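(* Let $\alpha:\mathbb{R}\to[c,d]\subset(1,2)$ and $b:\mathbb{R}\to(0,\infty)$ be continuously differentiable. Let $(\Gamma_i)_{i\ge1}$ be the sequence of arrival times of a Poisson process with unit rate, let $(V_i)_{i\ge1}$ be a sequence of i.i.d. random variables with distribution $\hat m(dx)=\frac{3}{\pi^2}\sum_{j=1}^{\infty}j^{-2}\,\mathbf{1}_{[-j,-j+1)\cup[j-1,j)}(x)\,dx$ on $\mathbb{R}$, and let $(\gamma_i)_{i\ge1}$ be a sequence of i.i.d. random variables with $P(\gamma_i=1)=P(\gamma_i=-1)=1/2$. Assume that the three sequences $(\Gamma_i)_{i\ge1}$, $(V_i)_{i\ge1}$, $(\gamma_i)_{i\ge1}$ are independent, and define $$Y(t)=b(t)\,C_{\alpha(t)}^{1/\alpha(t)}\sum_{i=1}^{\infty}\sum_{j=1}^{\infty}\gamma_i\,\Gamma_i^{-1/\alpha(t)}\big(\log|t-V_i|-\log|V_i|\big)\frac{\pi^{2/\alpha(t)}}{3^{1/\alpha(t)}}\,j^{2/\alpha(t)}\,\mathbf{1}_{[-j,-j+1)\cup[j-1,j)}(V_i)\qquad(t\in\mathbb{R}).$$ Then $Y$ is $1/\alpha(u)$-localisable at every $u\in\mathbb{R}$, with local form $Y'_u=b(u)\Lambda_{\alpha(u)}$.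
   Context: $C_\alpha=\left(\int_0^\infty x^{-\alpha}\sin(x)\,dx\right)^{-1}$. In the double sum, for each $i$ exactly one index $j$ gives a non-zero indicator; the sum over $j$ is performed first. For $\alpha\in(1,2)$, $\Lambda_\alpha$ denotes log-fractional stable motion, $$\Lambda_\alpha(t)=\int_{-\infty}^{\infty}\big(\log|t-x|-\log|x|\big)\,M(dx)\qquad(t\in\mathbb{R}),$$ where $M$ is a symmetric $\alpha$-stable random measure on $\mathbb{R}$ with Lebesgue control measure; i.e. for $f\in L^\alpha(\mathbb{R})$, $\int f\,dM$ is symmetric $\alpha$-stable with characteristic function $\theta\mapsto\exp(-|\theta|^\alpha\int|f(x)|^\alpha dx)$, and $f\mapsto\int f\,dM$ is linear. Localisability: a process $Y=\{Y(t):t\in\mathbb{R}\}$ is $h$-localisable at $u$ if there is a non-trivial process $Y'_u=\{Y'_u(t):t\in\mathbb{R}\}$, called the local form of $Y$ at $u$, such that $r^{-h}(Y(u+rt)-Y(u))\to Y'_u(t)$ as $r\to0^+$ in the sense of convergence of finite-dimensional distributions (as processes in $t$). Local forms are identified up to equality of finite-dimensional distributions. *)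

theory Defs
  imports "HOL-Probability.Probability"
begin

definition stochastic_process :: "'w measure \<Rightarrow> (real \<Rightarrow> 'w \<Rightarrow> real) \<Rightarrow> bool" where
  "stochastic_process M X \<longleftrightarrow> prob_space M \<and> (\<forall>t. X t \<in> borel_measurable M)"

text \<open>
  Weak convergence of the laws of \<open>(X r t)\<close>, \<open>t \<in> J\<close>, on \<open>\<real>\<^sup>J\<close> for every finite set \<open>J\<close> of
  times, tested on bounded continuous functions. Points of \<open>\<real>\<^sup>J\<close> are extensional functions
  on \<open>J\<close>.
\<close>

definition fdd_convergent ::
  "'w measure \<Rightarrow> ('i \<Rightarrow> real \<Rightarrow> 'w \<Rightarrow> real) \<Rightarrow> 'v measure \<Rightarrow> (real \<Rightarrow> 'v \<Rightarrow> real) \<Rightarrow> 'i filter \<Rightarrow> bool"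
where
  "fdd_convergent M X N Z F \<longleftrightarrow>
     (\<forall>(J :: real set) (g :: (real \<Rightarrow> real) \<Rightarrow> real).
        finite J \<longrightarrow>
        continuous_map (product_topology (\<lambda>_. euclideanreal) J) euclideanreal g \<longrightarrow>
        bounded (g ` (J \<rightarrow>\<^sub>E UNIV)) \<longrightarrow>
        ((\<lambda>r. \<integral>\<omega>. g (\<lambda>t\<in>J. X r t \<omega>) \<partial>M) \<longlongrightarrow> (\<integral>\<omega>. g (\<lambda>t\<in>J. Z t \<omega>) \<partial>N)) F)"

definition has_local_form ::
  "'w measure \<Rightarrow> (real \<Rightarrow> 'w \<Rightarrow> real) \<Rightarrow> real \<Rightarrow> real \<Rightarrow> 'v measure \<Rightarrow> (real \<Rightarrow> 'v \<Rightarrow> real) \<Rightarrow> bool"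
where
  "has_local_form M Y h u N Y' \<longleftrightarrow>
     stochastic_process M Y \<and> stochastic_process N Y' \<and>
     (\<exists>t. \<not> (AE \<omega> in N. Y' t \<omega> = 0)) \<and>
     fdd_convergent M (\<lambda>r t \<omega>. r powr (- h) * (Y (u + r * t) \<omega> - Y u \<omega>)) N Y' (at_right 0)"

text \<open>
  Every real-valued process indexed by \<open>\<real>\<close> has a version with the same finite-dimensional
  distributions on the path space, so the local form may be sought on a sample space of
  type \<^typ>\<open>real \<Rightarrow> real\<close>.
\<close>

definition localisable_at ::
  "'w measure \<Rightarrow> (real \<Rightarrow> 'w \<Rightarrow> real) \<Rightarrow> real \<Rightarrow> real \<Rightarrow> bool"
where
  "localisable_at M Y h u \<longleftrightarrow>
     (\<exists>(N :: (real \<Rightarrow> real) measure) Y'. has_local_form M Y h u N Y')"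

definition L_space :: "real \<Rightarrow> (real \<Rightarrow> real) set" where
  "L_space a = {f \<in> borel_measurable lborel. integrable lborel (\<lambda>x. \<bar>f x\<bar> powr a)}"

text \<open>
  A symmetric stable random measure of index \<open>a\<close> with Lebesgue control measure, given through
  its integral \<open>I f\<close> for \<open>f\<close> in \<open>L_space a\<close>. As the integrals are random variables, linearity
  is almost sure.
\<close>

definition sas_random_measure ::
  "'v measure \<Rightarrow> real \<Rightarrow> ((real \<Rightarrow> real) \<Rightarrow> 'v \<Rightarrow> real) \<Rightarrow> bool"
where
  "sas_random_measure N a I \<longleftrightarrow>
     prob_space N \<and>
     (\<forall>f\<in>L_space a. I f \<in> borel_measurable N) \<and>
     (\<forall>f\<in>L_space a. \<forall>\<theta>.
        char (distr N borel (I f)) \<theta> =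
          complex_of_real (exp (- (\<bar>\<theta>\<bar> powr a * (\<integral>x. \<bar>f x\<bar> powr a \<partial>lborel))))) \<and>
     (\<forall>f\<in>L_space a. \<forall>g\<in>L_space a. \<forall>p q.
        AE \<omega> in N. I (\<lambda>x. p * f x + q * g x) \<omega> = p * I f \<omega> + q * I g \<omega>)"

text \<open>The convention \<open>ln 0 = 0\<close> only affects the null set \<open>{0, t}\<close>.\<close>

definition log_kernel :: "real \<Rightarrow> real \<Rightarrow> real" where
  "log_kernel t x = ln \<bar>t - x\<bar> - ln \<bar>x\<bar>"

definition log_frac_stable_motion ::
  "((real \<Rightarrow> real) \<Rightarrow> 'v \<Rightarrow> real) \<Rightarrow> real \<Rightarrow> 'v \<Rightarrow> real"
where
  "log_frac_stable_motion I t = I (log_kernel t)"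

text \<open>
  The arrival times are the partial sums of independent exponential waiting times.
  All sequences start at index \<open>0\<close>: index \<open>i\<close> here is the usual index \<open>i + 1\<close>.
\<close>

definition poisson_arrival_times :: "'w measure \<Rightarrow> real \<Rightarrow> (nat \<Rightarrow> 'w \<Rightarrow> real) \<Rightarrow> bool" where
  "poisson_arrival_times M rate \<Gamma> \<longleftrightarrow>
     (let gap = (\<lambda>i \<omega>. \<Gamma> i \<omega> - (case i of 0 \<Rightarrow> 0 | Suc k \<Rightarrow> \<Gamma> k \<omega>)) in
        prob_space.indep_vars M (\<lambda>_. borel) gap UNIV \<and>
        (\<forall>i. distributed M lborel (gap i) (exponential_density rate)))"

definition shell :: "nat \<Rightarrow> real set" where
  "shell j = {- real (Suc j) ..< - real j} \<union> {real j ..< real (Suc j)}"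

definition m_hat_density :: "real \<Rightarrow> real" where
  "m_hat_density x = 3 / pi\<^sup>2 * (\<Sum>j. 1 / (real (Suc j))\<^sup>2 * indicator (shell j) x)"

text \<open>For \<open>1 < a < 2\<close> the integrand is absolutely integrable, so the Lebesgue integral is meant.\<close>

definition stable_const :: "real \<Rightarrow> real" where
  "stable_const a = inverse (LINT x:{0<..}|lborel. x powr (- a) * sin x)"

text \<open>
  For every \<open>\<omega>\<close> at most one summand of the inner sum is non-zero. The outer sum converges
  almost surely for each \<open>t\<close>, but in general not absolutely, so it is a sum in the order of
  the index.
\<close>

definition log_frac_multistable_motion ::
  "(real \<Rightarrow> real) \<Rightarrow> (real \<Rightarrow> real) \<Rightarrow> (nat \<Rightarrow> 'w \<Rightarrow> real) \<Rightarrow> (nat \<Rightarrow> 'w \<Rightarrow> real) \<Rightarrow> (nat \<Rightarrow> 'w \<Rightarrow> real)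
     \<Rightarrow> real \<Rightarrow> 'w \<Rightarrow> real"
where
  "log_frac_multistable_motion \<alpha> b \<Gamma> V \<gamma> t \<omega> =
     b t * stable_const (\<alpha> t) powr (1 / \<alpha> t) *
     (\<Sum>i. \<Sum>j. \<gamma> i \<omega> * \<Gamma> i \<omega> powr (- 1 / \<alpha> t) * log_kernel t (V i \<omega>) *
        (pi powr (2 / \<alpha> t) / 3 powr (1 / \<alpha> t)) * real (Suc j) powr (2 / \<alpha> t) *
        indicator (shell j) (V i \<omega>))"

end

theory Submission
  imports Defs
begin

text \<open>
  The idea is to see every value of \<open>Y\<close> as a sum over one Poisson process. Put
  \<open>m = m_hat_density\<close> and \<open>v\<^sub>i = \<Gamma>\<^sub>i m(V\<^sub>i)\<close>. The weights \<open>j\<^sup>2 \<pi>\<^sup>2 / 3\<close> in the definition of \<open>Y\<close> are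
  exactly \<open>1 / m\<close>, so almost surely
  \<open>Y(t) = b(t) C\<^bsub>\<alpha>(t)\<^esub>\<^bsup>1/\<alpha>(t)\<^esup> \<Sum>\<^sub>i \<gamma>\<^sub>i v\<^sub>i\<^bsup>-1/\<alpha>(t)\<^esup> K\<^sub>t(V\<^sub>i)\<close> with \<open>K\<^sub>t(x) = log \<bar>t - x\<bar> - log \<bar>x\<bar>\<close>,
  and the points \<open>(v\<^sub>i, V\<^sub>i)\<close> form a Poisson process with Lebesgue intensity on
  \<open>(0,\<infinity>) \<times> \<real>\<close>: whatever the positive density \<open>m\<close>, the scaling \<open>s \<mapsto> s m(x)\<close> turns the measure
  \<open>ds m(x) dx\<close> into \<open>dv dx\<close> (\<open>Campbell_formula\<close>).

  A series \<open>\<Sum>\<^sub>i \<gamma>\<^sub>i G(v\<^sub>i, V\<^sub>i)\<close> over these points is controlled by the single number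
  \<open>mass G = \<integral>\<integral> min 1 (G\<^sup>2) dv dx\<close>: if it is finite, the series converges almost surely, and
  \<open>E min 1 (S\<^sup>2) \<le> mass G\<close> for its sum \<open>S\<close> (\<open>random_series\<close>). Only finitely many terms exceed
  \<open>1\<close>, and the truncated terms are bounded martingale differences because of the random signs.

  For \<open>G(v, x) = f(x) v\<^bsup>-1/a\<^esup>\<close> with \<open>f\<close> in \<open>L\<^sup>a\<close> the sum is symmetric stable, with the explicit
  characteristic function of \<open>char_random_series\<close>. Hence \<open>f \<mapsto> C\<^sub>a\<^bsup>1/a\<^esup> \<Sum>\<^sub>i \<gamma>\<^sub>i v\<^sub>i\<^bsup>-1/a\<^esup> f(V\<^sub>i)\<close> is
  itself a stable random measure \<open>I\<close> on the sample space of \<open>Y\<close>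
  (\<open>sas_random_measure_lepage\<close>), and \<open>Y(t) = b(t) I(K\<^sub>t)\<close> with index \<open>a = \<alpha>(t)\<close>.

  Now fix \<open>u\<close> and put \<open>a = \<alpha>(u)\<close>. If index and amplitude are frozen at their values at \<open>u\<close>, the
  increments of \<open>b(u) I(K\<^sub>t)\<close> are exactly self-similar: \<open>K\<^bsub>u+rt\<^esub>(u+ry) - K\<^sub>u(u+ry) = K\<^sub>t(y)\<close> for
  almost all \<open>y\<close>, so that \<open>r\<^bsup>-1/a\<^esup> b(u) (I(K\<^bsub>u+rt\<^esub>) - I(K\<^sub>u))\<close> has the law of \<open>b(u) \<Lambda>\<^sub>a(t)\<close> for every \<open>r > 0\<close>, jointly
  in \<open>t\<close> (\<open>increment_law\<close>). Freezing costs little (\<open>freezing_error_tendsto_0\<close>): at time \<open>u + rt\<close>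
  the coefficients \<open>b C\<^bsup>1/\<alpha>\<^esup> v\<^bsup>-1/\<alpha>\<^esup>\<close> move by \<open>O(r)\<close> times a sum of two powers of \<open>v\<close>, and since
  \<open>a > 1\<close> the factor \<open>r\<^bsup>-1/a\<^esup> r\<close> tends to \<open>0\<close>; the bound by \<open>mass\<close> turns this into convergence to
  \<open>0\<close> in probability. A Slutsky argument for random vectors (\<open>Slutsky_tendsto\<close>) concludes.

  The existence of a stable random measure on the path space \<open>\<real> \<Rightarrow> \<real>\<close> is obtained by coding the
  three sequences \<open>\<Gamma>\<close>, \<open>V\<close>, \<open>\<gamma>\<close> into one function on \<open>\<real>\<close>.
\<close>

section \<open>Independence of doubly indexed families\<close>

text \<open>
  The waiting times, positions and signs are given as three independent sequences, each of
  independent entries. This turns them into one independent family, which can then be cut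
  along the time axis instead. An event of finitely many coordinates is an intersection of
  one cylinder per row, so its probability factors first over rows and then within each row.
\<close>

lemma (in prob_space) indep_vars_Times:
  assumes rows: "\<And>k. k \<in> K \<Longrightarrow> indep_vars (\<lambda>_. N) (X k) I"
    and cols: "indep_vars (\<lambda>_. PiM I (\<lambda>_. N)) (\<lambda>k \<omega>. \<lambda>i\<in>I. X k i \<omega>) K"
  shows "indep_vars (\<lambda>_. N) (\<lambda>p. X (fst p) (snd p)) (K \<times> I)"
  unfolding indep_vars_def2
proof (intro conjI ballI indep_setsI)
  fix p assume "p \<in> K \<times> I"
  then show rv: "random_variable N (X (fst p) (snd p))"
    using rows by (auto simp: indep_vars_def2)
  then show "{X (fst p) (snd p) -` A \<inter> space M |A. A \<in> sets N} \<subseteq> events"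
    by (auto intro: measurable_sets)
next
  fix A J assume J: "J \<noteq> {}" "J \<subseteq> K \<times> I" "finite J"
    and A: "\<forall>p\<in>J. A p \<in> {X (fst p) (snd p) -` B \<inter> space M |B. B \<in> sets N}"
  from A obtain B where B: "\<And>p. p \<in> J \<Longrightarrow> B p \<in> sets N"
    "\<And>p. p \<in> J \<Longrightarrow> A p = X (fst p) (snd p) -` B p \<inter> space M"
    by (simp add: bchoice_iff) metis
  define K' where "K' = fst ` J"
  define J' where "J' k = {i. (k, i) \<in> J}" for k
  \<comment> \<open>the cylinder cut out by the prescribed coordinates of row k\<close>
  define C where "C k = {x \<in> space (PiM I (\<lambda>_. N)). \<forall>i\<in>J' k. x i \<in> B (k, i)}" for k
  have J'_fin: "finite (J' k)" for k
    using finite_imageI[OF J(3), of snd] by (rule rev_finite_subset) (force simp: J'_def)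
  have J'_I: "J' k \<subseteq> I" for k using J(2) by (auto simp: J'_def)
  have K': "K' \<noteq> {}" "finite K'" "K' \<subseteq> K" using J by (auto simp: K'_def)
  have J_eq: "J = Sigma K' J'" by (force simp: K'_def J'_def)
  have C: "C k \<in> sets (PiM I (\<lambda>_. N))" for k
  proof -
    have "C k = (\<Inter>i\<in>J' k. {x \<in> space (PiM I (\<lambda>_. N)). x i \<in> B (k, i)}) \<inter> space (PiM I (\<lambda>_. N))"
      by (auto simp: C_def)
    also have "\<dots> \<in> sets (PiM I (\<lambda>_. N))"
    proof (cases "J' k = {}")
      case False
      have "{x \<in> space (PiM I (\<lambda>_. N)). x i \<in> B (k, i)} \<in> sets (PiM I (\<lambda>_. N))" if "i \<in> J' k" for i
        using B(1)[of "(k, i)"] that J'_I[of k]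
        by (intro sets_Collect_single) (auto simp: J'_def)
      then show ?thesis
        using False J'_fin by (intro sets.Int sets.finite_INT) auto
    qed auto
    finally show ?thesis .
  qed
  have XK: "X k i \<in> measurable M N" if "k \<in> K" "i \<in> I" for k i
    using rows[OF that(1)] that(2) by (auto simp: indep_vars_def2)
  have C_eq: "(\<lambda>\<omega>. \<lambda>i\<in>I. X k i \<omega>) -` C k \<inter> space M = (\<Inter>i\<in>J' k. X k i -` B (k, i) \<inter> space M)"
    if "k \<in> K'" for k
  proof -
    have k: "k \<in> K" using that K' by auto
    have ne: "J' k \<noteq> {}" using that by (auto simp: K'_def J'_def)
    have sp: "(\<lambda>i\<in>I. X k i \<omega>) \<in> space (PiM I (\<lambda>_. N))" if "\<omega> \<in> space M" for \<omega>
      using measurable_space[OF XK[OF k] that] by (auto simp: space_PiM)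
    have r: "(\<lambda>i\<in>I. X k i \<omega>) i = X k i \<omega>" if "i \<in> J' k" for i \<omega>
      using J'_I[of k] that by auto
    show ?thesis
      using sp ne r by (auto simp: C_def simp del: restrict_apply)
  qed
  have "(\<Inter>p\<in>J. A p) = (\<Inter>p\<in>J. X (fst p) (snd p) -` B p \<inter> space M)"
    by (rule INF_cong[OF refl]) (rule B(2))
  also have "\<dots> = (\<Inter>k\<in>K'. \<Inter>i\<in>J' k. X k i -` B (k, i) \<inter> space M)"
    unfolding J_eq by (rule set_eqI, simp only: INT_iff) auto
  also have "\<dots> = (\<Inter>k\<in>K'. (\<lambda>\<omega>. \<lambda>i\<in>I. X k i \<omega>) -` C k \<inter> space M)"
    by (rule INF_cong[OF refl]) (rule C_eq[symmetric])
  also have "prob \<dots> = (\<Prod>k\<in>K'. prob ((\<lambda>\<omega>. \<lambda>i\<in>I. X k i \<omega>) -` C k \<inter> space M))"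
    by (rule indep_varsD[OF cols]) (use K' C in auto)
  also have "\<dots> = (\<Prod>k\<in>K'. \<Prod>i\<in>J' k. prob (X k i -` B (k, i) \<inter> space M))"
  proof (rule prod.cong[OF refl])
    fix k assume k: "k \<in> K'"
    then have "k \<in> K" "J' k \<noteq> {}" using K' by (auto simp: K'_def J'_def)
    then show "prob ((\<lambda>\<omega>. \<lambda>i\<in>I. X k i \<omega>) -` C k \<inter> space M) = (\<Prod>i\<in>J' k. prob (X k i -` B (k, i) \<inter> space M))"
      unfolding C_eq[OF k]
      using indep_varsD[OF rows[of k], of "J' k" "\<lambda>i. B (k, i)"] J'_fin[of k] J'_I[of k] B(1)
      by (auto simp: J'_def)
  qed
  also have "\<dots> = (\<Prod>p\<in>J. prob (X (fst p) (snd p) -` B p \<inter> space M))"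
    unfolding J_eq using K' J'_fin by (simp add: prod.Sigma case_prod_beta)
  also have "\<dots> = (\<Prod>p\<in>J. prob (A p))"
    using B(2) by simp
  finally show "prob (\<Inter>p\<in>J. A p) = (\<Prod>p\<in>J. prob (A p))" .
qed

text \<open>
  Independence only concerns the generated \<open>\<sigma>\<close>-algebras. Measurability with respect to
  \<open>vimage_algebra\<close> therefore replaces explicit functions of the conditioning variables.
\<close>

lemma (in prob_space) indep_var_vimage_algebra:
  assumes ind: "indep_var N X T Y"
    and Z: "Z \<in> measurable (vimage_algebra (space M) X N) S"
    and W: "W \<in> measurable (vimage_algebra (space M) Y T) R"
  shows "indep_var S Z R W"
proof -
  have X: "X \<in> measurable M N" and Y: "Y \<in> measurable M T"
    using indep_var_rv1[OF ind] indep_var_rv2[OF ind] by auto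
  have sp: "X \<in> space M \<rightarrow> space N" "Y \<in> space M \<rightarrow> space T"
    using measurable_space[OF X] measurable_space[OF Y] by auto
  have ZM: "Z \<in> measurable M S" and WM: "W \<in> measurable M R"
    using Z W sets_image_in_sets[OF refl X] sets_image_in_sets[OF refl Y] by (auto simp: measurable_def)
  have "prob (a \<inter> b) = prob a * prob b" if "a \<in> {Z -` A \<inter> space M |A. A \<in> sets S}"
     "b \<in> {W -` A \<inter> space M |A. A \<in> sets R}" for a b
  proof -
    from that obtain A B where A: "A \<in> sets S" "a = Z -` A \<inter> space M" and B: "B \<in> sets R" "b = W -` B \<inter> space M" by auto
    have "a \<in> sets (vimage_algebra (space M) X N)" "b \<in> sets (vimage_algebra (space M) Y T)"
      using measurable_sets[OF Z A(1)] measurable_sets[OF W B(1)] A(2) B(2) by simp_all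
    then obtain A' B' where "A' \<in> sets N" "a = X -` A' \<inter> space M" "B' \<in> sets T" "b = Y -` B' \<inter> space M"
      using sp by (auto simp: sets_vimage_algebra2)
    moreover have "(X -` A' \<inter> space M) \<inter> (Y -` B' \<inter> space M) = (\<lambda>x. (X x, Y x)) -` (A' \<times> B') \<inter> space M"
      by auto
    ultimately show ?thesis
      using indep_varD[OF ind, of A' B'] by simp
  qed
  then have "indep_set {Z -` A \<inter> space M |A. A \<in> sets S} {W -` A \<inter> space M |A. A \<in> sets R}"
    using ZM WM by (intro indep_setI) (auto intro: measurable_sets)
  moreover have "Int_stable {f -` A \<inter> space M |A. A \<in> sets L}" for f :: "'a \<Rightarrow> 'z" and L
    by (auto simp: Int_stable_def) (rule_tac x="A \<inter> Aa" in exI, auto)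
  ultimately show ?thesis
    unfolding indep_var_eq using ZM WM by (auto intro!: indep_set_sigma_sets)
qed

text \<open>
  Fubini for the joint law, with the inner integration variable drawn again from the same
  probability space; no law has to be named.
\<close>

lemma (in prob_space) expectation_indep_pair:
  fixes h :: "_ \<Rightarrow> 'c::{banach, second_countable_topology}"
  assumes ind: "indep_var S X T Y" and h[measurable]: "h \<in> borel_measurable (S \<Otimes>\<^sub>M T)" and bd: "\<And>p. norm (h p) \<le> B"
  shows "(\<integral>\<omega>. h (X \<omega>, Y \<omega>) \<partial>M) = (\<integral>\<omega>. \<integral>\<omega>'. h (X \<omega>, Y \<omega>') \<partial>M \<partial>M)"
proof -
  have [measurable]: "X \<in> measurable M S" "Y \<in> measurable M T"
    using indep_var_rv1[OF ind] indep_var_rv2[OF ind] by auto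
  interpret X: prob_space "distr M S X" by (rule prob_space_distr) measurable
  interpret Y: prob_space "distr M T Y" by (rule prob_space_distr) measurable
  interpret XY: pair_prob_space "distr M S X" "distr M T Y" ..
  have hm: "h \<in> borel_measurable (distr M S X \<Otimes>\<^sub>M distr M T Y)" by simp
  have "(\<integral>\<omega>. h (X \<omega>, Y \<omega>) \<partial>M) = (\<integral>p. h p \<partial>distr M (S \<Otimes>\<^sub>M T) (\<lambda>\<omega>. (X \<omega>, Y \<omega>)))"
    by (subst integral_distr) auto
  also have "\<dots> = (\<integral>p. h p \<partial>(distr M S X \<Otimes>\<^sub>M distr M T Y))"
    using ind unfolding indep_var_distribution_eq by simp
  also have "\<dots> = (\<integral>x. \<integral>y. h (x, y) \<partial>distr M T Y \<partial>distr M S X)"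
    by (rule XY.integral_fst'[symmetric]) (rule XY.P.integrable_const_bound[where B=B, OF _ hm], use bd in auto)
  also have "\<dots> = (\<integral>\<omega>. \<integral>y. h (X \<omega>, y) \<partial>distr M T Y \<partial>M)"
    by (subst integral_distr) (auto intro!: Y.borel_measurable_lebesgue_integral)
  also have "\<dots> = (\<integral>\<omega>. \<integral>\<omega>'. h (X \<omega>, Y \<omega>') \<partial>M \<partial>M)"
    by (intro Bochner_Integration.integral_cong refl integral_distr) (auto dest: measurable_space[rotated])
  finally show ?thesis .
qed

section \<open>Series of bounded martingale differences\<close>

text \<open>
  The hypothesis \<open>orth\<close> says that \<open>X j\<close> has conditional mean \<open>0\<close> given \<open>F j\<close>. Hence for a
  predictable multiplier \<open>\<eta>\<close> all cross terms vanish, and only the squares remain.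
\<close>

lemma (in prob_space) martingale_transform_second_moment:
  fixes X \<eta> :: "nat \<Rightarrow> 'a \<Rightarrow> real"
  assumes F: "\<And>n. subalgebra M (F n)" "\<And>i j. i \<le> j \<Longrightarrow> subalgebra (F j) (F i)"
    and X: "\<And>i. X i \<in> borel_measurable (F (Suc i))" "\<And>i \<omega>. \<bar>X i \<omega>\<bar> \<le> 1"
    and orth: "\<And>j Z B. Z \<in> borel_measurable (F j) \<Longrightarrow> (\<And>\<omega>. \<bar>Z \<omega>\<bar> \<le> B) \<Longrightarrow> (\<integral>\<omega>. X j \<omega> * Z \<omega> \<partial>M) = 0"
    and \<eta>: "\<And>i. \<eta> i \<in> borel_measurable (F i)" "\<And>i \<omega>. \<bar>\<eta> i \<omega>\<bar> \<le> 1"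
  shows "(\<integral>\<omega>. (\<Sum>i<n. X i \<omega> * \<eta> i \<omega>)\<^sup>2 \<partial>M) \<le> (\<Sum>i<n. \<integral>\<omega>. (X i \<omega>)\<^sup>2 \<partial>M)"
proof (induction n)
  case 0 show ?case by simp
next
  case (Suc n)
  define T where "T \<omega> = (\<Sum>i<n. X i \<omega> * \<eta> i \<omega>)" for \<omega>
  have XF: "X i \<in> borel_measurable (F n)" if "i < n" for i
    using measurable_from_subalg[OF F(2) X(1), of "i" n] that by auto
  have \<eta>F: "\<eta> i \<in> borel_measurable (F n)" if "i < n" for i
    using measurable_from_subalg[OF F(2) \<eta>(1), of "i" n] that by auto
  have TF[measurable]: "T \<in> borel_measurable (F n)"
    unfolding T_def using XF \<eta>F by measurable
  have [measurable]: "\<eta> n \<in> borel_measurable (F n)" by (rule \<eta>)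
  have [measurable]: "T \<in> borel_measurable M" "\<eta> n \<in> borel_measurable M" "X n \<in> borel_measurable M"
    using measurable_from_subalg[OF F(1) TF] measurable_from_subalg[OF F(1) \<eta>(1)] measurable_from_subalg[OF F(1) X(1)] by auto
  have X\<eta>: "\<bar>X i \<omega> * \<eta> i \<omega>\<bar> \<le> 1" for i \<omega>
    using mult_mono[OF X(2)[of i \<omega>] \<eta>(2)[of i \<omega>]] by (simp add: abs_mult)
  have T_bd: "\<bar>T \<omega>\<bar> \<le> real n" for \<omega>
    unfolding T_def by (rule order_trans[OF sum_abs]) (use sum_mono[of "{..<n}" "\<lambda>i. \<bar>X i \<omega> * \<eta> i \<omega>\<bar>" "\<lambda>_. 1"] X\<eta> in simp)
  have Z_bd: "\<bar>\<eta> n \<omega> * T \<omega>\<bar> \<le> real n" for \<omega>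
    using mult_mono[OF \<eta>(2)[of n \<omega>] T_bd[of \<omega>]] by (simp add: abs_mult)
  have cross: "(\<integral>\<omega>. X n \<omega> * (\<eta> n \<omega> * T \<omega>) \<partial>M) = 0"
    by (rule orth[OF _ Z_bd]) measurable
  have i1: "integrable M (\<lambda>\<omega>. (T \<omega>)\<^sup>2)"
    by (rule integrable_const_bound[where B="(real n)\<^sup>2"]) (use T_bd in \<open>auto simp: abs_le_square_iff[symmetric]\<close>)
  have i2: "integrable M (\<lambda>\<omega>. X n \<omega> * (\<eta> n \<omega> * T \<omega>))"
    by (rule integrable_const_bound[where B="real n"])
      (use mult_mono[OF X(2)[of n] Z_bd] in \<open>auto simp: abs_mult\<close>)
  have i3: "integrable M (\<lambda>\<omega>. (X n \<omega> * \<eta> n \<omega>)\<^sup>2)"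
    by (rule integrable_const_bound[where B="1"]) (use X\<eta> in \<open>auto simp: abs_square_le_1\<close>)
  have i4: "integrable M (\<lambda>\<omega>. (X n \<omega>)\<^sup>2)"
    by (rule integrable_const_bound[where B="1"]) (use X in \<open>auto simp: abs_square_le_1\<close>)
  have "(\<integral>\<omega>. (\<Sum>i<Suc n. X i \<omega> * \<eta> i \<omega>)\<^sup>2 \<partial>M)
      = (\<integral>\<omega>. ((T \<omega>)\<^sup>2 + 2 * (X n \<omega> * (\<eta> n \<omega> * T \<omega>))) + (X n \<omega> * \<eta> n \<omega>)\<^sup>2 \<partial>M)"
    by (intro Bochner_Integration.integral_cong) (auto simp: T_def power2_sum algebra_simps)
  also have "\<dots> = (\<integral>\<omega>. (T \<omega>)\<^sup>2 \<partial>M) + (\<integral>\<omega>. (X n \<omega> * \<eta> n \<omega>)\<^sup>2 \<partial>M)"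
    using i1 i2 i3 cross by (simp del: mult.assoc)
  also have "(\<integral>\<omega>. (X n \<omega> * \<eta> n \<omega>)\<^sup>2 \<partial>M) \<le> (\<integral>\<omega>. (X n \<omega>)\<^sup>2 \<partial>M)"
  proof (rule integral_mono[OF i3 i4])
    fix \<omega> show "(X n \<omega> * \<eta> n \<omega>)\<^sup>2 \<le> (X n \<omega>)\<^sup>2"
      using \<eta>(2)[of n \<omega>] by (simp add: power_mult_distrib abs_square_le_1 mult_left_le)
  qed
  finally show ?case using Suc by (simp add: T_def)
qed

text \<open>
  Stop the sum when it first leaves \<open>[-e, e]\<close>. The stopped sum is a martingale transform, so its
  second moment is at most the sum of the variances; and where the maximum exceeds \<open>e\<close>, the
  stopped sum still exceeds \<open>e\<close> at the end, so that Markov's inequality applies.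
\<close>

lemma (in prob_space) Kolmogorov_maximal_inequality:
  fixes X :: "nat \<Rightarrow> 'a \<Rightarrow> real"
  assumes F: "\<And>n. subalgebra M (F n)" "\<And>i j. i \<le> j \<Longrightarrow> subalgebra (F j) (F i)"
    and X: "\<And>i. X i \<in> borel_measurable (F (Suc i))" "\<And>i \<omega>. \<bar>X i \<omega>\<bar> \<le> 1"
    and orth: "\<And>j Z B. Z \<in> borel_measurable (F j) \<Longrightarrow> (\<And>\<omega>. \<bar>Z \<omega>\<bar> \<le> B) \<Longrightarrow> (\<integral>\<omega>. X j \<omega> * Z \<omega> \<partial>M) = 0"
    and e: "0 < e"
  shows "prob {\<omega>\<in>space M. \<exists>k\<in>{m..n}. e < \<bar>\<Sum>i\<in>{m..<k}. X i \<omega>\<bar>} \<le> (\<Sum>i\<in>{m..<n}. \<integral>\<omega>. (X i \<omega>)\<^sup>2 \<partial>M) / e\<^sup>2"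
proof -
  define S where "S k \<omega> = (\<Sum>i\<in>{m..<k}. X i \<omega>)" for k \<omega>
  define \<eta> where "\<eta> i \<omega> = (if \<forall>k\<in>{m..i}. \<bar>S k \<omega>\<bar> \<le> e then 1 else 0 :: real)" for i \<omega>
  \<comment> \<open>setting the terms before m to zero makes the sum from m on a transform as well\<close>
  define W where "W i \<omega> = (if m \<le> i then X i \<omega> else 0)" for i \<omega>
  define T where "T \<omega> = (\<Sum>i<n. W i \<omega> * \<eta> i \<omega>)" for \<omega>
  have XF: "X i \<in> borel_measurable (F j)" if "i < j" for i j
    using measurable_from_subalg[OF F(2) X(1), of "i" j] that by auto
  have SF: "S k \<in> borel_measurable (F j)" if "k \<le> j" for k j
    unfolding S_def using XF that by (intro borel_measurable_sum) auto
  have \<eta>F: "\<eta> i \<in> borel_measurable (F i)" for i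
  proof -
    have [measurable]: "k \<in> {m..i} \<Longrightarrow> S k \<in> borel_measurable (F i)" for k using SF by auto
    have "{\<omega>\<in>space (F i). \<forall>k\<in>{m..i}. \<bar>S k \<omega>\<bar> \<le> e} \<in> sets (F i)"
      by measurable
    then show ?thesis unfolding \<eta>_def by measurable
  qed
  have W: "W i \<in> borel_measurable (F (Suc i))" "\<bar>W i \<omega>\<bar> \<le> 1" for i \<omega>
    using X unfolding W_def by (cases "m \<le> i"; auto)+
  have WM: "W i \<in> borel_measurable M" "\<eta> i \<in> borel_measurable M" "X i \<in> borel_measurable M" for i
    using measurable_from_subalg[OF F(1) W(1)] measurable_from_subalg[OF F(1) \<eta>F] measurable_from_subalg[OF F(1) X(1)] by auto
  note [measurable] = WM
  have Tm[measurable]: "T \<in> borel_measurable M" unfolding T_def by measurable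
  have W\<eta>: "\<bar>W i \<omega> * \<eta> i \<omega>\<bar> \<le> 1" for i \<omega>
    using W(2)[of i \<omega>] by (auto simp: \<eta>_def)
  have \<eta>1: "\<bar>\<eta> i \<omega>\<bar> \<le> 1" for i \<omega>
    by (auto simp: \<eta>_def)
  have T_bd: "\<bar>T \<omega>\<bar> \<le> real n" for \<omega>
    unfolding T_def by (rule order_trans[OF sum_abs]) (use sum_mono[of "{..<n}" "\<lambda>i. \<bar>W i \<omega> * \<eta> i \<omega>\<bar>" "\<lambda>_. 1"] W\<eta> in simp)
  have iT: "integrable M (\<lambda>\<omega>. (T \<omega>)\<^sup>2)"
    by (rule integrable_const_bound[where B="(real n)\<^sup>2"]) (use T_bd in \<open>auto simp: abs_le_square_iff[symmetric]\<close>)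
  have ET: "(\<integral>\<omega>. (T \<omega>)\<^sup>2 \<partial>M) \<le> (\<Sum>i<n. \<integral>\<omega>. (W i \<omega>)\<^sup>2 \<partial>M)"
    unfolding T_def
  proof (rule martingale_transform_second_moment[where F=F])
    fix j :: nat and Z :: "'a \<Rightarrow> real" and B assume "Z \<in> borel_measurable (F j)" "\<And>\<omega>. \<bar>Z \<omega>\<bar> \<le> B"
    from orth[OF this] show "(\<integral>\<omega>. W j \<omega> * Z \<omega> \<partial>M) = 0" by (cases "m \<le> j") (simp_all add: W_def)
  qed (fact F W \<eta>F \<eta>1)+
  also have "\<dots> = (\<Sum>i\<in>{m..<n}. \<integral>\<omega>. (X i \<omega>)\<^sup>2 \<partial>M)"
    by (rule sum.mono_neutral_cong_right) (auto simp: W_def)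
  finally have ET': "(\<integral>\<omega>. (T \<omega>)\<^sup>2 \<partial>M) \<le> (\<Sum>i\<in>{m..<n}. \<integral>\<omega>. (X i \<omega>)\<^sup>2 \<partial>M)" .
  have sub: "e\<^sup>2 \<le> (T \<omega>)\<^sup>2" if ex: "\<exists>k\<in>{m..n}. e < \<bar>S k \<omega>\<bar>" for \<omega>
  proof -
    define k0 where "k0 = (LEAST k. m \<le> k \<and> e < \<bar>S k \<omega>\<bar>)"
    from ex have ex': "\<exists>k. m \<le> k \<and> e < \<bar>S k \<omega>\<bar>" by auto
    have k0: "m \<le> k0" "e < \<bar>S k0 \<omega>\<bar>" using LeastI_ex[OF ex'] by (auto simp: k0_def)
    obtain k' where k': "m \<le> k'" "k' \<le> n" "e < \<bar>S k' \<omega>\<bar>" using ex by auto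
    have "k0 \<le> k'" unfolding k0_def by (rule Least_le) (use k' in auto)
    then have k0n: "k0 \<le> n" using k' by simp
    have min: "\<bar>S k \<omega>\<bar> \<le> e" if "m \<le> k" "k < k0" for k
      using not_less_Least[of k "\<lambda>k. m \<le> k \<and> e < \<bar>S k \<omega>\<bar>"] that by (auto simp: k0_def)
    have \<eta>1: "\<eta> i \<omega> = 1" if "i < k0" for i using that min by (auto simp: \<eta>_def)
    have \<eta>0: "\<eta> i \<omega> = 0" if "k0 \<le> i" for i using that k0 by (force simp: \<eta>_def)
    have "T \<omega> = S k0 \<omega>"
      unfolding T_def S_def
    proof (rule sum.mono_neutral_cong_right)
      show "{m..<k0} \<subseteq> {..<n}" using k0n by auto
    qed (use \<eta>0 \<eta>1 in \<open>auto simp: W_def not_less not_le\<close>)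
    then show ?thesis using k0(2) e by (metis abs_le_square_iff abs_of_pos less_imp_le)
  qed
  have "prob {\<omega>\<in>space M. \<exists>k\<in>{m..n}. e < \<bar>S k \<omega>\<bar>} \<le> prob {\<omega>\<in>space M. e\<^sup>2 \<le> (T \<omega>)\<^sup>2}"
    by (rule finite_measure_mono) (use sub in auto)
  also have "\<dots> \<le> (\<integral>\<omega>. (T \<omega>)\<^sup>2 \<partial>M) / e\<^sup>2"
    using integral_Markov_inequality_measure[OF iT, of "space M" "e\<^sup>2"] e by auto
  also have "\<dots> \<le> (\<Sum>i\<in>{m..<n}. \<integral>\<omega>. (X i \<omega>)\<^sup>2 \<partial>M) / e\<^sup>2"
    using ET' by (simp add: divide_right_mono)
  finally show ?thesis by (simp add: S_def)
qed

text \<open>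
  By the maximal inequality the oscillation after index \<open>m\<close> exceeds a given level with a
  probability bounded by the tail of the variance series. So almost surely the partial sums
  are Cauchy; the second moment of the limit follows by Fatou.
\<close>

lemma (in prob_space) AE_summable_martingale_differences:
  fixes X :: "nat \<Rightarrow> 'a \<Rightarrow> real"
  assumes F: "\<And>n. subalgebra M (F n)" "\<And>i j. i \<le> j \<Longrightarrow> subalgebra (F j) (F i)"
    and X: "\<And>i. X i \<in> borel_measurable (F (Suc i))" "\<And>i \<omega>. \<bar>X i \<omega>\<bar> \<le> 1"
    and orth: "\<And>j Z B. Z \<in> borel_measurable (F j) \<Longrightarrow> (\<And>\<omega>. \<bar>Z \<omega>\<bar> \<le> B) \<Longrightarrow> (\<integral>\<omega>. X j \<omega> * Z \<omega> \<partial>M) = 0"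
    and sm: "summable (\<lambda>i. \<integral>\<omega>. (X i \<omega>)\<^sup>2 \<partial>M)"
  shows "AE \<omega> in M. summable (\<lambda>i. X i \<omega>)"
    and "(\<integral>\<^sup>+\<omega>. ennreal ((\<Sum>i. X i \<omega>)\<^sup>2) \<partial>M) \<le> ennreal (\<Sum>i. \<integral>\<omega>. (X i \<omega>)\<^sup>2 \<partial>M)"
proof -
  define v where "v i = (\<integral>\<omega>. (X i \<omega>)\<^sup>2 \<partial>M)" for i
  have v0: "0 \<le> v i" for i by (auto simp: v_def)
  have sv: "summable v" using sm by (simp add: v_def[abs_def])
  have [measurable]: "X i \<in> borel_measurable M" for i
    using measurable_from_subalg[OF F(1) X(1)] by auto
  have main: "AE \<omega> in M. \<exists>m. \<forall>k\<ge>m. \<bar>\<Sum>i\<in>{m..<k}. X i \<omega>\<bar> \<le> e" if e: "0 < e" for e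
  proof -
    define B where "B m n = {\<omega>\<in>space M. \<exists>k\<in>{m..n}. e < \<bar>\<Sum>i\<in>{m..<k}. X i \<omega>\<bar>}" for m n
    \<comment> \<open>the events that the sums started at m ever leave the interval\<close>
    define D where "D m = (\<Union>n. B m n)" for m
    have [measurable]: "B m n \<in> events" for m n unfolding B_def by measurable
    have [measurable]: "D m \<in> events" for m unfolding D_def by measurable
    have D_le: "prob (D m) \<le> (\<Sum>i. v (i + m)) / e\<^sup>2" for m
    proof -
      have "(\<lambda>n. prob (B m n)) \<longlonglongrightarrow> prob (D m)"
        unfolding D_def by (rule finite_Lim_measure_incseq) (auto simp: incseq_def B_def)
      moreover have "prob (B m n) \<le> (\<Sum>i. v (i + m)) / e\<^sup>2" for n
      proof -
        have "prob (B m n) \<le> (\<Sum>i\<in>{m..<n}. v i) / e\<^sup>2"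
          unfolding B_def v_def by (rule Kolmogorov_maximal_inequality[where F=F, OF F X _ e], assumption+, rule orth)
        also have "(\<Sum>i\<in>{m..<n}. v i) \<le> (\<Sum>i. v (i + m))"
        proof (cases "m \<le> n")
          case True
          have "(\<Sum>i\<in>{m..<n}. v i) = (\<Sum>i<n-m. v (i + m))"
            using True by (intro sum.reindex_bij_witness[of _ "\<lambda>i. i + m" "\<lambda>i. i - m"]) auto
          also have "\<dots> \<le> (\<Sum>i. v (i + m))"
            using sv v0 by (intro sum_le_suminf) (auto simp: summable_iff_shift)
          finally show ?thesis .
        next
          case False
          then show ?thesis using sv v0 by (auto intro!: suminf_nonneg simp: summable_iff_shift)
        qed
        finally show ?thesis by (simp add: divide_right_mono)
      qed
      ultimately show ?thesis by (intro LIMSEQ_le_const2) auto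
    qed
    have "prob (\<Inter>m. D m) \<le> 0"
    proof (rule LIMSEQ_le_const)
      have "(\<lambda>m. (\<Sum>i. v (i + m)) / e\<^sup>2) \<longlonglongrightarrow> 0 / e\<^sup>2"
        by (intro tendsto_divide suminf_exist_split2[OF sv] tendsto_const) (use e in auto)
      then show "(\<lambda>m. (\<Sum>i. v (i + m)) / e\<^sup>2) \<longlonglongrightarrow> 0" by simp
      show "\<exists>N. \<forall>m\<ge>N. prob (\<Inter>m. D m) \<le> (\<Sum>i. v (i + m)) / e\<^sup>2"
      proof (intro exI[of _ 0] allI impI)
        fix m
        have "prob (\<Inter>m. D m) \<le> prob (D m)" by (rule finite_measure_mono) auto
        then show "prob (\<Inter>m. D m) \<le> (\<Sum>i. v (i + m)) / e\<^sup>2" using D_le[of m] by linarith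
      qed
    qed
    then have "AE \<omega> in M. \<omega> \<notin> (\<Inter>m. D m)"
      by (intro AE_not_in) (auto simp: null_sets_def emeasure_eq_measure measure_le_0_iff)
    then show ?thesis
    proof (rule AE_mp, intro AE_I2 impI)
      fix \<omega> assume "\<omega> \<in> space M" "\<omega> \<notin> (\<Inter>m. D m)"
      then obtain m where "\<omega> \<notin> D m" by auto
      then have "\<bar>\<Sum>i\<in>{m..<k}. X i \<omega>\<bar> \<le> e" if "k \<ge> m" for k
        using that \<open>\<omega> \<in> space M\<close> by (force simp: D_def B_def not_less)
      then show "\<exists>m. \<forall>k\<ge>m. \<bar>\<Sum>i\<in>{m..<k}. X i \<omega>\<bar> \<le> e" by auto
    qed
  qed
  have "AE \<omega> in M. \<forall>N::nat. \<exists>m. \<forall>k\<ge>m. \<bar>\<Sum>i\<in>{m..<k}. X i \<omega>\<bar> \<le> 1 / Suc N"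
    by (subst AE_all_countable) (intro allI main, simp)
  then show summ: "AE \<omega> in M. summable (\<lambda>i. X i \<omega>)"
  proof (rule AE_mp, intro AE_I2 impI)
    fix \<omega> assume H: "\<forall>N::nat. \<exists>m. \<forall>k\<ge>m. \<bar>\<Sum>i\<in>{m..<k}. X i \<omega>\<bar> \<le> 1 / Suc N"
    show "summable (\<lambda>i. X i \<omega>)"
      unfolding summable_Cauchy
    proof (intro allI impI)
      fix e :: real assume "0 < e"
      then obtain N where N: "1 / Suc N < e / 2" using nat_approx_posE[of "e/2"] by auto
      obtain m where m: "\<And>k. k \<ge> m \<Longrightarrow> \<bar>\<Sum>i\<in>{m..<k}. X i \<omega>\<bar> \<le> 1 / Suc N" using H by blast
      show "\<exists>N. \<forall>m\<ge>N. \<forall>n. norm (sum (\<lambda>i. X i \<omega>) {m..<n}) < e"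
      proof (intro exI[of _ m] allI impI)
        fix j n assume j: "m \<le> j"
        show "norm (sum (\<lambda>i. X i \<omega>) {j..<n}) < e"
        proof (cases "j \<le> n")
          case True
          have "sum (\<lambda>i. X i \<omega>) {m..<j} + sum (\<lambda>i. X i \<omega>) {j..<n} = sum (\<lambda>i. X i \<omega>) {m..<n}"
            using j True by (rule sum.atLeastLessThan_concat)
          then show ?thesis using m[of j] m[of n] j True N by auto
        qed (use \<open>0 < e\<close> in auto)
      qed
    qed
  qed
  have "(\<integral>\<^sup>+\<omega>. ennreal ((\<Sum>i. X i \<omega>)\<^sup>2) \<partial>M) = (\<integral>\<^sup>+\<omega>. liminf (\<lambda>n. ennreal ((\<Sum>i<n. X i \<omega>)\<^sup>2)) \<partial>M)"
  proof (rule nn_integral_cong_AE, rule AE_mp[OF summ], intro AE_I2 impI)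
    fix \<omega> assume "summable (\<lambda>i. X i \<omega>)"
    then have "(\<lambda>n. ennreal ((\<Sum>i<n. X i \<omega>)\<^sup>2)) \<longlonglongrightarrow> ennreal ((\<Sum>i. X i \<omega>)\<^sup>2)"
      by (intro tendsto_ennrealI tendsto_power summable_LIMSEQ)
    then show "ennreal ((\<Sum>i. X i \<omega>)\<^sup>2) = liminf (\<lambda>n. ennreal ((\<Sum>i<n. X i \<omega>)\<^sup>2))"
      by (intro lim_imp_Liminf[symmetric]) auto
  qed
  also have "\<dots> \<le> liminf (\<lambda>n. \<integral>\<^sup>+\<omega>. ennreal ((\<Sum>i<n. X i \<omega>)\<^sup>2) \<partial>M)"
    by (rule nn_integral_liminf) measurable
  also have "\<dots> \<le> ennreal (suminf v)"
  proof (rule Liminf_le)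
    show "\<forall>\<^sub>F n in sequentially. (\<integral>\<^sup>+\<omega>. ennreal ((\<Sum>i<n. X i \<omega>)\<^sup>2) \<partial>M) \<le> ennreal (suminf v)"
    proof (intro always_eventually allI)
      fix n
      have bd: "\<bar>\<Sum>i<n. X i \<omega>\<bar> \<le> real n" for \<omega>
        by (rule order_trans[OF sum_abs]) (use sum_mono[of "{..<n}" "\<lambda>i. \<bar>X i \<omega>\<bar>" "\<lambda>_. 1"] X(2) in simp)
      have "integrable M (\<lambda>\<omega>. (\<Sum>i<n. X i \<omega>)\<^sup>2)"
        by (rule integrable_const_bound[where B="(real n)\<^sup>2"]) (use bd in \<open>auto simp: abs_le_square_iff[symmetric]\<close>)
      then have "(\<integral>\<^sup>+\<omega>. ennreal ((\<Sum>i<n. X i \<omega>)\<^sup>2) \<partial>M) = ennreal (\<integral>\<omega>. (\<Sum>i<n. X i \<omega>)\<^sup>2 \<partial>M)"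
        by (rule nn_integral_eq_integral) auto
      also have "(\<integral>\<omega>. (\<Sum>i<n. X i \<omega>)\<^sup>2 \<partial>M) \<le> (\<Sum>i<n. v i)"
      proof -
        have "(\<integral>\<omega>. (\<Sum>i<n. X i \<omega> * 1)\<^sup>2 \<partial>M) \<le> (\<Sum>i<n. \<integral>\<omega>. (X i \<omega>)\<^sup>2 \<partial>M)"
          by (rule martingale_transform_second_moment[where F=F]; (rule F X orth; assumption)?) auto
        then show ?thesis by (simp add: v_def)
      qed
      also have "\<dots> \<le> suminf v" using sv v0 by (intro sum_le_suminf) auto
      finally show "(\<integral>\<^sup>+\<omega>. ennreal ((\<Sum>i<n. X i \<omega>)\<^sup>2) \<partial>M) \<le> ennreal (suminf v)"
        by (simp add: ennreal_leI)
    qed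
  qed auto
  finally show "(\<integral>\<^sup>+\<omega>. ennreal ((\<Sum>i. X i \<omega>)\<^sup>2) \<partial>M) \<le> ennreal (\<Sum>i. \<integral>\<omega>. (X i \<omega>)\<^sup>2 \<partial>M)"
    by (simp add: v_def[abs_def])
qed

section \<open>Laws of random vectors and their limits\<close>

text \<open>
  A weight bounded below by \<open>1\<close> has a positive total mass, so it can be normalised.
\<close>

lemma weighted_law:
  fixes X W :: "'a \<Rightarrow> real"
  assumes M: "prob_space M" and [measurable]: "X \<in> borel_measurable M" "W \<in> borel_measurable M"
    and W: "\<And>\<omega>. 1 \<le> W \<omega>" "\<And>\<omega>. W \<omega> \<le> K"
  defines "m \<equiv> \<integral>\<omega>. W \<omega> \<partial>M"
  defines "\<mu> \<equiv> distr (density M (\<lambda>\<omega>. ennreal (W \<omega> / m))) borel X"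
  shows "0 < m" and "real_distribution \<mu>"
    and "char \<mu> s = (1 / m) *\<^sub>R (\<integral>\<omega>. W \<omega> *\<^sub>R iexp (s * X \<omega>) \<partial>M)"
    and "B \<in> sets borel \<Longrightarrow> (\<integral>\<omega>. W \<omega> * indicator B (X \<omega>) \<partial>M) = m * (\<integral>x. indicator B x \<partial>\<mu>)"
proof -
  interpret prob_space M by fact
  have W0: "0 \<le> W \<omega>" for \<omega> using W(1)[of \<omega>] by simp
  have iW: "integrable M W"
    by (rule integrable_const_bound[where B=K]) (use W W0 in auto)
  have "(\<integral>\<omega>. 1 \<partial>M) \<le> m" unfolding m_def using iW W(1) by (intro integral_mono) auto
  then show m: "0 < m" by (simp add: prob_space)
  have "prob_space (density M (\<lambda>\<omega>. ennreal (W \<omega> / m)))"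
  proof
    have "(\<integral>\<^sup>+\<omega>. ennreal (W \<omega> / m) \<partial>M) = ennreal (\<integral>\<omega>. W \<omega> / m \<partial>M)"
      using W0 m iW by (intro nn_integral_eq_integral) auto
    also have "\<dots> = 1" using m by (simp add: m_def)
    finally show "emeasure (density M (\<lambda>\<omega>. ennreal (W \<omega> / m))) (space (density M (\<lambda>\<omega>. ennreal (W \<omega> / m)))) = 1"
      by (simp add: emeasure_density cong: nn_integral_cong)
  qed
  then show "real_distribution \<mu>"
    unfolding \<mu>_def by (intro prob_space.real_distribution_distr) auto
  have "char \<mu> s = (\<integral>\<omega>. (W \<omega> / m) *\<^sub>R iexp (s * X \<omega>) \<partial>M)"
    unfolding char_def \<mu>_def using W0 m by (simp add: integral_distr integral_density)
  also have "\<dots> = (\<integral>\<omega>. (1 / m) *\<^sub>R (W \<omega> *\<^sub>R iexp (s * X \<omega>)) \<partial>M)" by simp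
  finally show "char \<mu> s = (1 / m) *\<^sub>R (\<integral>\<omega>. W \<omega> *\<^sub>R iexp (s * X \<omega>) \<partial>M)"
    by (simp only: integral_scaleR_right)
  assume [measurable]: "B \<in> sets borel"
  have "(\<integral>x. indicator B x \<partial>\<mu>) = (\<integral>\<omega>. (W \<omega> / m) * indicator B (X \<omega>) \<partial>M)"
    unfolding \<mu>_def using W0 m
    by (simp add: integral_distr integral_density del: integral_indicator Bochner_Integration.integral_indicator)
  then show "(\<integral>\<omega>. W \<omega> * indicator B (X \<omega>) \<partial>M) = m * (\<integral>x. indicator B x \<partial>\<mu>)" using m by simp
qed

lemma weighted_Levy_uniqueness_ge_1:
  fixes X W :: "'a \<Rightarrow> real" and X' W' :: "'b \<Rightarrow> real"
  assumes M: "prob_space M" "X \<in> borel_measurable M" "W \<in> borel_measurable M" "\<And>\<omega>. 1 \<le> W \<omega>" "\<And>\<omega>. W \<omega> \<le> K"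
    and N: "prob_space N" "X' \<in> borel_measurable N" "W' \<in> borel_measurable N" "\<And>\<omega>. 1 \<le> W' \<omega>" "\<And>\<omega>. W' \<omega> \<le> K"
    and eq: "\<And>s. (\<integral>\<omega>. W \<omega> *\<^sub>R iexp (s * X \<omega>) \<partial>M) = (\<integral>\<omega>. W' \<omega> *\<^sub>R iexp (s * X' \<omega>) \<partial>N)"
    and B: "B \<in> sets borel"
  shows "(\<integral>\<omega>. W \<omega> * indicator B (X \<omega>) \<partial>M) = (\<integral>\<omega>. W' \<omega> * indicator B (X' \<omega>) \<partial>N)"
proof -
  have m: "(\<integral>\<omega>. W \<omega> \<partial>M) = (\<integral>\<omega>. W' \<omega> \<partial>N)"
    using eq[of 0] by (simp add: scaleR_conv_of_real)
  have "distr (density M (\<lambda>\<omega>. ennreal (W \<omega> / (\<integral>\<omega>. W \<omega> \<partial>M)))) borel X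
      = distr (density N (\<lambda>\<omega>. ennreal (W' \<omega> / (\<integral>\<omega>. W' \<omega> \<partial>N)))) borel X'"
    by (rule Levy_uniqueness[OF weighted_law(2)[OF M] weighted_law(2)[OF N]])
      (rule ext, unfold weighted_law(3)[OF M] weighted_law(3)[OF N], simp only: eq m)
  then show ?thesis
    unfolding weighted_law(4)[OF M B] weighted_law(4)[OF N B] by (simp only: m)
qed

text \<open>
  For a signed weight \<open>W\<close> apply the uniqueness theorem to the weights \<open>2 + W\<close> and \<open>1\<close>.
\<close>

lemma weighted_Levy_uniqueness:
  fixes X W :: "'a \<Rightarrow> real" and X' W' :: "'b \<Rightarrow> real"
  assumes M: "prob_space M" and N: "prob_space N"
    and [measurable]: "X \<in> borel_measurable M" "W \<in> borel_measurable M"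
      "X' \<in> borel_measurable N" "W' \<in> borel_measurable N"
    and W: "\<And>\<omega>. \<bar>W \<omega>\<bar> \<le> 1" and W': "\<And>\<omega>. \<bar>W' \<omega>\<bar> \<le> 1"
    and eq1: "\<And>s. (\<integral>\<omega>. iexp (s * X \<omega>) \<partial>M) = (\<integral>\<omega>. iexp (s * X' \<omega>) \<partial>N)"
    and eq: "\<And>s. (\<integral>\<omega>. W \<omega> *\<^sub>R iexp (s * X \<omega>) \<partial>M) = (\<integral>\<omega>. W' \<omega> *\<^sub>R iexp (s * X' \<omega>) \<partial>N)"
    and B: "B \<in> sets borel"
  shows "(\<integral>\<omega>. W \<omega> * indicator B (X \<omega>) \<partial>M) = (\<integral>\<omega>. W' \<omega> * indicator B (X' \<omega>) \<partial>N)"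
proof -
  interpret M: prob_space M by fact
  interpret N: prob_space N by fact
  note [measurable] = B
  have i1: "integrable M (\<lambda>\<omega>. iexp (s * X \<omega>))" "integrable M (\<lambda>\<omega>. W \<omega> *\<^sub>R iexp (s * X \<omega>))"
    "integrable M (\<lambda>\<omega>. indicator B (X \<omega>) :: real)" "integrable M (\<lambda>\<omega>. W \<omega> * indicator B (X \<omega>))" for s
    by (rule M.integrable_const_bound[where B=1]; use W in \<open>auto simp: indicator_def\<close>)+
  have i2: "integrable N (\<lambda>\<omega>. iexp (s * X' \<omega>))" "integrable N (\<lambda>\<omega>. W' \<omega> *\<^sub>R iexp (s * X' \<omega>))"
    "integrable N (\<lambda>\<omega>. indicator B (X' \<omega>) :: real)" "integrable N (\<lambda>\<omega>. W' \<omega> * indicator B (X' \<omega>))" for s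
    by (rule N.integrable_const_bound[where B=1]; use W' in \<open>auto simp: indicator_def\<close>)+
  have "(\<integral>\<omega>. (2 + W \<omega>) * indicator B (X \<omega>) \<partial>M) = (\<integral>\<omega>. (2 + W' \<omega>) * indicator B (X' \<omega>) \<partial>N)"
  proof (rule weighted_Levy_uniqueness_ge_1[where K=3])
    fix s show "(\<integral>\<omega>. (2 + W \<omega>) *\<^sub>R iexp (s * X \<omega>) \<partial>M) = (\<integral>\<omega>. (2 + W' \<omega>) *\<^sub>R iexp (s * X' \<omega>) \<partial>N)"
      using i1(1,2)[of s] i2(1,2)[of s] eq1[of s] eq[of s]
      by (simp only: scaleR_add_left integral_scaleR_right integrable_scaleR_right Bochner_Integration.integral_add)
  next
    fix \<omega> show "1 \<le> 2 + W \<omega>" "2 + W \<omega> \<le> 3" using W[of \<omega>] by auto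
  next
    fix \<omega> show "1 \<le> 2 + W' \<omega>" "2 + W' \<omega> \<le> 3" using W'[of \<omega>] by auto
  qed (use B M N in auto)
  moreover have "(\<integral>\<omega>. (1::real) * indicator B (X \<omega>) \<partial>M) = (\<integral>\<omega>. 1 * indicator B (X' \<omega>) \<partial>N)"
    by (rule weighted_Levy_uniqueness_ge_1[where K=1 and W="\<lambda>_. 1" and W'="\<lambda>_. 1"]) (use M N B eq1 in auto)
  ultimately show ?thesis
    using i1 i2 by (simp add: ring_distribs)
qed

text \<open>
  The characteristic functions of all linear combinations determine the law of a random
  vector. The coordinates are converted one after the other: if the mixed expressions
  \<open>E (\<Prod>\<^bsub>j\<in>A\<^esub> 1(X\<^sub>j \<in> B\<^sub>j)) exp (i \<Sum>\<^sub>j \<theta>\<^sub>j X\<^sub>j)\<close> agree for all \<open>\<theta>\<close>, then for a further coordinate \<open>a\<close>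
  the real and imaginary parts of the integrand serve as signed weights in the one-dimensional
  uniqueness theorem for \<open>X\<^sub>a\<close>, which adds the factor \<open>1(X\<^sub>a \<in> B\<^sub>a)\<close>. At the end \<open>A = J\<close> and
  \<open>\<theta> = 0\<close>, and boxes generate the product \<open>\<sigma>\<close>-algebra.
\<close>

lemma distr_PiM_eqI_char:
  fixes X :: "'i \<Rightarrow> 'a \<Rightarrow> real" and X' :: "'i \<Rightarrow> 'b \<Rightarrow> real"
  assumes M: "prob_space M" and N: "prob_space N" and J: "finite J"
    and X: "\<And>j. j \<in> J \<Longrightarrow> X j \<in> borel_measurable M" and X': "\<And>j. j \<in> J \<Longrightarrow> X' j \<in> borel_measurable N"
    and eq: "\<And>\<theta>. (\<integral>\<omega>. iexp (\<Sum>j\<in>J. \<theta> j * X j \<omega>) \<partial>M) = (\<integral>\<omega>. iexp (\<Sum>j\<in>J. \<theta> j * X' j \<omega>) \<partial>N)"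
  shows "distr M (PiM J (\<lambda>_. borel)) (\<lambda>\<omega>. \<lambda>j\<in>J. X j \<omega>) = distr N (PiM J (\<lambda>_. borel)) (\<lambda>\<omega>. \<lambda>j\<in>J. X' j \<omega>)"
proof -
  interpret M: prob_space M by fact
  interpret N: prob_space N by fact
  define P where "P A B \<omega> = (\<Prod>j\<in>A. indicator (B j) (X j \<omega>) :: real)" for A B \<omega>
  define P' where "P' A B \<omega> = (\<Prod>j\<in>A. indicator (B j) (X' j \<omega>) :: real)" for A B \<omega>
  define S where "S \<theta> \<omega> = (\<Sum>j\<in>J. \<theta> j * X j \<omega>)" for \<theta> \<omega>
  define S' where "S' \<theta> \<omega> = (\<Sum>j\<in>J. \<theta> j * X' j \<omega>)" for \<theta> \<omega>
  have S_m[measurable]: "S \<theta> \<in> borel_measurable M" and S'_m[measurable]: "S' \<theta> \<in> borel_measurable N" for \<theta>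
    unfolding S_def S'_def using X X' by (auto intro!: borel_measurable_sum borel_measurable_times)
  have P_m: "P A B \<in> borel_measurable M" if "A \<subseteq> J" "\<And>j. j \<in> A \<Longrightarrow> B j \<in> sets borel" for A B
    unfolding P_def
  proof (rule borel_measurable_prod)
    fix j assume j: "j \<in> A"
    have [measurable]: "X j \<in> borel_measurable M" "B j \<in> sets borel" using X that j by auto
    show "(\<lambda>\<omega>. indicator (B j) (X j \<omega>) :: real) \<in> borel_measurable M" by measurable
  qed
  have P'_m: "P' A B \<in> borel_measurable N" if "A \<subseteq> J" "\<And>j. j \<in> A \<Longrightarrow> B j \<in> sets borel" for A B
    unfolding P'_def
  proof (rule borel_measurable_prod)
    fix j assume j: "j \<in> A"
    have [measurable]: "X' j \<in> borel_measurable N" "B j \<in> sets borel" using X' that j by auto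
    show "(\<lambda>\<omega>. indicator (B j) (X' j \<omega>) :: real) \<in> borel_measurable N" by measurable
  qed
  have P01: "\<bar>P A B \<omega>\<bar> \<le> 1" "\<bar>P' A B \<omega>'\<bar> \<le> 1" for A B \<omega> \<omega>'
    unfolding P_def P'_def abs_prod by (intro prod_le_1, auto simp: indicator_def)+
  have upd: "S \<theta> \<omega> + s * X a \<omega> = S (\<theta>(a := \<theta> a + s)) \<omega>" if "a \<in> J" for \<theta> s a \<omega>
    unfolding S_def using J that by (simp add: sum.remove[of J a] algebra_simps)
  have upd': "S' \<theta> \<omega> + s * X' a \<omega> = S' (\<theta>(a := \<theta> a + s)) \<omega>" if "a \<in> J" for \<theta> s a \<omega>
    unfolding S'_def using J that by (simp add: sum.remove[of J a] algebra_simps)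
  have neg: "- S \<theta> \<omega> = S (\<lambda>j. - \<theta> j) \<omega>" "- S' \<theta> \<omega>' = S' (\<lambda>j. - \<theta> j) \<omega>'" for \<theta> \<omega> \<omega>'
    by (simp_all add: S_def S'_def sum_negf)
  have cos_cis: "complex_of_real (cos (y - \<phi>)) * cis x = (cis (- \<phi>) * cis (y + x) + cis \<phi> * cis (- y + x)) / 2" for x y \<phi>
    unfolding cis_mult by (simp add: complex_eq_iff cos_add sin_add cos_diff sin_diff algebra_simps)
  have cosR: "(p * cos (y - \<phi>)) *\<^sub>R iexp x = (iexp (- \<phi>) * (p *\<^sub>R iexp (y + x)) + iexp \<phi> * (p *\<^sub>R iexp (- y + x))) / 2" for p x y \<phi> :: real
    unfolding scaleR_conv_of_real of_real_mult mult.assoc cos_cis[unfolded cis_conv_exp]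
    by (simp only: times_divide_eq_right ring_distribs mult.left_commute)
  have neg_upd: "S ((\<lambda>j. - \<theta> j)(a := - \<theta> a + s)) \<omega> = - S \<theta> \<omega> + s * X a \<omega>" 
    "S' ((\<lambda>j. - \<theta> j)(a := - \<theta> a + s)) \<omega>' = - S' \<theta> \<omega>' + s * X' a \<omega>'" if "a \<in> J" for \<theta> s a \<omega> \<omega>'
    using upd[OF that, of "\<lambda>j. - \<theta> j" \<omega> s] upd'[OF that, of "\<lambda>j. - \<theta> j" \<omega>' s] by (simp_all only: neg)
  have main: "(\<integral>\<omega>. P A B \<omega> *\<^sub>R iexp (S \<theta> \<omega>) \<partial>M) = (\<integral>\<omega>. P' A B \<omega> *\<^sub>R iexp (S' \<theta> \<omega>) \<partial>N)"
    if A: "A \<subseteq> J" "\<And>j. j \<in> A \<Longrightarrow> B j \<in> sets borel" for A B \<theta>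
    using finite_subset[OF A(1) J] A
  proof (induction A arbitrary: \<theta> rule: finite_induct)
    case empty
    then show ?case using eq by (simp add: P_def P'_def S_def S'_def)
  next
    case (insert a A)
    have a: "a \<in> J" "B a \<in> sets borel" and A: "A \<subseteq> J" "\<And>j. j \<in> A \<Longrightarrow> B j \<in> sets borel" using insert.prems by auto
    note IH = insert.IH[OF A]
    note [measurable] = P_m[OF A] P'_m[OF A] X[OF a(1)] X'[OF a(1)] a(2)
    have int: "integrable M (\<lambda>\<omega>. P A B \<omega> *\<^sub>R iexp (S \<theta> \<omega>))" "integrable N (\<lambda>\<omega>. P' A B \<omega> *\<^sub>R iexp (S' \<theta> \<omega>))" for \<theta>
      by (rule M.integrable_const_bound[where B=1] N.integrable_const_bound[where B=1]; use P01 in auto)+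
    have split: "P (insert a A) B \<omega> = P A B \<omega> * indicator (B a) (X a \<omega>)"
      "P' (insert a A) B \<omega>' = P' A B \<omega>' * indicator (B a) (X' a \<omega>')" for \<omega> \<omega>'
      using insert.hyps by (simp_all add: P_def P'_def)
    have eq1: "(\<integral>\<omega>. iexp (s * X a \<omega>) \<partial>M) = (\<integral>\<omega>. iexp (s * X' a \<omega>) \<partial>N)" for s
      using eq[of "\<lambda>j. if j = a then s else 0"] J a(1) by (simp add: if_distrib[of "\<lambda>x. x * _"] sum.delta cong: if_cong)
    \<comment> \<open>the phases 0 and pi / 2 give the real and the imaginary part\<close>
    have c: "(\<integral>\<omega>. (P A B \<omega> * cos (S \<theta> \<omega> - \<phi>)) * indicator (B a) (X a \<omega>) \<partial>M) = (\<integral>\<omega>. (P' A B \<omega> * cos (S' \<theta> \<omega> - \<phi>)) * indicator (B a) (X' a \<omega>) \<partial>N)" for \<phi>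
    proof (rule weighted_Levy_uniqueness[OF M N])
      fix \<omega> \<omega>'
      show "\<bar>P A B \<omega> * cos (S \<theta> \<omega> - \<phi>)\<bar> \<le> 1" "\<bar>P' A B \<omega>' * cos (S' \<theta> \<omega>' - \<phi>)\<bar> \<le> 1"
        using mult_mono[OF P01(1)[of A B \<omega>] abs_cos_le_one[of "S \<theta> \<omega> - \<phi>"]] mult_mono[OF P01(2)[of A B \<omega>'] abs_cos_le_one[of "S' \<theta> \<omega>' - \<phi>"]]
        by (simp_all add: abs_mult)
    next
      fix s
      show "(\<integral>\<omega>. (P A B \<omega> * cos (S \<theta> \<omega> - \<phi>)) *\<^sub>R iexp (s * X a \<omega>) \<partial>M) = (\<integral>\<omega>. (P' A B \<omega> * cos (S' \<theta> \<omega> - \<phi>)) *\<^sub>R iexp (s * X' a \<omega>) \<partial>N)"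
        unfolding cosR upd[OF a(1)] upd'[OF a(1)] neg_upd[OF a(1), symmetric] using int IH
        by (simp only: integral_divide_zero Bochner_Integration.integral_add integral_mult_right_zero integrable_mult_right)
    qed (use eq1 a in auto)
    have b1: "\<bar>P A B \<omega> * cos (S \<theta> \<omega> - \<phi>) * indicator (B a) (X a \<omega>)\<bar> \<le> 1" for \<omega> \<phi>
      using mult_mono[OF P01(1)[of A B \<omega>] abs_cos_le_one[of "S \<theta> \<omega> - \<phi>"]] by (auto simp: abs_mult indicator_def)
    have b2: "\<bar>P' A B \<omega> * cos (S' \<theta> \<omega> - \<phi>) * indicator (B a) (X' a \<omega>)\<bar> \<le> 1" for \<omega> \<phi>
      using mult_mono[OF P01(2)[of A B \<omega>] abs_cos_le_one[of "S' \<theta> \<omega> - \<phi>"]] by (auto simp: abs_mult indicator_def)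
    have i1: "integrable M (\<lambda>\<omega>. P A B \<omega> * cos (S \<theta> \<omega> - \<phi>) * indicator (B a) (X a \<omega>))" for \<phi>
      by (rule M.integrable_const_bound[where B=1]; use b1 in auto)
    have i2: "integrable N (\<lambda>\<omega>. P' A B \<omega> * cos (S' \<theta> \<omega> - \<phi>) * indicator (B a) (X' a \<omega>))" for \<phi>
      by (rule N.integrable_const_bound[where B=1]; use b2 in auto)
    have euler: "(p * q) *\<^sub>R iexp x = complex_of_real (p * cos (x - 0) * q) + \<i> * complex_of_real (p * cos (x - pi / 2) * q)" for p q x :: real
      by (simp add: cis_conv_exp[symmetric] complex_eq_iff cos_diff)
    show ?case
      unfolding split euler using i1 i2 c
      by (simp only: Bochner_Integration.integral_add integrable_of_real integrable_mult_right
          integral_mult_right_zero integral_complex_of_real)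
  qed
  have box: "emeasure (distr M (PiM J (\<lambda>_. borel)) (\<lambda>\<omega>. \<lambda>j\<in>J. X j \<omega>)) (Pi\<^sub>E J B) = emeasure (distr N (PiM J (\<lambda>_. borel)) (\<lambda>\<omega>. \<lambda>j\<in>J. X' j \<omega>)) (Pi\<^sub>E J B)"
    if B: "\<And>j. j \<in> J \<Longrightarrow> B j \<in> sets borel" for B
  proof -
    have "(\<integral>\<omega>. P J B \<omega> \<partial>M) = (\<integral>\<omega>. P' J B \<omega> \<partial>N)"
      using main[of J B "\<lambda>_. 0"] B by (simp add: S_def S'_def scaleR_conv_of_real)
    moreover have "P J B \<omega> = indicator ((\<lambda>\<omega>. \<lambda>j\<in>J. X j \<omega>) -` (Pi\<^sub>E J B)) \<omega>" for \<omega>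
      using J by (auto simp: P_def indicator_def PiE_iff extensional_def)
    moreover have "P' J B \<omega> = indicator ((\<lambda>\<omega>. \<lambda>j\<in>J. X' j \<omega>) -` (Pi\<^sub>E J B)) \<omega>" for \<omega>
      using J by (auto simp: P'_def indicator_def PiE_iff extensional_def)
    moreover have [measurable]: "Pi\<^sub>E J B \<in> sets (PiM J (\<lambda>_. borel))"
      using B J by (intro sets_PiM_I_finite) auto
    ultimately show ?thesis
      using X X' by (simp add: emeasure_distr M.emeasure_eq_measure N.emeasure_eq_measure)
  qed
  show ?thesis
  proof (rule measure_eqI_PiM_finite[OF J])
    show "range (\<lambda>_::nat. Pi\<^sub>E J (\<lambda>_. UNIV :: real set)) \<subseteq> prod_algebra J (\<lambda>_. borel)"
      using J by (auto intro!: prod_algebraI_finite)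
    show "emeasure (distr M (PiM J (\<lambda>_. borel)) (\<lambda>\<omega>. \<lambda>j\<in>J. X j \<omega>)) (Pi\<^sub>E J (\<lambda>_. UNIV)) \<noteq> \<infinity>"
      using X J by (simp add: emeasure_distr sets_PiM_I_finite)
  qed (use box in \<open>auto simp: space_PiM\<close>)
qed

lemma continuous_map_product_sequentially:
  assumes g: "continuous_map (product_topology (\<lambda>_. euclideanreal) J) euclideanreal g"
    and x: "x \<in> J \<rightarrow>\<^sub>E UNIV" and y: "\<And>n. y n \<in> J \<rightarrow>\<^sub>E UNIV"
    and lim: "\<And>j. j \<in> J \<Longrightarrow> (\<lambda>n. y n j) \<longlonglongrightarrow> x j"
  shows "(\<lambda>n. g (y n)) \<longlonglongrightarrow> g x"
proof -
  have "limitin (product_topology (\<lambda>_. euclideanreal) J) y x sequentially"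
    unfolding limitin_componentwise using x y lim by (auto simp: PiE_iff)
  from continuous_map_limit[OF g this] show ?thesis by (simp add: o_def)
qed

text \<open>
  \<open>g\<close> is the pointwise limit of its values at points rounded down to multiples of \<open>1 / (n + 1)\<close>,
  and these take countably many values because \<open>J\<close> is finite.
\<close>

lemma continuous_map_product_borel_measurable:
  assumes J: "finite J" and g: "continuous_map (product_topology (\<lambda>_. euclideanreal) J) euclideanreal g"
  shows "g \<in> borel_measurable (PiM J (\<lambda>_. borel))"
proof (rule borel_measurable_LIMSEQ_real)
  define \<rho> :: "nat \<Rightarrow> ('a \<Rightarrow> real) \<Rightarrow> 'a \<Rightarrow> int" where "\<rho> n x = (\<lambda>j\<in>J. \<lfloor>real (Suc n) * x j\<rfloor>)" for n x
  define G where "G n z = g (\<lambda>j\<in>J. real_of_int (z j) / real (Suc n))" for n z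
  fix x assume "x \<in> space (PiM J (\<lambda>_. borel :: real measure))"
  then have x: "x \<in> J \<rightarrow>\<^sub>E UNIV" by (simp add: space_PiM)
  show "(\<lambda>n. G n (\<rho> n x)) \<longlonglongrightarrow> g x"
    unfolding G_def
  proof (rule continuous_map_product_sequentially[OF g x])
    fix j assume j: "j \<in> J"
    have "(\<lambda>n. real_of_int \<lfloor>real (Suc n) * x j\<rfloor> / real (Suc n)) \<longlonglongrightarrow> x j"
    proof (rule tendsto_sandwich)
      show "\<forall>\<^sub>F n in sequentially. x j - 1 / real (Suc n) \<le> real_of_int \<lfloor>real (Suc n) * x j\<rfloor> / real (Suc n)"
      proof (intro always_eventually allI)
        fix n
        have "real (Suc n) * x j - 1 \<le> real_of_int \<lfloor>real (Suc n) * x j\<rfloor>" by linarith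
        then show "x j - 1 / real (Suc n) \<le> real_of_int \<lfloor>real (Suc n) * x j\<rfloor> / real (Suc n)"
          using divide_right_mono[of "real (Suc n) * x j - 1" _ "real (Suc n)"]
          by (simp add: diff_divide_distrib del: of_nat_Suc)
      qed
      show "\<forall>\<^sub>F n in sequentially. real_of_int \<lfloor>real (Suc n) * x j\<rfloor> / real (Suc n) \<le> x j"
      proof (intro always_eventually allI)
        fix n
        have "real_of_int \<lfloor>real (Suc n) * x j\<rfloor> \<le> real (Suc n) * x j" by linarith
        then show "real_of_int \<lfloor>real (Suc n) * x j\<rfloor> / real (Suc n) \<le> x j"
          by (simp add: field_simps del: of_nat_Suc)
      qed
      show "(\<lambda>n. x j - 1 / real (Suc n)) \<longlonglongrightarrow> x j"
        using tendsto_diff[OF tendsto_const LIMSEQ_inverse_real_of_nat, of "x j"] by (simp add: inverse_eq_divide)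
    qed auto
    then show "(\<lambda>n. (\<lambda>j\<in>J. real_of_int (\<rho> n x j) / real (Suc n)) j) \<longlonglongrightarrow> x j"
      using j by (simp add: \<rho>_def)
  qed auto
next
  define \<rho> :: "nat \<Rightarrow> ('a \<Rightarrow> real) \<Rightarrow> 'a \<Rightarrow> int" where "\<rho> n x = (\<lambda>j\<in>J. \<lfloor>real (Suc n) * x j\<rfloor>)" for n x
  define G where "G n z = g (\<lambda>j\<in>J. real_of_int (z j) / real (Suc n))" for n z
  fix n
  have "\<rho> n \<in> measurable (PiM J (\<lambda>_. borel)) (count_space (J \<rightarrow>\<^sub>E UNIV))"
  proof (subst measurable_count_space_eq_countable)
    show "countable (J \<rightarrow>\<^sub>E (UNIV :: int set))" using J by (intro countable_PiE) auto
    show "\<rho> n \<in> space (PiM J (\<lambda>_. borel)) \<rightarrow> J \<rightarrow>\<^sub>E UNIV \<and>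
      (\<forall>a\<in>J \<rightarrow>\<^sub>E UNIV. \<rho> n -` {a} \<inter> space (PiM J (\<lambda>_. borel)) \<in> sets (PiM J (\<lambda>_. borel)))"
    proof (intro conjI ballI)
      fix a :: "'a \<Rightarrow> int" assume a: "a \<in> J \<rightarrow>\<^sub>E UNIV"
      have "\<rho> n -` {a} \<inter> space (PiM J (\<lambda>_. borel)) = {x \<in> space (PiM J (\<lambda>_. borel)). \<forall>j\<in>J. \<lfloor>real (Suc n) * x j\<rfloor> = a j}"
        using a by (auto simp: \<rho>_def fun_eq_iff PiE_iff extensional_def)
      also have "\<dots> \<in> sets (PiM J (\<lambda>_. borel))"
        using J by measurable
      finally show "\<rho> n -` {a} \<inter> space (PiM J (\<lambda>_. borel)) \<in> sets (PiM J (\<lambda>_. borel))" .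
    qed (auto simp: \<rho>_def)
  qed
  from measurable_compose[OF this, of "G n" borel]
  show "(\<lambda>x. G n (\<rho> n x)) \<in> borel_measurable (PiM J (\<lambda>_. borel))" by simp
qed

text \<open>
  \<open>g\<close> is continuous but need not be uniformly continuous, and the vectors \<open>U r\<close> share only their law.
  Let \<open>A \<epsilon> n\<close> be the set of points at which \<open>g\<close> oscillates by at most \<open>\<epsilon>\<close> within distance
  \<open>1 / (n + 1)\<close>. By continuity these sets increase to the whole space, so one \<open>n\<close> makes the
  complement of \<open>A \<epsilon> n\<close> unlikely for the common law of all \<open>U r\<close> at once; rational offsets keep the
  sets measurable.
\<close>

lemma Slutsky_tendsto:
  fixes U X :: "'i \<Rightarrow> 'j \<Rightarrow> 'a \<Rightarrow> real" and Z :: "'j \<Rightarrow> 'b \<Rightarrow> real"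
  assumes M: "prob_space M" and N: "prob_space N" and J: "finite J"
    and g: "continuous_map (product_topology (\<lambda>_. euclideanreal) J) euclideanreal g"
    and bd: "bounded (g ` (J \<rightarrow>\<^sub>E UNIV))"
    and U: "\<And>r t. t \<in> J \<Longrightarrow> U r t \<in> borel_measurable M"
    and X: "\<And>r t. t \<in> J \<Longrightarrow> X r t \<in> borel_measurable M"
    and Z: "\<And>t. t \<in> J \<Longrightarrow> Z t \<in> borel_measurable N"
    and law: "\<forall>\<^sub>F r in F. distr M (PiM J (\<lambda>_. borel)) (\<lambda>\<omega>. \<lambda>t\<in>J. U r t \<omega>) = distr N (PiM J (\<lambda>_. borel)) (\<lambda>\<omega>. \<lambda>t\<in>J. Z t \<omega>)"
    and close: "\<And>t d. t \<in> J \<Longrightarrow> 0 < d \<Longrightarrow> ((\<lambda>r. measure M {\<omega>\<in>space M. d \<le> \<bar>X r t \<omega> - U r t \<omega>\<bar>}) \<longlongrightarrow> 0) F"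
  shows "((\<lambda>r. \<integral>\<omega>. g (\<lambda>t\<in>J. X r t \<omega>) \<partial>M) \<longlongrightarrow> (\<integral>\<omega>. g (\<lambda>t\<in>J. Z t \<omega>) \<partial>N)) F"
proof -
  interpret M: prob_space M by fact
  interpret N: prob_space N by fact
  let ?P = "PiM J (\<lambda>_. borel :: real measure)"
  have gm[measurable]: "g \<in> borel_measurable ?P" by (rule continuous_map_product_borel_measurable[OF J g])
  have Um[measurable]: "(\<lambda>\<omega>. \<lambda>t\<in>J. U r t \<omega>) \<in> measurable M ?P" for r using U by (intro measurable_restrict)
  have Xm[measurable]: "(\<lambda>\<omega>. \<lambda>t\<in>J. X r t \<omega>) \<in> measurable M ?P" for r using X by (intro measurable_restrict)
  have Zm[measurable]: "(\<lambda>\<omega>. \<lambda>t\<in>J. Z t \<omega>) \<in> measurable N ?P" using Z by (intro measurable_restrict)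
  from bd obtain B0 where B0: "\<And>x. x \<in> J \<rightarrow>\<^sub>E UNIV \<Longrightarrow> \<bar>g x\<bar> \<le> B0" by (auto simp: bounded_iff)
  define B where "B = max B0 0"
  have B: "\<And>x. x \<in> J \<rightarrow>\<^sub>E UNIV \<Longrightarrow> \<bar>g x\<bar> \<le> B" "0 \<le> B" using B0 by (force simp: B_def)+
  define D where "D n = {q \<in> J \<rightarrow>\<^sub>E \<rat>. \<forall>j\<in>J. \<bar>q j\<bar> < 1 / real (Suc n)}" for n
  have D_count: "countable (D n)" for n
    unfolding D_def by (rule countable_subset[of _ "J \<rightarrow>\<^sub>E \<rat>"]) (auto intro!: countable_PiE J countable_rat)
  define A where "A \<epsilon> n = {x \<in> space ?P. \<forall>q\<in>D n. \<bar>g (\<lambda>j\<in>J. x j + q j) - g x\<bar> \<le> \<epsilon>}" for \<epsilon> n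
  have A_sets[measurable]: "A \<epsilon> n \<in> sets ?P" for \<epsilon> n
    unfolding A_def by (rule sets.sets_Collect_countable_All'[OF _ D_count]) measurable
  have A_D: "\<bar>g (\<lambda>j\<in>J. x j + e j) - g x\<bar> \<le> \<epsilon>" if x: "x \<in> A \<epsilon> n" and e: "\<And>j. j \<in> J \<Longrightarrow> \<bar>e j\<bar> < 1 / real (Suc n)" for x e \<epsilon> n
  proof -
    \<comment> \<open>the given offset is approximated by rational ones that stay in the same cube\<close>
    have "\<exists>q. \<forall>k::nat. q k \<in> \<rat> \<and> \<bar>q k\<bar> < 1 / real (Suc n) \<and> \<bar>q k - e j\<bar> < 1 / real (Suc k)" if j: "j \<in> J" for j
    proof (rule choice, rule allI)
      fix k
      have "max (- (1 / real (Suc n))) (e j - 1 / real (Suc k)) < min (1 / real (Suc n)) (e j + 1 / real (Suc k))"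
        using e[OF j] by (auto simp: abs_less_iff simp del: of_nat_Suc) (smt (verit) of_nat_0_less_iff zero_less_Suc zero_less_divide_1_iff)+
      from Rats_dense_in_real[OF this] obtain q where q: "q \<in> \<rat>" 
        "max (- (1 / real (Suc n))) (e j - 1 / real (Suc k)) < q" "q < min (1 / real (Suc n)) (e j + 1 / real (Suc k))" by auto
      show "\<exists>q. q \<in> \<rat> \<and> \<bar>q\<bar> < 1 / real (Suc n) \<and> \<bar>q - e j\<bar> < 1 / real (Suc k)"
        by (rule exI[of _ q]) (use q in \<open>auto simp: abs_less_iff simp del: of_nat_Suc\<close>)
    qed
    then obtain q where q: "\<And>j k. j \<in> J \<Longrightarrow> q j k \<in> \<rat> \<and> \<bar>q j k\<bar> < 1 / real (Suc n) \<and> \<bar>q j k - e j\<bar> < 1 / real (Suc k)"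
      by metis
    have "(\<lambda>k. g (\<lambda>j\<in>J. x j + q j k)) \<longlonglongrightarrow> g (\<lambda>j\<in>J. x j + e j)"
    proof (rule continuous_map_product_sequentially[OF g])
      fix j assume j: "j \<in> J"
      have "(\<lambda>k. q j k - e j) \<longlonglongrightarrow> 0"
        by (rule Lim_null_comparison[OF _ LIMSEQ_inverse_real_of_nat])
          (use q[OF j] in \<open>auto simp: inverse_eq_divide less_imp_le simp del: of_nat_Suc\<close>)
      then have "(\<lambda>k. q j k) \<longlonglongrightarrow> e j" by (simp add: LIM_zero_iff)
      then have "(\<lambda>k. x j + q j k) \<longlonglongrightarrow> x j + e j" by (intro tendsto_intros)
      then show "(\<lambda>k. (\<lambda>j\<in>J. x j + q j k) j) \<longlonglongrightarrow> (\<lambda>j\<in>J. x j + e j) j" using j by simp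
    qed auto
    then have "(\<lambda>k. \<bar>g (\<lambda>j\<in>J. x j + q j k) - g x\<bar>) \<longlonglongrightarrow> \<bar>g (\<lambda>j\<in>J. x j + e j) - g x\<bar>"
      by (intro tendsto_intros)
    moreover have "\<bar>g (\<lambda>j\<in>J. x j + q j k) - g x\<bar> \<le> \<epsilon>" for k
    proof -
      have "(\<lambda>j\<in>J. q j k) \<in> D n" using q by (auto simp: D_def)
      moreover have "(\<lambda>j\<in>J. x j + (\<lambda>j\<in>J. q j k) j) = (\<lambda>j\<in>J. x j + q j k)" by (auto simp: fun_eq_iff)
      ultimately show ?thesis using x unfolding A_def by fastforce
    qed
    ultimately show ?thesis by (intro LIMSEQ_le_const2) auto
  qed
  have A_ex: "\<exists>n. x \<in> A \<epsilon> n" if x: "x \<in> space ?P" and "0 < \<epsilon>" for x \<epsilon>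
  proof (rule ccontr)
    assume "\<not> ?thesis"
    then have "\<exists>q. q \<in> D n \<and> \<epsilon> < \<bar>g (\<lambda>j\<in>J. x j + q j) - g x\<bar>" for n
      using x by (auto simp: A_def not_le)
    then obtain q where q: "\<And>n. q n \<in> D n" "\<And>n. \<epsilon> < \<bar>g (\<lambda>j\<in>J. x j + q n j) - g x\<bar>" by metis
    have "(\<lambda>n. g (\<lambda>j\<in>J. x j + q n j)) \<longlonglongrightarrow> g x"
    proof (rule continuous_map_product_sequentially[OF g])
      show "x \<in> J \<rightarrow>\<^sub>E UNIV" using x by (simp add: space_PiM)
      fix j assume j: "j \<in> J"
      have "(\<lambda>n. q n j) \<longlonglongrightarrow> 0"
        by (rule Lim_null_comparison[OF _ LIMSEQ_inverse_real_of_nat])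
          (use q(1) j in \<open>auto simp: D_def inverse_eq_divide less_imp_le simp del: of_nat_Suc\<close>)
      from tendsto_add[OF tendsto_const this, of "x j"]
      show "(\<lambda>n. (\<lambda>j\<in>J. x j + q n j) j) \<longlonglongrightarrow> x j" using j by simp
    qed auto
    then have "(\<lambda>n. \<bar>g (\<lambda>j\<in>J. x j + q n j) - g x\<bar>) \<longlonglongrightarrow> \<bar>g x - g x\<bar>" by (intro tendsto_intros)
    then have "\<epsilon> \<le> \<bar>g x - g x\<bar>" using q(2) by (intro LIMSEQ_le_const) (auto intro: less_imp_le)
    then show False using \<open>0 < \<epsilon>\<close> by simp
  qed
  have A_mono: "A \<epsilon> n \<subseteq> A \<epsilon> m" if "n \<le> m" for \<epsilon> n m
  proof -
    have "1 / real (Suc m) \<le> 1 / real (Suc n)" using that by (simp add: frac_le)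
    then have "D m \<subseteq> D n" by (force simp: D_def)
    then show ?thesis by (auto simp: A_def)
  qed
  show ?thesis
  proof (rule tendstoI)
    fix \<epsilon>' :: real assume "0 < \<epsilon>'"
    define \<epsilon> where "\<epsilon> = \<epsilon>' / (2 + 4 * B)"
    have \<epsilon>: "0 < \<epsilon>" using \<open>0 < \<epsilon>'\<close> B(2) by (simp add: \<epsilon>_def)
    have \<epsilon>': "\<epsilon> + 2 * B * (2 * \<epsilon>) < \<epsilon>'"
    proof -
      have "\<epsilon> + 2 * B * (2 * \<epsilon>) = (1 + 4 * B) * \<epsilon>" by (simp add: algebra_simps)
      also have "\<dots> < (2 + 4 * B) * \<epsilon>" using \<epsilon> by simp
      also have "\<dots> = \<epsilon>'" using B(2) by (simp add: \<epsilon>_def)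
      finally show ?thesis .
    qed
    let ?Z = "\<lambda>n. (\<lambda>\<omega>. \<lambda>t\<in>J. Z t \<omega>) -` (space ?P - A \<epsilon> n) \<inter> space N"
    have "(\<lambda>n. N.prob (?Z n)) \<longlonglongrightarrow> N.prob (\<Inter>n. ?Z n)"
      by (rule N.finite_Lim_measure_decseq) (use A_mono in \<open>force simp: decseq_def intro!: measurable_sets[OF Zm]\<close>)+
    moreover have "(\<Inter>n. ?Z n) = {}"
      using A_ex[OF measurable_space[OF Zm] \<epsilon>] by auto
    ultimately have "(\<lambda>n. N.prob (?Z n)) \<longlonglongrightarrow> 0" by simp
    then have "\<forall>\<^sub>F n in sequentially. N.prob (?Z n) < \<epsilon>" using \<epsilon> by (rule order_tendstoD)
    then obtain n where n: "N.prob (?Z n) < \<epsilon>" by (auto simp: eventually_sequentially)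
    have "((\<lambda>r. \<Sum>t\<in>J. M.prob {\<omega>\<in>space M. 1 / real (Suc n) \<le> \<bar>X r t \<omega> - U r t \<omega>\<bar>}) \<longlongrightarrow> (\<Sum>t\<in>J. 0)) F"
      by (intro tendsto_sum close) auto
    then have "\<forall>\<^sub>F r in F. (\<Sum>t\<in>J. M.prob {\<omega>\<in>space M. 1 / real (Suc n) \<le> \<bar>X r t \<omega> - U r t \<omega>\<bar>}) < \<epsilon>"
      using \<epsilon> by (auto dest: order_tendstoD)
    then show "\<forall>\<^sub>F r in F. dist (\<integral>\<omega>. g (\<lambda>t\<in>J. X r t \<omega>) \<partial>M) (\<integral>\<omega>. g (\<lambda>t\<in>J. Z t \<omega>) \<partial>N) < \<epsilon>'"
      using law
    proof eventually_elim
      case (elim r)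
      have eqZ: "(\<integral>\<omega>. g (\<lambda>t\<in>J. Z t \<omega>) \<partial>N) = (\<integral>\<omega>. g (\<lambda>t\<in>J. U r t \<omega>) \<partial>M)"
        using integral_distr[OF Um gm, of r] integral_distr[OF Zm gm] elim(2) by simp
      define E1 where "E1 = (\<lambda>\<omega>. \<lambda>t\<in>J. U r t \<omega>) -` (space ?P - A \<epsilon> n) \<inter> space M"
      define E2 where "E2 t = {\<omega>\<in>space M. 1 / real (Suc n) \<le> \<bar>X r t \<omega> - U r t \<omega>\<bar>}" for t
      define E where "E = E1 \<union> (\<Union>t\<in>J. E2 t)"
      have E1m[measurable]: "E1 \<in> sets M" unfolding E1_def by measurable
      have E2m: "E2 t \<in> sets M" if "t \<in> J" for t
        using X[OF that, of r] U[OF that, of r] unfolding E2_def by measurable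
      have Em[measurable]: "E \<in> sets M" unfolding E_def by (intro sets.Un sets.finite_UN E1m E2m J)
      have "M.prob E1 = N.prob (?Z n)"
        unfolding E1_def using measure_distr[OF Um, of "space ?P - A \<epsilon> n" r] measure_distr[OF Zm, of "space ?P - A \<epsilon> n"] elim(2) by simp
      then have "M.prob E1 < \<epsilon>" using n by simp
      moreover have "M.prob (\<Union>t\<in>J. E2 t) \<le> (\<Sum>t\<in>J. M.prob (E2 t))"
        by (rule M.finite_measure_subadditive_finite) (use J E2m in auto)
      moreover have "(\<Sum>t\<in>J. M.prob (E2 t)) < \<epsilon>" using elim(1) by (simp add: E2_def)
      moreover have "M.prob E \<le> M.prob E1 + M.prob (\<Union>t\<in>J. E2 t)"
        unfolding E_def by (rule measure_Un_le) (use J E2m in auto)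
      ultimately have PE: "M.prob E \<le> 2 * \<epsilon>" by simp
      have gb: "\<bar>g (\<lambda>t\<in>J. X r t \<omega>)\<bar> \<le> B" "\<bar>g (\<lambda>t\<in>J. U r t \<omega>)\<bar> \<le> B" for \<omega> by (auto intro!: B)
      have ig: "integrable M (\<lambda>\<omega>. g (\<lambda>t\<in>J. X r t \<omega>))" "integrable M (\<lambda>\<omega>. g (\<lambda>t\<in>J. U r t \<omega>))"
        by (rule M.integrable_const_bound[where B=B]; use gb in auto)+
      have pt: "\<bar>g (\<lambda>t\<in>J. X r t \<omega>) - g (\<lambda>t\<in>J. U r t \<omega>)\<bar> \<le> \<epsilon> + 2 * B * indicator E \<omega>" if \<omega>: "\<omega> \<in> space M" for \<omega>
      proof (cases "\<omega> \<in> E")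
        case True then show ?thesis using gb[of \<omega>] \<epsilon> by simp
      next
        case False
        have "(\<lambda>t\<in>J. U r t \<omega>) \<in> A \<epsilon> n"
          using False \<omega> measurable_space[OF Um \<omega>] by (auto simp: E_def E1_def)
        moreover have "\<bar>X r t \<omega> - U r t \<omega>\<bar> < 1 / real (Suc n)" if "t \<in> J" for t
          using False \<omega> that by (force simp: E_def E2_def not_le)
        ultimately have "\<bar>g (\<lambda>j\<in>J. (\<lambda>t\<in>J. U r t \<omega>) j + (X r j \<omega> - U r j \<omega>)) - g (\<lambda>t\<in>J. U r t \<omega>)\<bar> \<le> \<epsilon>"
          by (rule A_D)
        moreover have "(\<lambda>j\<in>J. (\<lambda>t\<in>J. U r t \<omega>) j + (X r j \<omega> - U r j \<omega>)) = (\<lambda>t\<in>J. X r t \<omega>)"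
          by (auto simp: fun_eq_iff)
        ultimately show ?thesis using False by simp
      qed
      have "\<bar>(\<integral>\<omega>. g (\<lambda>t\<in>J. X r t \<omega>) \<partial>M) - (\<integral>\<omega>. g (\<lambda>t\<in>J. U r t \<omega>) \<partial>M)\<bar> = \<bar>\<integral>\<omega>. g (\<lambda>t\<in>J. X r t \<omega>) - g (\<lambda>t\<in>J. U r t \<omega>) \<partial>M\<bar>"
        using ig by simp
      also have "\<dots> \<le> (\<integral>\<omega>. \<bar>g (\<lambda>t\<in>J. X r t \<omega>) - g (\<lambda>t\<in>J. U r t \<omega>)\<bar> \<partial>M)"
        by (rule integral_abs_bound)
      also have "\<dots> \<le> (\<integral>\<omega>. \<epsilon> + 2 * B * indicator E \<omega> \<partial>M)"
      proof (rule integral_mono)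
        show "integrable M (\<lambda>\<omega>. \<epsilon> + 2 * B * indicator E \<omega>)"
          by (rule M.integrable_const_bound[where B="\<epsilon> + 2 * B"]) (use \<epsilon> B(2) in \<open>auto simp: indicator_def\<close>)
      qed (use ig pt in auto)
      also have "\<dots> = \<epsilon> + 2 * B * M.prob E"
        by (subst Bochner_Integration.integral_add) (auto simp: M.prob_space M.emeasure_eq_measure)
      also have "\<dots> \<le> \<epsilon> + 2 * B * (2 * \<epsilon>)" using PE B(2) by (intro add_left_mono mult_left_mono) auto
      finally show ?case using \<epsilon>' by (simp add: eqZ dist_real_def)
    qed
  qed
qed

section \<open>The stable constant and power integrals\<close>

lemma nn_integral_powr_0_1:
  fixes p :: real assumes "-1 < p"
  shows "(\<integral>\<^sup>+v. ennreal (indicator {0..1} v * v powr p) \<partial>lborel) = ennreal (1 / (p + 1))"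
  using nn_integral_has_integral_lebesgue[OF _ has_integral_powr_from_0[OF assms, of 1]] by simp

lemma nn_integral_powr_1_inf:
  fixes p :: real assumes "p < -1"
  shows "(\<integral>\<^sup>+v. ennreal (indicator {1..} v * v powr p) \<partial>lborel) = ennreal (- 1 / (p + 1))"
  using nn_integral_has_integral_lebesgue[OF _ has_integral_powr_to_inf[OF assms, of 1]] by simp

text \<open>
  By the mean value theorem the difference is \<open>\<bar>p - q\<bar> \<bar>ln v\<bar> v\<^bsup>-z\<^esup>\<close> for some \<open>z\<close> between \<open>p\<close> and \<open>q\<close>. The
  room \<open>e\<close> in the exponent absorbs the logarithm, through a smaller power for \<open>v \<ge> 1\<close> and a larger
  one for \<open>v < 1\<close>.
\<close>

lemma abs_powr_diff_le:
  fixes v p q p0 p1 e :: real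
  assumes v: "0 < v" and e: "0 < e" and p: "p0 + e \<le> p" "p \<le> p1 - e" and q: "p0 + e \<le> q" "q \<le> p1 - e"
  shows "\<bar>v powr (- p) - v powr (- q)\<bar> \<le> \<bar>p - q\<bar> / e * (v powr (- p0) + v powr (- p1))"
proof -
  have main: "\<bar>v powr (- p) - v powr (- q)\<bar> \<le> \<bar>p - q\<bar> / e * (v powr (- p0) + v powr (- p1))"
    if pq: "p < q" and p: "p0 + e \<le> p" "p \<le> p1 - e" and q: "p0 + e \<le> q" "q \<le> p1 - e" for p q
  proof -
    have D: "DERIV (\<lambda>s. v powr (- s)) s :> - ln v * v powr (- s)" for s
      using v by (auto intro!: derivative_eq_intros)
    from MVT2[OF pq, of "\<lambda>s. v powr (- s)" "\<lambda>s. - ln v * v powr (- s)"] D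
    obtain z where z: "p < z" "z < q" "v powr (- q) - v powr (- p) = (q - p) * (- ln v * v powr (- z))" by auto
    have "\<bar>v powr (- p) - v powr (- q)\<bar> = \<bar>p - q\<bar> * (\<bar>ln v\<bar> * v powr (- z))"
      using z(3) by (simp add: abs_minus_commute[of "v powr (- p)"] abs_mult abs_minus_commute[of p])
    also have "\<bar>ln v\<bar> * v powr (- z) \<le> (v powr (- p0) + v powr (- p1)) / e"
    proof (cases "1 \<le> v")
      case True
      have "\<bar>ln v\<bar> * v powr (- z) \<le> v powr e / e * v powr (- z)"
        using ln_powr_bound[OF True e] True by (intro mult_right_mono) auto
      also have "\<dots> = v powr (e - z) / e" using v by (simp add: powr_add[symmetric])
      also have "v powr (e - z) \<le> v powr (- p0)" using True p z by (intro powr_mono) auto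
      finally show ?thesis using e by (simp add: divide_right_mono add_divide_distrib add_increasing2)
    next
      case False
      have "ln (1/v) \<le> (1/v) powr e / e" using False v e by (intro ln_powr_bound) auto
      then have "\<bar>ln v\<bar> \<le> v powr (- e) / e" using False v by (simp add: ln_div powr_divide powr_minus_divide)
      then have "\<bar>ln v\<bar> * v powr (- z) \<le> v powr (- e) / e * v powr (- z)" by (intro mult_right_mono) auto
      also have "\<dots> = v powr (- e - z) / e" using v by (simp add: powr_add[symmetric])
      also have "v powr (- e - z) \<le> v powr (- p1)" using False v q z by (intro powr_mono') auto
      finally show ?thesis using e by (simp add: divide_right_mono add_divide_distrib add_increasing)
    qed
    finally show ?thesis by (simp add: mult_left_mono)
  qed
  show ?thesis
  proof (cases p q rule: linorder_cases)
    case less then show ?thesis using main[OF less] p q by simp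
  next
    case equal then show ?thesis by simp
  next
    case greater then show ?thesis using main[OF greater] p q by (simp add: abs_minus_commute)
  qed
qed

text \<open>
  The reciprocal of the stable constant.
\<close>

definition kappa :: "real \<Rightarrow> real" where
  "kappa a = (LINT x:{0<..}|lborel. x powr (- a) * sin x)"

lemma stable_const_kappa: "stable_const a = inverse (kappa a)"
  by (simp add: stable_const_def kappa_def)

lemma nn_integral_powr_sin_finite:
  fixes a :: real assumes a: "1 < a" "a < 2"
  shows "(\<integral>\<^sup>+y. ennreal (indicator {0<..} y * y powr (- a) * \<bar>sin y\<bar>) \<partial>lborel) < \<infinity>"
proof -
  have "(\<integral>\<^sup>+y. ennreal (indicator {0<..} y * y powr (- a) * \<bar>sin y\<bar>) \<partial>lborel)
     \<le> (\<integral>\<^sup>+y. ennreal (indicator {0..1} y * y powr (1 - a)) + ennreal (indicator {1..} y * y powr (- a)) \<partial>lborel)"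
  proof (rule nn_integral_mono)
    fix y :: real
    consider "y \<le> 0" | "0 < y" "y \<le> 1" | "1 < y" by linarith
    then show "ennreal (indicator {0<..} y * y powr (- a) * \<bar>sin y\<bar>) \<le> ennreal (indicator {0..1} y * y powr (1 - a)) + ennreal (indicator {1..} y * y powr (- a))"
    proof cases
      case 2
      have "y powr (- a) * \<bar>sin y\<bar> \<le> y powr (- a) * y" using abs_sin_x_le_abs_x[of y] 2 by (intro mult_left_mono) auto
      also have "\<dots> = y powr (1 - a)" using 2 by (simp add: powr_diff powr_minus_divide)
      finally have "ennreal (indicator {0<..} y * y powr (- a) * \<bar>sin y\<bar>) \<le> ennreal (indicator {0..1} y * y powr (1 - a))"
        using 2 by (intro ennreal_leI) simp
      then show ?thesis by (rule order_trans) simp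
    next
      case 3
      have "y powr (- a) * \<bar>sin y\<bar> \<le> y powr (- a) * 1" by (intro mult_left_mono) auto
      then show ?thesis using 3 by (auto intro!: ennreal_leI)
    qed auto
  qed
  also have "\<dots> = ennreal (1 / (1 - a + 1)) + ennreal (- 1 / (- a + 1))"
    by (subst nn_integral_add) (use nn_integral_powr_0_1[of "1 - a"] nn_integral_powr_1_inf[of "- a"] a in auto)
  also have "\<dots> < \<infinity>" by (simp add: ennreal_add_less_top)
  finally show ?thesis .
qed

lemma set_integrable_powr_sin:
  fixes a :: real assumes a: "1 < a" "a < 2"
  shows "set_integrable lborel {0<..} (\<lambda>y. y powr (- a) * \<bar>sin y\<bar>)"
    and "set_integrable lborel {0<..} (\<lambda>y. y powr (- a) * sin y)"
  unfolding set_integrable_def using nn_integral_powr_sin_finite[OF a]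
  by (auto intro!: integrableI_bounded simp: abs_mult mult.assoc)

lemma kappa_Lipschitz:
  assumes cd: "1 < c" "d < 2"
  obtains L where "0 \<le> L" "\<And>a a'. a \<in> {c..d} \<Longrightarrow> a' \<in> {c..d} \<Longrightarrow> \<bar>kappa a - kappa a'\<bar> \<le> L * \<bar>a - a'\<bar>"
proof -
  define e where "e = min (c - 1) (2 - d) / 2"
  have e: "0 < e" "1 < c - e" "d + e < 2" using cd by (auto simp: e_def min_def field_simps)
  show ?thesis
  proof (cases "c \<le> d")
    case False
    then show ?thesis by (intro that[of 0]) auto
  next
    case True
    let ?h = "\<lambda>y. y powr (- (c - e)) * \<bar>sin y\<bar> + y powr (- (d + e)) * \<bar>sin y\<bar>"
    have ih: "set_integrable lborel {0<..} ?h"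
      by (intro set_integral_add set_integrable_powr_sin) (use e True in auto)
    define L where "L = (LINT y:{0<..}|lborel. ?h y) / e"
    have "0 \<le> L" unfolding L_def set_lebesgue_integral_def using e by (auto intro!: divide_nonneg_nonneg integral_nonneg_AE)
    moreover have "\<bar>kappa a - kappa a'\<bar> \<le> L * \<bar>a - a'\<bar>" if a: "a \<in> {c..d}" "a' \<in> {c..d}" for a a'
    proof -
      have i: "set_integrable lborel {0<..} (\<lambda>y. y powr (- a) * sin y)" "set_integrable lborel {0<..} (\<lambda>y. y powr (- a') * sin y)"
        by (rule set_integrable_powr_sin; use a e in auto)+
      have "kappa a - kappa a' = (LINT y:{0<..}|lborel. y powr (- a) * sin y - y powr (- a') * sin y)"
        unfolding kappa_def by (rule set_integral_diff(2)[OF i, symmetric])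
      also have "\<bar>\<dots>\<bar> \<le> (LINT y:{0<..}|lborel. \<bar>y powr (- a) * sin y - y powr (- a') * sin y\<bar>)"
        using set_integral_norm_bound[OF set_integral_diff(1)[OF i]] by simp
      also have "\<dots> \<le> (LINT y:{0<..}|lborel. \<bar>a - a'\<bar> / e * ?h y)"
      proof (rule set_integral_mono)
        show "set_integrable lborel {0<..} (\<lambda>y. \<bar>y powr (- a) * sin y - y powr (- a') * sin y\<bar>)"
          using set_integrable_abs[OF set_integral_diff(1)[OF i]] .
        show "set_integrable lborel {0<..} (\<lambda>y. \<bar>a - a'\<bar> / e * ?h y)"
          using ih by (rule set_integrable_mult_right)
        fix y :: real assume "y \<in> {0<..}"
        then have y: "0 < y" by simp
        have "\<bar>y powr (- a) - y powr (- a')\<bar> \<le> \<bar>a - a'\<bar> / e * (y powr (- (c - e)) + y powr (- (d + e)))"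
          using a by (intro abs_powr_diff_le y e(1)) auto
        then have "\<bar>y powr (- a) - y powr (- a')\<bar> * \<bar>sin y\<bar> \<le> \<bar>a - a'\<bar> / e * (y powr (- (c - e)) + y powr (- (d + e))) * \<bar>sin y\<bar>"
          by (rule mult_right_mono) auto
        then show "\<bar>y powr (- a) * sin y - y powr (- a') * sin y\<bar> \<le> \<bar>a - a'\<bar> / e * ?h y"
          by (simp add: left_diff_distrib[symmetric] abs_mult distrib_right mult.assoc)
      qed
      also have "\<dots> = L * \<bar>a - a'\<bar>" by (simp add: L_def set_integral_mult_right)
      finally show ?thesis .
    qed
    ultimately show ?thesis by (rule that)
  qed
qed

lemma integral_sin_indicator:
  fixes z :: real assumes "0 \<le> z"
  shows "(\<integral>y. indicator {y. 0 < y \<and> y \<le> z} y * sin y \<partial>lborel) = 1 - cos z"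
proof -
  have "(\<integral>y. indicator {0..z} y *\<^sub>R sin y \<partial>lborel) = (- cos z) - (- cos 0)"
    by (rule integral_FTC_atLeastAtMost) (use assms in \<open>auto intro!: derivative_eq_intros continuous_intros
       simp: has_real_derivative_iff_has_vector_derivative[symmetric]\<close>)
  also have "(\<lambda>y. indicator {0..z} y *\<^sub>R sin y) = (\<lambda>y. indicator {y. 0 < y \<and> y \<le> z} y * sin y)"
    by (auto simp: fun_eq_iff indicator_def)
  finally show ?thesis by simp
qed

lemma powr_inverse_le_iff:
  fixes v y a :: real assumes "0 < v" "0 < y" "0 < a"
  shows "y \<le> v powr (- 1 / a) \<longleftrightarrow> v \<le> y powr (- a)"
proof
  assume "y \<le> v powr (- 1 / a)"
  then have "(v powr (- 1 / a)) powr (- a) \<le> y powr (- a)" using assms by (intro powr_mono2') auto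
  then show "v \<le> y powr (- a)" using assms by (simp add: powr_powr)
next
  assume "v \<le> y powr (- a)"
  then have "(y powr (- a)) powr (- 1 / a) \<le> v powr (- 1 / a)" using assms by (intro powr_mono2') auto
  then show "y \<le> v powr (- 1 / a)" using assms by (simp add: powr_powr)
qed

text \<open>
  Write \<open>1 - cos z\<close> as the integral of \<open>sin\<close> over \<open>[0, z]\<close> and exchange the integrals. The set of
  \<open>v > 0\<close> with \<open>y \<le> v\<^bsup>-1/a\<^esup>\<close> has length \<open>y\<^bsup>-a\<^esup>\<close>, so the double integral of the absolute value is
  finite: it equals the integral of \<open>y\<^bsup>-a\<^esup> \<bar>sin y\<bar>\<close>.
\<close>

lemma kappa_eq_integral_cos:
  fixes a :: real assumes a: "1 < a" "a < 2"
  shows "integrable lborel (\<lambda>v. indicator {0<..} v * (1 - cos (v powr (- 1 / a))))"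
    and "(\<integral>v. indicator {0<..} v * (1 - cos (v powr (- 1 / a))) \<partial>lborel) = kappa a"
proof -
  let ?S = "{(y, v). 0 < y \<and> 0 < v \<and> y \<le> v powr (- 1 / a)} :: (real \<times> real) set"
  define f where "f y v = indicator ?S (y, v) * sin y" for y v
  have "?S = {p \<in> space (borel \<Otimes>\<^sub>M borel). 0 < fst p \<and> 0 < snd p \<and> fst p \<le> snd p powr (- 1 / a)}"
    by (auto simp: space_pair_measure)
  also have "\<dots> \<in> sets (borel \<Otimes>\<^sub>M borel)" by measurable
  finally have [measurable]: "?S \<in> sets (borel \<Otimes>\<^sub>M borel)" .
  have f_m[measurable]: "case_prod f \<in> borel_measurable (lborel \<Otimes>\<^sub>M lborel)"
    unfolding f_def by measurable
  have f_eq: "f y v = indicator {0<..} y * sin y * indicator {0<..y powr (- a)} v" for y v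
    using powr_inverse_le_iff[of v y a] a by (auto simp: f_def indicator_def)
  have int_v: "(\<integral>v. f y v \<partial>lborel) = indicator {0<..} y * (y powr (- a) * sin y)" for y
    by (simp add: f_eq)
  have int_y: "(\<integral>y. f y v \<partial>lborel) = indicator {0<..} v * (1 - cos (v powr (- 1 / a)))" for v
  proof (cases "0 < v")
    case True
    have "f y v = indicator {y. 0 < y \<and> y \<le> v powr (- 1 / a)} y * sin y" for y
      using True by (auto simp: f_def indicator_def)
    then show ?thesis using integral_sin_indicator[of "v powr (- 1 / a)"] True by simp
  qed (simp add: f_def)
  have int_f: "integrable (lborel \<Otimes>\<^sub>M lborel) (case_prod f)"
  proof (rule lborel_pair.Fubini_integrable[OF f_m])
    have "(\<integral>v. norm (case (y, v) of (y, v) \<Rightarrow> f y v) \<partial>lborel) = indicator {0<..} y *\<^sub>R (y powr (- a) * \<bar>sin y\<bar>)" for y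
      by (simp add: f_eq abs_mult)
    then show "integrable lborel (\<lambda>y. \<integral>v. norm (case (y, v) of (y, v) \<Rightarrow> f y v) \<partial>lborel)"
      using set_integrable_powr_sin(1)[OF a] by (simp add: set_integrable_def)
    show "AE y in lborel. integrable lborel (\<lambda>v. case (y, v) of (y, v) \<Rightarrow> f y v)"
      by (simp add: f_eq integrable_mult_right_iff)
  qed
  have "integrable lborel (\<lambda>v. \<integral>y. f y v \<partial>lborel)"
    using lborel_pair.integrable_snd[OF int_f] .
  then show "integrable lborel (\<lambda>v. indicator {0<..} v * (1 - cos (v powr (- 1 / a))))"
    by (simp add: int_y)
  show "(\<integral>v. indicator {0<..} v * (1 - cos (v powr (- 1 / a))) \<partial>lborel) = kappa a"
    using lborel_pair.Fubini_integral[OF int_f] unfolding int_v int_y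
    by (simp add: kappa_def set_lebesgue_integral_def)
qed

lemma nn_integral_cos_kappa:
  fixes a :: real assumes a: "1 < a" "a < 2"
  shows "(\<integral>\<^sup>+v. ennreal (1 - cos (v powr (- 1 / a))) * indicator {0<..} v \<partial>lborel) = ennreal (kappa a)"
proof -
  have "(\<integral>\<^sup>+v. ennreal (1 - cos (v powr (- 1 / a))) * indicator {0<..} v \<partial>lborel)
      = (\<integral>\<^sup>+v. ennreal (indicator {0<..} v * (1 - cos (v powr (- 1 / a)))) \<partial>lborel)"
    by (intro nn_integral_cong) (auto simp: indicator_def)
  also have "\<dots> = ennreal (kappa a)"
    unfolding kappa_eq_integral_cos(2)[OF a, symmetric]
    by (rule nn_integral_eq_integral[OF kappa_eq_integral_cos(1)[OF a]]) simp
  finally show ?thesis .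
qed

text \<open>
  Visible from the representation by \<open>1 - cos\<close>, whose integrand is nonnegative. For
  \<open>1 \<le> v \<le> 2\<close> the argument \<open>v\<^bsup>-1/a\<^esup>\<close> stays in \<open>[1/2, 1]\<close>, which bounds the integrand from below.
\<close>

lemma kappa_pos:
  fixes a :: real assumes a: "1 < a" "a < 2"
  shows "0 < kappa a"
proof -
  have "ennreal (1 - cos (1/2)) = (\<integral>\<^sup>+v. ennreal (1 - cos (1/2)) * indicator {1..2} (v::real) \<partial>lborel)"
    by (simp add: nn_integral_cmult_indicator)
  also have "\<dots> \<le> (\<integral>\<^sup>+v. ennreal (1 - cos (v powr (- 1 / a))) * indicator {0<..} v \<partial>lborel)"
  proof (rule nn_integral_mono)
    fix v :: real
    show "ennreal (1 - cos (1/2)) * indicator {1..2} v \<le> ennreal (1 - cos (v powr (- 1 / a))) * indicator {0<..} v"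
    proof (cases "v \<in> {1..2}")
      case True
      have "1 / 2 \<le> v powr (- 1)" using True by (simp add: powr_minus field_simps)
      also have "v powr (- 1) \<le> v powr (- 1 / a)" using True a by (intro powr_mono) (auto simp: field_simps)
      finally have "1 / 2 \<le> v powr (- 1 / a)" .
      moreover have "v powr (- 1 / a) \<le> v powr 0" using True a by (intro powr_mono) auto
      ultimately have "1/2 \<le> v powr (- 1 / a)" "v powr (- 1 / a) \<le> pi" using True pi_gt3 by auto
      then have "cos (v powr (- 1 / a)) \<le> cos (1/2)" by (intro cos_monotone_0_pi_le) auto
      then show ?thesis using True by (auto intro!: ennreal_leI)
    qed auto
  qed
  also have "\<dots> = ennreal (kappa a)" by (rule nn_integral_cos_kappa[OF a])
  finally have "ennreal (1 - cos (1/2)) \<le> ennreal (kappa a)" .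
  moreover have "cos (1/2 :: real) < cos 0" by (rule cos_monotone_0_pi) (use pi_gt3 in auto)
  then have "0 < 1 - cos (1/2::real)" by simp
  ultimately show ?thesis by (metis ennreal_less_zero_iff order_less_le_trans)
qed

text \<open>
  Substitute \<open>v = \<bar>k\<bar>\<^bsup>a\<^esup> v'\<close>. This is the scaling that produces the factor \<open>\<bar>\<theta>\<bar>\<^bsup>a\<^esup>\<close> in stable
  characteristic functions and the \<open>L\<^sup>a\<close> norm of the integrand.
\<close>

lemma nn_integral_powr_scale:
  fixes a k :: real and h :: "real \<Rightarrow> ennreal"
  assumes a: "0 < a" and h[measurable]: "h \<in> borel_measurable borel" and even: "\<And>x. h (- x) = h x" and h0: "h 0 = 0"
  shows "(\<integral>\<^sup>+v. h (k * v powr (- 1 / a)) * indicator {0<..} v \<partial>lborel)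
    = ennreal (\<bar>k\<bar> powr a) * (\<integral>\<^sup>+v. h (v powr (- 1 / a)) * indicator {0<..} v \<partial>lborel)"
proof (cases "k = 0")
  case True then show ?thesis by (simp add: h0)
next
  case False
  define c where "c = \<bar>k\<bar> powr a"
  have c: "0 < c" using False by (simp add: c_def)
  have "(\<integral>\<^sup>+v. h (k * v powr (- 1 / a)) * indicator {0<..} v \<partial>lborel)
    = ennreal \<bar>c\<bar> * (\<integral>\<^sup>+v. h (k * (0 + c * v) powr (- 1 / a)) * indicator {0<..} (0 + c * v) \<partial>lborel)"
    by (rule nn_integral_real_affine) (use c in auto)
  also have "(\<integral>\<^sup>+v. h (k * (0 + c * v) powr (- 1 / a)) * indicator {0<..} (0 + c * v) \<partial>lborel)
     = (\<integral>\<^sup>+v. h (v powr (- 1 / a)) * indicator {0<..} v \<partial>lborel)"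
  proof (rule nn_integral_cong)
    fix v :: real
    show "h (k * (0 + c * v) powr (- 1 / a)) * indicator {0<..} (0 + c * v) = h (v powr (- 1 / a)) * indicator {0<..} v"
    proof (cases "0 < v")
      case True
      have "(c * v) powr (- 1 / a) = c powr (- 1 / a) * v powr (- 1 / a)" using c True by (simp add: powr_mult)
      also have "c powr (- 1 / a) = \<bar>k\<bar> powr (- 1)" using a by (simp add: c_def powr_powr)
      also have "\<dots> = 1 / \<bar>k\<bar>" using False by (simp add: powr_minus_divide)
      finally have "k * (c * v) powr (- 1 / a) = sgn k * v powr (- 1 / a)" using False by (simp add: sgn_if)
      moreover have "h (sgn k * v powr (- 1 / a)) = h (v powr (- 1 / a))"
        using False even[of "v powr (- 1 / a)"] by (auto simp: sgn_if)
      ultimately show ?thesis using True c by simp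
    next
      case False
      then show ?thesis using c by (auto simp: indicator_def zero_less_mult_iff)
    qed
  qed
  finally show ?thesis using c by (simp add: c_def)
qed

lemma nn_integral_min_square_powr:
  fixes a k :: real assumes a: "0 < a" "a < 2"
  shows "(\<integral>\<^sup>+v. ennreal (min 1 ((k * v powr (- 1 / a))\<^sup>2)) * indicator {0<..} v \<partial>lborel) \<le> ennreal (2 / (2 - a)) * ennreal (\<bar>k\<bar> powr a)"
proof -
  have "(\<integral>\<^sup>+v. ennreal (min 1 ((v powr (- 1 / a))\<^sup>2)) * indicator {0<..} v \<partial>lborel)
     \<le> (\<integral>\<^sup>+v. ennreal (indicator {0..1} v * v powr 0) + ennreal (indicator {1..} v * v powr (- 2 / a)) \<partial>lborel)"
  proof (rule nn_integral_mono)
    fix v :: real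
    consider "v \<le> 0" | "0 < v" "v \<le> 1" | "1 < v" by linarith
    then show "ennreal (min 1 ((v powr (- 1 / a))\<^sup>2)) * indicator {0<..} v \<le> ennreal (indicator {0..1} v * v powr 0) + ennreal (indicator {1..} v * v powr (- 2 / a))"
    proof cases
      case 2
      then show ?thesis by (auto intro!: add_increasing2)
    next
      case 3
      then have "(v powr (- 1 / a))\<^sup>2 = v powr (- 2 / a)"
        by (simp add: power2_eq_square powr_add[symmetric])
      then show ?thesis using 3 by (auto intro!: ennreal_leI)
    qed auto
  qed
  also have "\<dots> = ennreal (1 / (0 + 1)) + ennreal (- 1 / (- 2 / a + 1))"
    by (subst nn_integral_add) (use nn_integral_powr_0_1[of 0] nn_integral_powr_1_inf[of "- 2 / a"] a in \<open>auto simp: field_simps\<close>)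
  also have "\<dots> = ennreal (2 / (2 - a))"
  proof -
    have "- 1 / (- 2 / a + 1) = a / (2 - a)" using a by (simp add: field_simps)
    moreover have "1 + a / (2 - a) = 2 / (2 - a)" using a by (simp add: field_simps)
    moreover have "ennreal 1 + ennreal (a / (2 - a)) = ennreal (1 + a / (2 - a))"
      using a by (intro ennreal_plus[symmetric]) auto
    ultimately show ?thesis by simp
  qed
  finally have *: "(\<integral>\<^sup>+v. ennreal (min 1 ((v powr (- 1 / a))\<^sup>2)) * indicator {0<..} v \<partial>lborel) \<le> ennreal (2 / (2 - a))" .
  have "(\<integral>\<^sup>+v. ennreal (min 1 ((k * v powr (- 1 / a))\<^sup>2)) * indicator {0<..} v \<partial>lborel)
     = ennreal (\<bar>k\<bar> powr a) * (\<integral>\<^sup>+v. ennreal (min 1 ((v powr (- 1 / a))\<^sup>2)) * indicator {0<..} v \<partial>lborel)"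
    using a by (intro nn_integral_powr_scale[where h="\<lambda>x. ennreal (min 1 (x\<^sup>2))"]) auto
  also have "\<dots> \<le> ennreal (\<bar>k\<bar> powr a) * ennreal (2 / (2 - a))" by (intro mult_left_mono *) auto
  finally show ?thesis by (simp add: mult.commute)
qed

section \<open>Integrability of the logarithmic kernel\<close>

lemma nn_integral_abs_le:
  fixes h :: "real \<Rightarrow> ennreal" assumes [measurable]: "h \<in> borel_measurable borel"
  shows "(\<integral>\<^sup>+y. h \<bar>y\<bar> \<partial>lborel) \<le> 2 * (\<integral>\<^sup>+y. h y * indicator {0..} y \<partial>lborel)"
proof -
  have "(\<integral>\<^sup>+y. h \<bar>y\<bar> \<partial>lborel) \<le> (\<integral>\<^sup>+y. h y * indicator {0..} y + h (- y) * indicator {0..} (- y) \<partial>lborel)"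
    by (intro nn_integral_mono) (auto simp: abs_if indicator_def)
  also have "\<dots> = (\<integral>\<^sup>+y. h y * indicator {0..} y \<partial>lborel) + (\<integral>\<^sup>+y. h (- y) * indicator {0..} (- y) \<partial>lborel)"
    by (rule nn_integral_add) auto
  also have "(\<integral>\<^sup>+y. h (- y) * indicator {0..} (- y) \<partial>lborel) = (\<integral>\<^sup>+y. h y * indicator {0..} y \<partial>lborel)"
    using nn_integral_real_affine[of "\<lambda>y. h y * indicator {0..} y" "-1" 0] by simp
  finally show ?thesis by (simp add: mult_2)
qed

lemma log_kernel_measurable[measurable]: "log_kernel t \<in> borel_measurable borel"
  unfolding log_kernel_def by measurable

lemma abs_ln_le_powr:
  fixes z :: real assumes "0 < z" "z \<le> 3"
  shows "(ln z)\<^sup>2 \<le> 32 * z powr (- 1 / 2) + 18"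
proof -
  have "\<bar>ln z\<bar> \<le> 4 * z powr (- 1 / 4) + 3"
  proof (cases "1 \<le> z")
    case True
    then show ?thesis using ln_le_minus_one[of z] assms by (simp add: add_increasing)
  next
    case False
    have "ln (1/z) \<le> (1/z) powr (1/4) / (1/4)" using False assms by (intro ln_powr_bound) auto
    then show ?thesis using False assms by (simp add: ln_div powr_divide powr_minus_divide)
  qed
  then have "(ln z)\<^sup>2 \<le> (4 * z powr (- 1 / 4) + 3)\<^sup>2"
    by (metis abs_ge_zero power2_abs power_mono)
  also have "\<dots> \<le> 2 * (4 * z powr (- 1 / 4))\<^sup>2 + 2 * 3\<^sup>2"
    using sum_squares_bound[of "4 * z powr (- 1 / 4)" 3] by (simp add: power2_sum)
  also have "(4 * z powr (- 1 / 4))\<^sup>2 = 16 * z powr (- 1 / 2)"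
    using assms by (simp add: power_mult_distrib power2_eq_square[of "z powr _"] powr_add[symmetric])
  finally show ?thesis by simp
qed

text \<open>
  On \<open>[-2, 2]\<close> the two logarithmic singularities are dominated by inverse square roots; outside,
  \<open>\<bar>ln \<bar>1 - 1 / y\<bar>\<bar> \<le> 2 / \<bar>y\<bar>\<close>, and \<open>p > 1\<close> makes the \<open>p\<close>-th power integrable.
\<close>

lemma log_kernel_1_powr_finite:
  fixes p :: real assumes p: "1 < p" "p \<le> 2"
  shows "(\<integral>\<^sup>+y. ennreal (\<bar>log_kernel 1 y\<bar> powr p) \<partial>lborel) < \<infinity>"
proof -
  define \<psi> where "\<psi> z = ennreal (indicator {0..3} z * z powr (- 1 / 2))" for z :: real
  define \<phi> where "\<phi> z = ennreal (indicator {1..} z * z powr (- p))" for z :: real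
  have [measurable]: "\<psi> \<in> borel_measurable borel" "\<phi> \<in> borel_measurable borel" unfolding \<psi>_def \<phi>_def by measurable
  have "(\<integral>\<^sup>+z. \<psi> z * indicator {0..} z \<partial>lborel) = (\<integral>\<^sup>+z. ennreal (indicator {0..3} z * z powr (- 1 / 2)) \<partial>lborel)"
    by (intro nn_integral_cong) (auto simp: \<psi>_def indicator_def)
  also have "\<dots> < \<infinity>"
    using nn_integral_has_integral_lebesgue[OF _ has_integral_powr_from_0[of "- 1 / 2" 3]] by simp
  finally have \<psi>fin: "(\<integral>\<^sup>+z. \<psi> \<bar>z\<bar> \<partial>lborel) < \<infinity>"
    using nn_integral_abs_le[of \<psi>] by (auto intro: le_less_trans simp: ennreal_mult_less_top)
  have "(\<integral>\<^sup>+z. \<phi> z * indicator {0..} z \<partial>lborel) = (\<integral>\<^sup>+z. ennreal (indicator {1..} z * z powr (- p)) \<partial>lborel)"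
    by (intro nn_integral_cong) (auto simp: \<phi>_def indicator_def)
  also have "\<dots> < \<infinity>" using nn_integral_powr_1_inf[of "- p"] p by simp
  finally have \<phi>fin: "(\<integral>\<^sup>+z. \<phi> \<bar>z\<bar> \<partial>lborel) < \<infinity>"
    using nn_integral_abs_le[of \<phi>] by (auto intro: le_less_trans simp: ennreal_mult_less_top)
  have \<psi>1: "(\<integral>\<^sup>+z. \<psi> \<bar>1 - z\<bar> \<partial>lborel) = (\<integral>\<^sup>+z. \<psi> \<bar>z\<bar> \<partial>lborel)"
    using nn_integral_real_affine[of "\<lambda>z. \<psi> \<bar>z\<bar>" "-1" 1] by simp
  have "(\<integral>\<^sup>+y. ennreal (\<bar>log_kernel 1 y\<bar> powr p) \<partial>lborel)
     \<le> (\<integral>\<^sup>+y. 73 * indicator {-2..2} y + 64 * \<psi> \<bar>1 - y\<bar> + 64 * \<psi> \<bar>y\<bar> + ennreal (2 powr p) * \<phi> \<bar>y\<bar> \<partial>lborel)"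
  proof (rule nn_integral_mono_AE)
    have "AE y in lborel. y \<noteq> 0" "AE y in lborel. y \<noteq> (1::real)" by (rule AE_lborel_singleton)+
    then show "AE y in lborel. ennreal (\<bar>log_kernel 1 y\<bar> powr p) \<le> 73 * indicator {-2..2} y + 64 * \<psi> \<bar>1 - y\<bar> + 64 * \<psi> \<bar>y\<bar> + ennreal (2 powr p) * \<phi> \<bar>y\<bar>"
    proof eventually_elim
      case (elim y)
      show ?case
      proof (cases "\<bar>y\<bar> \<le> 2")
        case True
        define q where "q = log_kernel 1 y"
        have "\<bar>q\<bar> powr p \<le> 1 + q\<^sup>2"
        proof (cases "\<bar>q\<bar> \<le> 1")
          case True
          then have "\<bar>q\<bar> powr p \<le> 1" using p powr_le1[of p "\<bar>q\<bar>"] by simp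
          then show ?thesis by (simp add: add_increasing2)
        next
          case False
          then have "\<bar>q\<bar> powr p \<le> \<bar>q\<bar> powr 2" using p by (intro powr_mono) auto
          also have "\<dots> = q\<^sup>2" using False by simp
          finally show ?thesis by simp
        qed
        also have "q\<^sup>2 \<le> 2 * (ln \<bar>1 - y\<bar>)\<^sup>2 + 2 * (ln \<bar>y\<bar>)\<^sup>2"
          using sum_squares_bound[of "ln \<bar>1 - y\<bar>" "- ln \<bar>y\<bar>"] by (simp add: q_def log_kernel_def power2_diff)
        also have "\<dots> \<le> 2 * (32 * \<bar>1 - y\<bar> powr (- 1 / 2) + 18) + 2 * (32 * \<bar>y\<bar> powr (- 1 / 2) + 18)"
          using elim True by (intro add_mono mult_left_mono abs_ln_le_powr) auto
        finally have "\<bar>q\<bar> powr p \<le> 73 + 64 * \<bar>1 - y\<bar> powr (- 1 / 2) + 64 * \<bar>y\<bar> powr (- 1 / 2)" by simp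
        then have "ennreal (\<bar>q\<bar> powr p) \<le> ennreal (73 + 64 * \<bar>1 - y\<bar> powr (- 1 / 2) + 64 * \<bar>y\<bar> powr (- 1 / 2))"
          by (rule ennreal_leI)
        also have "\<dots> = 73 * indicator {-2..2} y + 64 * \<psi> \<bar>1 - y\<bar> + 64 * \<psi> \<bar>y\<bar>"
          using True by (simp add: \<psi>_def ennreal_mult' abs_le_iff)
        finally show ?thesis unfolding q_def by (rule order_trans) simp
      next
        case False
        have "log_kernel 1 y = ln \<bar>(1 - y) / y\<bar>" using elim by (simp add: log_kernel_def ln_div abs_divide)
        also have "(1 - y) / y = - (1 + (- 1 / y))" using elim by (simp add: field_simps)
        also have "\<bar>- (1 + (- 1 / y))\<bar> = 1 + (- 1 / y)"
          unfolding abs_minus_cancel using False by (intro abs_of_nonneg) (auto simp: field_simps abs_if split: if_splits)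
        finally have eq: "log_kernel 1 y = ln (1 + (- 1 / y))" .
        have b: "\<bar>- 1 / y\<bar> \<le> 1 / 2" using False by (simp add: abs_divide field_simps)
        have "\<bar>ln (1 + (- 1 / y))\<bar> \<le> \<bar>- 1 / y\<bar> + 2 * (- 1 / y)\<^sup>2"
          using abs_ln_one_plus_x_minus_x_bound[OF b] by linarith
        also have "2 * (- 1 / y)\<^sup>2 = 2 * \<bar>- 1 / y\<bar> * \<bar>- 1 / y\<bar>" by (simp add: power2_eq_square)
        also have "2 * \<bar>- 1 / y\<bar> * \<bar>- 1 / y\<bar> \<le> 2 * (1/2) * \<bar>- 1 / y\<bar>" using b by (intro mult_right_mono mult_left_mono) auto
        finally have "\<bar>log_kernel 1 y\<bar> \<le> 2 / \<bar>y\<bar>" unfolding eq by simp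
        then have "\<bar>log_kernel 1 y\<bar> powr p \<le> (2 / \<bar>y\<bar>) powr p" using p by (intro powr_mono2) auto
        also have "\<dots> = 2 powr p * \<bar>y\<bar> powr (- p)" using elim by (simp add: powr_divide powr_minus_divide)
        finally have "ennreal (\<bar>log_kernel 1 y\<bar> powr p) \<le> ennreal (2 powr p * \<bar>y\<bar> powr (- p))" by (rule ennreal_leI)
        also have "\<dots> = ennreal (2 powr p) * \<phi> \<bar>y\<bar>" using False by (simp add: \<phi>_def ennreal_mult)
        finally show ?thesis by (rule order_trans) simp
      qed
    qed
  qed
  also have "\<dots> = 73 * emeasure lborel {-2..2::real} + 64 * (\<integral>\<^sup>+z. \<psi> \<bar>1 - z\<bar> \<partial>lborel) + 64 * (\<integral>\<^sup>+z. \<psi> \<bar>z\<bar> \<partial>lborel) + ennreal (2 powr p) * (\<integral>\<^sup>+z. \<phi> \<bar>z\<bar> \<partial>lborel)"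
    by (simp add: nn_integral_add nn_integral_cmult)
  also have "\<dots> < \<infinity>"
    using \<psi>fin \<phi>fin by (simp add: \<psi>1 ennreal_mult_less_top ennreal_add_less_top less_top)
  finally show ?thesis .
qed

definition log_kernel_norm :: "real \<Rightarrow> real" where
  "log_kernel_norm p = (\<integral>y. \<bar>log_kernel 1 y\<bar> powr p \<partial>lborel)"

text \<open>
  The kernel is scale invariant, \<open>log_kernel t (t y) = log_kernel 1 y\<close> for almost all \<open>y\<close>, so the
  integral is linear in \<open>\<bar>t\<bar>\<close>. In particular it is locally bounded in \<open>t\<close>.
\<close>

lemma nn_integral_log_kernel:
  fixes p t :: real assumes p: "1 < p" "p \<le> 2"
  shows "(\<integral>\<^sup>+x. ennreal (\<bar>log_kernel t x\<bar> powr p) \<partial>lborel) = ennreal (\<bar>t\<bar> * log_kernel_norm p)"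
proof (cases "t = 0")
  case True then show ?thesis by (simp add: log_kernel_def)
next
  case False
  have "integrable lborel (\<lambda>y. \<bar>log_kernel 1 y\<bar> powr p)"
    using log_kernel_1_powr_finite[OF p] by (intro integrableI_bounded) auto
  then have 1: "(\<integral>\<^sup>+y. ennreal (\<bar>log_kernel 1 y\<bar> powr p) \<partial>lborel) = ennreal (log_kernel_norm p)"
    unfolding log_kernel_norm_def by (rule nn_integral_eq_integral) simp
  have "(\<integral>\<^sup>+x. ennreal (\<bar>log_kernel t x\<bar> powr p) \<partial>lborel) = ennreal \<bar>t\<bar> * (\<integral>\<^sup>+y. ennreal (\<bar>log_kernel t (0 + t * y)\<bar> powr p) \<partial>lborel)"
    by (rule nn_integral_real_affine) (use False in auto)
  also have "(\<integral>\<^sup>+y. ennreal (\<bar>log_kernel t (0 + t * y)\<bar> powr p) \<partial>lborel) = (\<integral>\<^sup>+y. ennreal (\<bar>log_kernel 1 y\<bar> powr p) \<partial>lborel)"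
  proof (rule nn_integral_cong_AE)
    have "AE y in lborel. y \<noteq> 0" "AE y in lborel. y \<noteq> (1::real)" by (rule AE_lborel_singleton)+
    then show "AE y in lborel. ennreal (\<bar>log_kernel t (0 + t * y)\<bar> powr p) = ennreal (\<bar>log_kernel 1 y\<bar> powr p)"
    proof eventually_elim
      case (elim y)
      have "t - t * y = t * (1 - y)" by (simp add: algebra_simps)
      then have "log_kernel t (0 + t * y) = log_kernel 1 y"
        using elim False by (simp add: log_kernel_def abs_mult ln_mult)
      then show ?case by simp
    qed
  qed
  finally show ?thesis using 1 by (simp add: ennreal_mult')
qed

lemma log_kernel_norm_nonneg: "0 \<le> log_kernel_norm p"
  by (simp add: log_kernel_norm_def)

lemma log_kernel_in_L_space:
  assumes p: "1 < p" "p \<le> 2"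
  shows "log_kernel t \<in> L_space p"
  unfolding L_space_def using nn_integral_log_kernel[OF p, of t]
  by (auto intro!: integrableI_bounded)

lemma log_kernel_norm_pos:
  assumes p: "1 < p" "p \<le> 2"
  shows "0 < log_kernel_norm p"
proof (rule ccontr)
  assume "\<not> ?thesis"
  then have "log_kernel_norm p = 0" using log_kernel_norm_nonneg[of p] by simp
  then have "(\<integral>\<^sup>+x. ennreal (\<bar>log_kernel 1 x\<bar> powr p) \<partial>lborel) = 0" using nn_integral_log_kernel[OF p, of 1] by simp
  then have "AE x in lborel. log_kernel 1 x = 0"
    by (subst (asm) nn_integral_0_iff_AE) auto
  moreover have "log_kernel 1 x \<noteq> 0" if "x \<in> {2..3}" for x
  proof -
    have "ln (x - 1) < ln x" using that by (intro ln_less_cancel_iff[THEN iffD2]) auto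
    then show ?thesis using that by (simp add: log_kernel_def abs_if)
  qed
  ultimately have "AE x in lborel. x \<notin> {2..3::real}" by (auto elim!: eventually_mono)
  then have "{2..3::real} \<in> null_sets lborel" by (subst AE_iff_null_sets) auto
  then show False by auto
qed

section \<open>The Poisson points of a LePage series\<close>

definition shell_index :: "real \<Rightarrow> nat" where
  "shell_index x = (if 0 \<le> x then nat \<lfloor>x\<rfloor> else nat (\<lceil>- x\<rceil> - 1))"

lemma mem_shell_iff: "x \<in> shell j \<longleftrightarrow> j = shell_index x"
proof (cases "0 \<le> x")
  case True
  have "x \<in> shell j \<longleftrightarrow> \<lfloor>x\<rfloor> = int j"
    using True by (auto simp: shell_def floor_eq_iff)
  then show ?thesis using True by (auto simp: shell_index_def)
next
  case False
  have "x \<in> shell j \<longleftrightarrow> \<lceil>- x\<rceil> = int j + 1"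
    using False by (auto simp: shell_def ceiling_eq_iff)
  moreover have "0 < \<lceil>- x\<rceil>" using False by simp
  ultimately show ?thesis using False by (auto simp: shell_index_def)
qed

lemma suminf_shell: "(\<Sum>j. f j * indicator (shell j) x) = (f (shell_index x) :: real)"
proof -
  have "(\<Sum>j. f j * indicator (shell j) x) = (\<Sum>j\<in>{shell_index x}. f j * indicator (shell j) x)"
    by (rule suminf_finite) (auto simp: mem_shell_iff)
  then show ?thesis by (simp add: mem_shell_iff)
qed

lemma m_hat_density_eq: "m_hat_density x = 3 / (pi\<^sup>2 * (real (Suc (shell_index x)))\<^sup>2)"
  unfolding m_hat_density_def suminf_shell by simp

lemma m_hat_density_pos: "0 < m_hat_density x"
  unfolding m_hat_density_eq by (intro divide_pos_pos mult_pos_pos) auto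

lemma m_hat_density_measurable[measurable]: "m_hat_density \<in> borel_measurable borel"
proof -
  have [measurable]: "shell j \<in> sets borel" for j unfolding shell_def by auto
  show ?thesis unfolding m_hat_density_def[abs_def] by measurable
qed

text \<open>
  The probabilistic hypotheses of the theorem.
\<close>

locale lepage_variables = prob_space M for M :: "'w measure" +
  fixes \<Gamma> V \<gamma> :: "nat \<Rightarrow> 'w \<Rightarrow> real"
  assumes arrivals: "poisson_arrival_times M 1 \<Gamma>"
    and V_indep: "indep_vars (\<lambda>_. borel) V UNIV"
    and V_distributed: "\<And>i. distributed M lborel (V i) m_hat_density"
    and \<gamma>_indep: "indep_vars (\<lambda>_. borel) \<gamma> UNIV"
    and \<gamma>_plus: "\<And>i. prob {\<omega> \<in> space M. \<gamma> i \<omega> = 1} = 1 / 2"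
    and \<gamma>_minus: "\<And>i. prob {\<omega> \<in> space M. \<gamma> i \<omega> = - 1} = 1 / 2"
    and sequences_indep: "indep_vars (\<lambda>_. PiM UNIV (\<lambda>_. borel)) (\<lambda>k \<omega> i. ([\<Gamma>, V, \<gamma>] ! k) i \<omega>) {..<3::nat}"
begin

definition gap :: "nat \<Rightarrow> 'w \<Rightarrow> real" where
  "gap i \<omega> = \<Gamma> i \<omega> - (case i of 0 \<Rightarrow> 0 | Suc k \<Rightarrow> \<Gamma> k \<omega>)"

definition arrival :: "nat \<Rightarrow> 'w \<Rightarrow> real" where
  "arrival n \<omega> = (\<Sum>i<n. gap i \<omega>)"

lemma gap_indep: "indep_vars (\<lambda>_. borel) gap UNIV"
  and gap_distributed: "distributed M lborel (gap i) (exponential_density 1)"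
  using arrivals by (auto simp: poisson_arrival_times_def Let_def gap_def[abs_def])

lemma \<Gamma>_eq_arrival: "\<Gamma> n = arrival (Suc n)"
proof
  show "\<Gamma> n \<omega> = arrival (Suc n) \<omega>" for \<omega>
    by (induction n) (simp_all add: arrival_def gap_def)
qed

text \<open>
  Waiting times, positions and signs as one independent family, so that the past and the new
  variables at a given time are disjoint sets of indices.
\<close>

definition coord :: "nat \<times> nat \<Rightarrow> 'w \<Rightarrow> real" where
  "coord p = ([gap, V, \<gamma>] ! fst p) (snd p)"

lemma coord_simps: "coord (0, i) = gap i" "coord (1, i) = V i" "coord (2, i) = \<gamma> i"
  by (simp_all add: coord_def numeral_2_eq_2)

lemma coord_indep: "indep_vars (\<lambda>_. borel) coord ({..<3} \<times> UNIV)"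
proof -
  define Y where "Y k f = (if k = (0::nat) then (\<lambda>i. f i - (case i of 0 \<Rightarrow> 0 | Suc j \<Rightarrow> f j)) else f)" for k and f :: "nat \<Rightarrow> real"
  have Y: "Y k \<in> measurable (PiM UNIV (\<lambda>_. borel)) (PiM UNIV (\<lambda>_. borel))" for k
  proof (cases "k = 0")
    case True
    have "(\<lambda>f. f i - (case i of 0 \<Rightarrow> 0 | Suc j \<Rightarrow> f j)) \<in> borel_measurable (PiM UNIV (\<lambda>_. borel :: real measure))" for i :: nat
      by (cases i) auto
    then show ?thesis unfolding Y_def using True by (auto intro!: measurable_PiM_single' simp: space_PiM PiE_def)
  next
    case False
    then have "Y k = (\<lambda>f. f)" by (auto simp: Y_def)
    then show ?thesis by simp
  qed
  have "indep_vars (\<lambda>_. PiM UNIV (\<lambda>_. borel)) (\<lambda>k \<omega>. Y k (\<lambda>i. ([\<Gamma>, V, \<gamma>] ! k) i \<omega>)) {..<3}"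
    by (rule indep_vars_compose2[OF sequences_indep]) (rule Y)
  also have "?this \<longleftrightarrow> indep_vars (\<lambda>_. PiM UNIV (\<lambda>_. borel)) (\<lambda>k \<omega>. \<lambda>i\<in>UNIV. ([gap, V, \<gamma>] ! k) i \<omega>) {..<3}"
  proof (rule indep_vars_cong)
    fix k :: nat assume "k \<in> {..<3}"
    then have "k = 0 \<or> k = 1 \<or> k = 2" by auto
    then show "(\<lambda>\<omega>. Y k (\<lambda>i. ([\<Gamma>, V, \<gamma>] ! k) i \<omega>)) = (\<lambda>\<omega>. \<lambda>i\<in>UNIV. ([gap, V, \<gamma>] ! k) i \<omega>)"
      by (auto simp: Y_def gap_def fun_eq_iff split: nat.splits)
  qed auto
  finally have cols: "indep_vars (\<lambda>_. PiM UNIV (\<lambda>_. borel)) (\<lambda>k \<omega>. \<lambda>i\<in>UNIV. ([gap, V, \<gamma>] ! k) i \<omega>) {..<3}" .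
  have "indep_vars (\<lambda>_. borel) (\<lambda>p. ([gap, V, \<gamma>] ! fst p) (snd p)) ({..<3} \<times> UNIV)"
  proof (rule indep_vars_Times[OF _ cols])
    fix k :: nat assume "k \<in> {..<3}"
    then have "k = 0 \<or> k = 1 \<or> k = 2" by auto
    then show "indep_vars (\<lambda>_. borel) (([gap, V, \<gamma>] ! k)) UNIV"
      using gap_indep V_indep \<gamma>_indep by (auto simp: numeral_2_eq_2)
  qed
  then show ?thesis by (simp add: coord_def[abs_def])
qed

lemma coord_measurable: "k < 3 \<Longrightarrow> coord (k, i) \<in> borel_measurable M"
  using coord_indep by (auto simp: indep_vars_def2)

lemma gap_measurable[measurable]: "gap i \<in> borel_measurable M"
  and V_measurable[measurable]: "V i \<in> borel_measurable M"
  and \<gamma>_measurable[measurable]: "\<gamma> i \<in> borel_measurable M"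
  using coord_measurable[of 0 i] coord_measurable[of 1 i] coord_measurable[of 2 i] unfolding coord_simps by simp_all

lemma arrival_measurable[measurable]: "arrival n \<in> borel_measurable M"
  unfolding arrival_def[abs_def] by measurable

lemma \<Gamma>_measurable[measurable]: "\<Gamma> n \<in> borel_measurable M"
  using arrival_measurable[of "Suc n"] by (simp add: \<Gamma>_eq_arrival)

text \<open>
  What is known once the coordinates in \<open>A\<close> are known. With it, being a function of the past is a
  measurability statement.
\<close>

definition info :: "(nat \<times> nat) set \<Rightarrow> 'w measure" where
  "info A = vimage_algebra (space M) (\<lambda>\<omega>. \<lambda>p\<in>A. coord p \<omega>) (PiM A (\<lambda>_. borel))"

lemma space_info[simp]: "space (info A) = space M"
  by (simp add: info_def)

lemma coord_info: "p \<in> A \<Longrightarrow> coord p \<in> borel_measurable (info A)"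
proof -
  assume p: "p \<in> A"
  have "(\<lambda>\<omega>. \<lambda>p\<in>A. coord p \<omega>) \<in> measurable (info A) (PiM A (\<lambda>_. borel))"
    unfolding info_def by (rule measurable_vimage_algebra1) (auto simp: space_PiM)
  from measurable_compose[OF this measurable_component_singleton[OF p]] show ?thesis using p by simp
qed

lemma info_mono: "A \<subseteq> B \<Longrightarrow> subalgebra (info B) (info A)"
proof -
  assume AB: "A \<subseteq> B"
  have "(\<lambda>\<omega>. \<lambda>p\<in>A. coord p \<omega>) \<in> measurable (info B) (PiM A (\<lambda>_. borel))"
    using AB by (intro measurable_restrict coord_info) auto
  from sets_image_in_sets[OF space_info this] show ?thesis
    unfolding subalgebra_def by (simp add: info_def[of A])
qed

lemma subalgebra_info: "A \<subseteq> {..<3} \<times> UNIV \<Longrightarrow> subalgebra M (info A)"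
proof -
  assume A: "A \<subseteq> {..<3} \<times> UNIV"
  have "coord p \<in> borel_measurable M" if "p \<in> A" for p
    using coord_measurable[of "fst p" "snd p"] A that by auto
  then have "(\<lambda>\<omega>. \<lambda>p\<in>A. coord p \<omega>) \<in> measurable M (PiM A (\<lambda>_. borel))"
    by (intro measurable_restrict) auto
  from sets_image_in_sets[OF refl this] show ?thesis
    unfolding subalgebra_def by (simp add: info_def)
qed

lemma indep_info:
  assumes "A \<inter> B = {}" "A \<subseteq> {..<3} \<times> UNIV" "B \<subseteq> {..<3} \<times> UNIV"
    and "Z \<in> measurable (info A) S" "W \<in> measurable (info B) T"
  shows "indep_var S Z T W"
  using indep_var_vimage_algebra[OF indep_var_restrict[OF coord_indep assms(1-3)]] assms(4-5)
  by (auto simp: info_def)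

lemma gap_info: "(0, i) \<in> B \<Longrightarrow> gap i \<in> borel_measurable (info B)"
  and V_info: "(1, i) \<in> B \<Longrightarrow> V i \<in> borel_measurable (info B)"
  and \<gamma>_info: "(2, i) \<in> B \<Longrightarrow> \<gamma> i \<in> borel_measurable (info B)"
  using coord_info[of "(0, i)" B] coord_info[of "(1, i)" B] coord_info[of "(2, i)" B]
  unfolding coord_simps by blast+

lemma arrival_info: "{0} \<times> {..<n} \<subseteq> B \<Longrightarrow> arrival n \<in> borel_measurable (info B)"
  unfolding arrival_def[abs_def] by (intro borel_measurable_sum gap_info) auto

lemma \<Gamma>_info: "{0} \<times> {..i} \<subseteq> B \<Longrightarrow> \<Gamma> i \<in> borel_measurable (info B)"
  by (subst \<Gamma>_eq_arrival, rule arrival_info) (simp only: lessThan_Suc_atMost)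

definition past :: "nat \<Rightarrow> (nat \<times> nat) set" where
  "past n = {..<3} \<times> {..<n}"

lemma \<gamma>_sign: "AE \<omega> in M. \<gamma> i \<omega> = 1 \<or> \<gamma> i \<omega> = - 1"
proof -
  have "prob ({\<omega> \<in> space M. \<gamma> i \<omega> = 1} \<union> {\<omega> \<in> space M. \<gamma> i \<omega> = - 1}) = 1"
    using \<gamma>_plus[of i] \<gamma>_minus[of i] by (subst finite_measure_Union) auto
  also have "{\<omega> \<in> space M. \<gamma> i \<omega> = 1} \<union> {\<omega> \<in> space M. \<gamma> i \<omega> = - 1} = {\<omega> \<in> space M. \<gamma> i \<omega> = 1 \<or> \<gamma> i \<omega> = - 1}" by auto
  finally show ?thesis by (subst (asm) prob_Collect_eq_1) auto
qed

lemma expectation_\<gamma>: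
  fixes h :: "real \<Rightarrow> 'c::{banach, second_countable_topology}"
  assumes [measurable]: "h \<in> borel_measurable borel"
  shows "(\<integral>\<omega>. h (\<gamma> i \<omega>) \<partial>M) = (1 / 2) *\<^sub>R (h 1 + h (- 1))"
proof -
  have "(\<integral>\<omega>. h (\<gamma> i \<omega>) \<partial>M) = (\<integral>\<omega>. indicator {\<omega> \<in> space M. \<gamma> i \<omega> = 1} \<omega> *\<^sub>R h 1 + indicator {\<omega> \<in> space M. \<gamma> i \<omega> = - 1} \<omega> *\<^sub>R h (- 1) \<partial>M)"
  proof (rule integral_cong_AE)
    show "AE \<omega> in M. h (\<gamma> i \<omega>) = indicator {\<omega> \<in> space M. \<gamma> i \<omega> = 1} \<omega> *\<^sub>R h 1 + indicator {\<omega> \<in> space M. \<gamma> i \<omega> = - 1} \<omega> *\<^sub>R h (- 1)"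
      using \<gamma>_sign[of i] AE_space by eventually_elim auto
  qed measurable
  also have "\<dots> = (1/2) *\<^sub>R h 1 + (1/2) *\<^sub>R h (- 1)"
    by (subst Bochner_Integration.integral_add) (auto simp: \<gamma>_plus \<gamma>_minus less_top[symmetric])
  finally show ?thesis by (simp add: scaleR_add_right)
qed

lemma nn_integral_V: 
  assumes [measurable]: "h \<in> borel_measurable borel"
  shows "(\<integral>\<^sup>+\<omega>. h (V i \<omega>) \<partial>M) = (\<integral>\<^sup>+x. ennreal (m_hat_density x) * h x \<partial>lborel)"
  by (rule distributed_nn_integral[OF V_distributed, symmetric]) simp

lemma gap_pos: "AE \<omega> in M. 0 < gap i \<omega>"
proof -
  have "AE x in lborel. x \<noteq> (0::real)" by (rule AE_lborel_singleton)
  then have "AE x in lborel. 0 < ennreal (exponential_density 1 x) \<longrightarrow> 0 < x"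
    by eventually_elim (auto simp: erlang_density_def split: if_splits)
  then have "AE x in distr M lborel (gap i). 0 < x"
    unfolding distributed_distr_eq_density[OF gap_distributed]
    by (subst AE_density) (auto intro!: distributed_borel_measurable[OF gap_distributed])
  then show ?thesis by (subst (asm) AE_distr_iff) auto
qed

lemma arrival_nonneg: "AE \<omega> in M. 0 \<le> arrival n \<omega>"
proof -
  have "AE \<omega> in M. \<forall>i. 0 < gap i \<omega>" by (subst AE_all_countable) (simp add: gap_pos)
  then show ?thesis by eventually_elim (simp add: arrival_def sum_nonneg less_imp_le)
qed

lemma \<Gamma>_pos: "AE \<omega> in M. 0 < \<Gamma> n \<omega>"
proof -
  have "AE \<omega> in M. \<forall>i. 0 < gap i \<omega>" by (subst AE_all_countable) (simp add: gap_pos)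
  then show ?thesis
  proof eventually_elim
    case (elim \<omega>)
    then have "0 \<le> (\<Sum>i<n. gap i \<omega>)" by (intro sum_nonneg) (simp add: less_imp_le)
    then show ?case using elim by (simp add: \<Gamma>_eq_arrival arrival_def add_nonneg_pos)
  qed
qed

lemma \<Gamma>_distributed: "distributed M lborel (\<Gamma> n) (erlang_density n 1)"
proof -
  have "distributed M lborel (\<lambda>\<omega>. \<Sum>i\<in>{..<Suc n}. gap i \<omega>) (erlang_density (card {..<Suc n} - 1) 1)"
    by (rule exponential_distributed_sum[OF _ _ _ gap_distributed indep_vars_subset[OF gap_indep]]) auto
  then show ?thesis by (simp add: \<Gamma>_eq_arrival arrival_def[abs_def])
qed

lemma suminf_erlang_density: "0 \<le> s \<Longrightarrow> (\<Sum>i. ennreal (erlang_density i 1 s)) = 1"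
proof -
  assume s: "0 \<le> s"
  have "(\<lambda>i. s ^ i / fact i) sums exp s"
    using exp_converges[of s] by (simp only: real_scaleR_def divide_inverse mult.commute)
  then have "(\<lambda>i. s ^ i / fact i * exp (- s)) sums (exp s * exp (- s))" by (rule sums_mult2)
  also have "(\<lambda>i. s ^ i / fact i * exp (- s)) = (\<lambda>i. erlang_density i 1 s)"
    using s by (auto simp: erlang_density_def fun_eq_iff)
  finally have *: "(\<lambda>i. erlang_density i 1 s) sums 1" by (simp add: exp_minus)
  then have "(\<Sum>i. ennreal (erlang_density i 1 s)) = ennreal (\<Sum>i. erlang_density i 1 s)"
    by (intro suminf_ennreal2) (auto simp: sums_iff)
  then show ?thesis using * by (simp add: sums_iff)
qed

text \<open>
  The \<open>i\<close>-th arrival time has an Erlang density and is independent of \<open>V i\<close>; the Erlang densities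
  sum to \<open>1\<close> on the half-line.
\<close>

lemma Campbell_formula_\<Gamma>_V:
  assumes \<phi>[measurable]: "\<phi> \<in> borel_measurable (borel \<Otimes>\<^sub>M borel)"
  shows "(\<Sum>i. \<integral>\<^sup>+\<omega>. \<phi> (\<Gamma> i \<omega>, V i \<omega>) \<partial>M)
    = (\<integral>\<^sup>+x. (\<integral>\<^sup>+s. \<phi> (s, x) * indicator {0<..} s \<partial>lborel) * ennreal (m_hat_density x) \<partial>lborel)"
proof -
  have [measurable]: "(\<lambda>s. erlang_density i 1 s) \<in> borel_measurable borel" for i by simp
  have ind: "indep_var lborel (\<Gamma> i) lborel (V i)" for i
  proof (rule indep_info[of "{0} \<times> UNIV" "{1} \<times> UNIV"])
    show "\<Gamma> i \<in> measurable (info ({0} \<times> UNIV)) lborel" using \<Gamma>_info[of i "{0} \<times> UNIV"] by auto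
    show "V i \<in> measurable (info ({1} \<times> UNIV)) lborel" using V_info[of i "{1} \<times> UNIV"] by simp
  qed auto
  have "(\<integral>\<^sup>+\<omega>. \<phi> (\<Gamma> i \<omega>, V i \<omega>) \<partial>M)
    = (\<integral>\<^sup>+x. \<integral>\<^sup>+s. ennreal (erlang_density i 1 s) * (ennreal (m_hat_density x) * \<phi> (s, x)) \<partial>lborel \<partial>lborel)" for i
  proof -
    have D: "distributed M (lborel \<Otimes>\<^sub>M lborel) (\<lambda>\<omega>. (\<Gamma> i \<omega>, V i \<omega>))
       (\<lambda>(s, x). ennreal (erlang_density i 1 s) * ennreal (m_hat_density x))"
      by (rule distributed_joint_indep[OF lborel.sigma_finite_measure_axioms lborel.sigma_finite_measure_axioms
            \<Gamma>_distributed[of i] V_distributed[of i] ind[of i]])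
    have "(\<integral>\<^sup>+\<omega>. \<phi> (\<Gamma> i \<omega>, V i \<omega>) \<partial>M) = (\<integral>\<^sup>+p. (case p of (s, x) \<Rightarrow> ennreal (erlang_density i 1 s) * ennreal (m_hat_density x)) * \<phi> p \<partial>(lborel \<Otimes>\<^sub>M lborel))"
      by (rule distributed_nn_integral[OF D, symmetric]) simp
    also have "\<dots> = (\<integral>\<^sup>+x. \<integral>\<^sup>+s. ennreal (erlang_density i 1 s) * ennreal (m_hat_density x) * \<phi> (s, x) \<partial>lborel \<partial>lborel)"
      by (subst lborel_pair.nn_integral_snd[symmetric]) auto
    finally show ?thesis by (simp add: mult.assoc)
  qed
  then have "(\<Sum>i. \<integral>\<^sup>+\<omega>. \<phi> (\<Gamma> i \<omega>, V i \<omega>) \<partial>M)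
    = (\<integral>\<^sup>+x. \<integral>\<^sup>+s. (\<Sum>i. ennreal (erlang_density i 1 s) * (ennreal (m_hat_density x) * \<phi> (s, x))) \<partial>lborel \<partial>lborel)"
    by (simp add: nn_integral_suminf[symmetric])
  also have "\<dots> = (\<integral>\<^sup>+x. \<integral>\<^sup>+s. \<phi> (s, x) * indicator {0<..} s * ennreal (m_hat_density x) \<partial>lborel \<partial>lborel)"
  proof (rule nn_integral_cong, rule nn_integral_cong_AE)
    fix x :: real
    have "AE s in lborel. s \<noteq> (0::real)" by (rule AE_lborel_singleton)
    then show "AE s in lborel. (\<Sum>i. ennreal (erlang_density i 1 s) * (ennreal (m_hat_density x) * \<phi> (s, x)))
      = \<phi> (s, x) * indicator {0<..} s * ennreal (m_hat_density x)"
    proof eventually_elim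
      case (elim s)
      show ?case
      proof (cases "0 < s")
        case True
        have "(\<Sum>i. ennreal (erlang_density i 1 s) * (ennreal (m_hat_density x) * \<phi> (s, x)))
            = (\<Sum>i. ennreal (erlang_density i 1 s)) * (ennreal (m_hat_density x) * \<phi> (s, x))"
          by (rule ennreal_suminf_multc)
        also have "\<dots> = ennreal (m_hat_density x) * \<phi> (s, x)"
          using suminf_erlang_density[of s] True by (simp only: less_imp_le mult_1)
        also have "\<dots> = \<phi> (s, x) * indicator {0<..} s * ennreal (m_hat_density x)" using True by (simp add: mult.commute)
        finally show ?thesis .
      next
        case False
        then have "erlang_density i 1 s = 0" for i using elim by (simp add: erlang_density_def)
        then show ?thesis using False by simp
      qed
    qed
  qed
  also have "\<dots> = (\<integral>\<^sup>+x. (\<integral>\<^sup>+s. \<phi> (s, x) * indicator {0<..} s \<partial>lborel) * ennreal (m_hat_density x) \<partial>lborel)"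
    by (intro nn_integral_cong nn_integral_multc) simp
  finally show ?thesis .
qed

text \<open>
  The points \<open>(pt i, V i)\<close> carry Lebesgue intensity, see \<open>Campbell_formula\<close> below.
\<close>

definition pt :: "nat \<Rightarrow> 'w \<Rightarrow> real" where
  "pt i \<omega> = \<Gamma> i \<omega> * m_hat_density (V i \<omega>)"

lemma pt_measurable[measurable]: "pt i \<in> borel_measurable M"
  unfolding pt_def[abs_def] by measurable

end

lemma nn_integral_m_hat_scale:
  assumes \<phi>[measurable]: "\<phi> \<in> borel_measurable (borel \<Otimes>\<^sub>M borel)"
  shows "(\<integral>\<^sup>+s. \<phi> (s * m_hat_density x, x) * indicator {0<..} s \<partial>lborel) * ennreal (m_hat_density x)
      = (\<integral>\<^sup>+v. \<phi> (v, x) * indicator {0<..} v \<partial>lborel)"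
proof -
  let ?c = "m_hat_density x"
  have c: "0 < ?c" by (rule m_hat_density_pos)
  have "(\<integral>\<^sup>+v. \<phi> (v, x) * indicator {0<..} v \<partial>lborel) = ennreal \<bar>?c\<bar> * (\<integral>\<^sup>+s. \<phi> (0 + ?c * s, x) * indicator {0<..} (0 + ?c * s) \<partial>lborel)"
    by (rule nn_integral_real_affine) (use c in auto)
  also have "(\<integral>\<^sup>+s. \<phi> (0 + ?c * s, x) * indicator {0<..} (0 + ?c * s) \<partial>lborel) = (\<integral>\<^sup>+s. \<phi> (s * ?c, x) * indicator {0<..} s \<partial>lborel)"
    by (intro nn_integral_cong) (use c in \<open>auto simp: indicator_def zero_less_mult_iff mult.commute\<close>)
  finally show ?thesis using c by (simp add: mult.commute)
qed

definition mass :: "(real \<Rightarrow> real \<Rightarrow> real) \<Rightarrow> ennreal" where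
  "mass G = (\<integral>\<^sup>+x. \<integral>\<^sup>+v. ennreal (min 1 ((G v x)\<^sup>2)) * indicator {0<..} v \<partial>lborel \<partial>lborel)"

context lepage_variables
begin

lemma Campbell_formula:
  assumes \<phi>[measurable]: "\<phi> \<in> borel_measurable (borel \<Otimes>\<^sub>M borel)"
  shows "(\<Sum>i. \<integral>\<^sup>+\<omega>. \<phi> (pt i \<omega>, V i \<omega>) \<partial>M) = (\<integral>\<^sup>+x. \<integral>\<^sup>+v. \<phi> (v, x) * indicator {0<..} v \<partial>lborel \<partial>lborel)"
proof -
  have "(\<lambda>(s, x). \<phi> (s * m_hat_density x, x)) \<in> borel_measurable (borel \<Otimes>\<^sub>M borel)" by measurable
  from Campbell_formula_\<Gamma>_V[OF this] show ?thesis
    by (simp add: pt_def nn_integral_m_hat_scale[OF \<phi>])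
qed

text \<open>
  The expected number of arrivals up to \<open>N\<close> is \<open>N\<close>, hence almost surely finite.
\<close>

lemma arrival_at_top: "AE \<omega> in M. filterlim (\<lambda>n. arrival n \<omega>) at_top sequentially"
proof -
  have "AE \<omega> in M. \<forall>\<^sub>F i in sequentially. real N < \<Gamma> i \<omega>" for N :: nat
  proof -
    define A where "A i = {\<omega> \<in> space M. \<Gamma> i \<omega> \<le> real N}" for i
    have [measurable]: "A i \<in> events" for i unfolding A_def by measurable
    define \<phi> where "\<phi> = (\<lambda>(s, x::real). indicator {..real N} s :: ennreal)"
    have [measurable]: "\<phi> \<in> borel_measurable (borel \<Otimes>\<^sub>M borel)" unfolding \<phi>_def by measurable
    have "(\<Sum>i. ennreal (prob (A i))) = (\<Sum>i. \<integral>\<^sup>+\<omega>. \<phi> (\<Gamma> i \<omega>, V i \<omega>) \<partial>M)"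
    proof (rule suminf_cong)
      fix i
      have "(\<integral>\<^sup>+\<omega>. \<phi> (\<Gamma> i \<omega>, V i \<omega>) \<partial>M) = (\<integral>\<^sup>+\<omega>. indicator (A i) \<omega> \<partial>M)"
        by (intro nn_integral_cong) (auto simp: \<phi>_def A_def indicator_def)
      then show "ennreal (prob (A i)) = (\<integral>\<^sup>+\<omega>. \<phi> (\<Gamma> i \<omega>, V i \<omega>) \<partial>M)" by (simp add: emeasure_eq_measure)
    qed
    also have "\<dots> = (\<integral>\<^sup>+x. (\<integral>\<^sup>+s. \<phi> (s, x) * indicator {0<..} s \<partial>lborel) * ennreal (m_hat_density x) \<partial>lborel)"
      by (rule Campbell_formula_\<Gamma>_V) measurable
    also have "\<dots> = (\<integral>\<^sup>+x. ennreal (m_hat_density x) * ennreal (real N) \<partial>lborel)"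
    proof (rule nn_integral_cong)
      fix x :: real
      have "(\<integral>\<^sup>+s. \<phi> (s, x) * indicator {0<..} s \<partial>lborel) = (\<integral>\<^sup>+s. indicator {0<..real N} s \<partial>lborel)"
        by (intro nn_integral_cong) (auto simp: \<phi>_def indicator_def)
      then show "(\<integral>\<^sup>+s. \<phi> (s, x) * indicator {0<..} s \<partial>lborel) * ennreal (m_hat_density x) = ennreal (m_hat_density x) * ennreal (real N)"
        by (simp add: mult.commute)
    qed
    also have "\<dots> = (\<integral>\<^sup>+\<omega>. ennreal (real N) \<partial>M)" by (rule nn_integral_V[of _ 0, symmetric]) simp
    also have "\<dots> < top" by (simp add: emeasure_space_1)
    finally have "summable (\<lambda>i. prob (A i))" by (intro summable_suminf_not_top) auto
    then have "AE \<omega> in M. \<forall>\<^sub>F i in sequentially. \<omega> \<in> space M - A i"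
      by (intro borel_cantelli_AE1) (auto simp: emeasure_eq_measure)
    then show ?thesis by eventually_elim (auto simp: A_def not_le elim!: eventually_mono)
  qed
  then have "AE \<omega> in M. \<forall>N::nat. \<forall>\<^sub>F i in sequentially. real N < \<Gamma> i \<omega>" by (subst AE_all_countable) simp
  then show ?thesis
  proof eventually_elim
    case (elim \<omega>)
    have "filterlim (\<lambda>n. \<Gamma> n \<omega>) at_top sequentially"
      unfolding filterlim_at_top
    proof
      fix Z :: real
      obtain N :: nat where "Z \<le> real N" using real_arch_simple by blast
      then show "\<forall>\<^sub>F n in sequentially. Z \<le> \<Gamma> n \<omega>" using elim[rule_format, of N] by (auto elim!: eventually_mono)
    qed
    then show ?case
      using filterlim_sequentially_Suc[of "\<lambda>n. arrival n \<omega>" at_top] by (simp add: \<Gamma>_eq_arrival)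
  qed
qed

section \<open>Convergence of random series over the Poisson points\<close>

definition trunc :: "real \<Rightarrow> real" where
  "trunc y = (if \<bar>y\<bar> \<le> 1 then y else 0)"

lemma trunc_measurable[measurable]: "trunc \<in> borel_measurable borel"
  unfolding trunc_def[abs_def] by measurable

text \<open>
  The number of terms with \<open>\<bar>G\<bar> > 1\<close> and the sum of the squares of the others have together the
  expectation \<open>mass G\<close>, by Campbell's formula for \<open>min 1 (G\<^sup>2)\<close>. So only finitely many terms are large, and the truncated ones form a
  summable series of martingale differences, as each sign is independent of everything up to its
  own position. The expected number of large terms bounds the probability that there is one; otherwise the
  sum coincides with the truncated one, whose second moment is at most the expected sum of squares.
\<close>

lemma random_series:
  assumes Gm[measurable]: "case_prod G \<in> borel_measurable (borel \<Otimes>\<^sub>M borel)" and fin: "mass G < \<infinity>"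
  shows random_series_summable: "AE \<omega> in M. summable (\<lambda>i. \<gamma> i \<omega> * G (pt i \<omega>) (V i \<omega>))"
    and random_series_bound: "(\<integral>\<^sup>+\<omega>. ennreal (min 1 ((\<Sum>i. \<gamma> i \<omega> * G (pt i \<omega>) (V i \<omega>))\<^sup>2)) \<partial>M) \<le> mass G"
proof -
  define g where "g i \<omega> = G (pt i \<omega>) (V i \<omega>)" for i \<omega>
  \<comment> \<open>sgn makes the terms bounded everywhere, not only almost surely\<close>
  define X where "X i \<omega> = sgn (\<gamma> i \<omega>) * trunc (g i \<omega>)" for i \<omega>
  define A where "A i = {\<omega> \<in> space M. 1 < \<bar>g i \<omega>\<bar>}" for i
  have gm[measurable]: "g i \<in> borel_measurable M" for i
    using measurable_compose[OF measurable_Pair[OF pt_measurable[of i] V_measurable[of i]] Gm] by (simp add: g_def[abs_def])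
  have [measurable]: "A i \<in> events" for i unfolding A_def by measurable
  have [measurable]: "X i \<in> borel_measurable M" for i unfolding X_def by measurable
  have X1: "\<bar>X i \<omega>\<bar> \<le> 1" for i \<omega> by (auto simp: X_def trunc_def sgn_if)
  have X2_int: "integrable M (\<lambda>\<omega>. (X i \<omega>)\<^sup>2)" for i
    by (rule integrable_const_bound[where B=1]) (use X1 in \<open>auto simp: abs_square_le_1\<close>)
  have le: "ennreal (prob (A i)) + ennreal (\<integral>\<omega>. (X i \<omega>)\<^sup>2 \<partial>M) \<le> (\<integral>\<^sup>+\<omega>. ennreal (min 1 ((g i \<omega>)\<^sup>2)) \<partial>M)" for i
  proof -
    have "ennreal (prob (A i)) + ennreal (\<integral>\<omega>. (X i \<omega>)\<^sup>2 \<partial>M) = (\<integral>\<^sup>+\<omega>. indicator (A i) \<omega> \<partial>M) + (\<integral>\<^sup>+\<omega>. ennreal ((X i \<omega>)\<^sup>2) \<partial>M)"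
      using X2_int by (simp add: emeasure_eq_measure nn_integral_eq_integral)
    also have "\<dots> = (\<integral>\<^sup>+\<omega>. indicator (A i) \<omega> + ennreal ((X i \<omega>)\<^sup>2) \<partial>M)"
      by (rule nn_integral_add[symmetric]) auto
    also have "\<dots> \<le> (\<integral>\<^sup>+\<omega>. ennreal (min 1 ((g i \<omega>)\<^sup>2)) \<partial>M)"
    proof (rule nn_integral_mono)
      fix \<omega> assume "\<omega> \<in> space M"
      show "indicator (A i) \<omega> + ennreal ((X i \<omega>)\<^sup>2) \<le> ennreal (min 1 ((g i \<omega>)\<^sup>2))"
      proof (cases "\<omega> \<in> A i")
        case True
        then have *: "1 < \<bar>g i \<omega>\<bar>" by (auto simp: A_def)
        then have "1 \<le> (g i \<omega>)\<^sup>2" by (metis abs_square_le_1 linear not_le power2_abs abs_ge_zero one_le_power less_imp_le)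
        then show ?thesis using True * by (simp add: X_def trunc_def)
      next
        case False
        then have *: "\<bar>g i \<omega>\<bar> \<le> 1" using \<open>\<omega> \<in> space M\<close> by (auto simp: A_def)
        then have "(X i \<omega>)\<^sup>2 \<le> (g i \<omega>)\<^sup>2"
          by (auto simp: X_def trunc_def sgn_if power_mult_distrib)
        moreover have "(X i \<omega>)\<^sup>2 \<le> 1" using X1 by (simp add: abs_square_le_1)
        ultimately show ?thesis using False by (auto intro!: ennreal_leI)
      qed
    qed
    finally show ?thesis .
  qed
  define \<phi> where "\<phi> = (\<lambda>(v, x). ennreal (min 1 ((G v x)\<^sup>2)))"
  have [measurable]: "\<phi> \<in> borel_measurable (borel \<Otimes>\<^sub>M borel)" unfolding \<phi>_def by measurable
  have "(\<Sum>i. \<integral>\<^sup>+\<omega>. ennreal (min 1 ((g i \<omega>)\<^sup>2)) \<partial>M) = mass G"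
    using Campbell_formula[of \<phi>] by (simp add: \<phi>_def mass_def g_def)
  moreover have "(\<Sum>i. ennreal (prob (A i)) + ennreal (\<integral>\<omega>. (X i \<omega>)\<^sup>2 \<partial>M)) \<le> (\<Sum>i. \<integral>\<^sup>+\<omega>. ennreal (min 1 ((g i \<omega>)\<^sup>2)) \<partial>M)"
    by (intro suminf_le le) auto
  ultimately have tot: "(\<Sum>i. ennreal (prob (A i))) + (\<Sum>i. ennreal (\<integral>\<omega>. (X i \<omega>)\<^sup>2 \<partial>M)) \<le> mass G"
    by (simp add: suminf_add)
  then have "(\<Sum>i. ennreal (prob (A i))) + (\<Sum>i. ennreal (\<integral>\<omega>. (X i \<omega>)\<^sup>2 \<partial>M)) < top"
    by (rule le_less_trans[OF _ fin[unfolded infinity_ennreal_def]])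
  then have tot_fin: "(\<Sum>i. ennreal (prob (A i))) < top" "(\<Sum>i. ennreal (\<integral>\<omega>. (X i \<omega>)\<^sup>2 \<partial>M)) < top"
    by (simp_all only: ennreal_add_less_top)
  have sA: "summable (\<lambda>i. prob (A i))" using tot_fin(1) by (intro summable_suminf_not_top) auto
  have sX: "summable (\<lambda>i. \<integral>\<omega>. (X i \<omega>)\<^sup>2 \<partial>M)" using tot_fin(2) by (intro summable_suminf_not_top) auto
  define F where "F n = info (past n)" for n
  have tr_info: "(\<lambda>\<omega>. trunc (g i \<omega>)) \<in> borel_measurable (info B)" if B: "{0} \<times> {..i} \<subseteq> B" "(1, i) \<in> B" for i B
  proof -
    note V = V_info[OF B(2)] and \<Gamma> = \<Gamma>_info[OF B(1)]
    have "pt i \<in> borel_measurable (info B)"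
      unfolding pt_def[abs_def]
      by (intro borel_measurable_times \<Gamma> measurable_compose[OF V m_hat_density_measurable])
    then have "g i \<in> borel_measurable (info B)"
      using measurable_compose[OF measurable_Pair[OF _ V] Gm, of "pt i"] by (simp add: g_def[abs_def])
    then show ?thesis by (rule measurable_compose[OF _ trunc_measurable])
  qed
  have sub1: "subalgebra M (F n)" for n unfolding F_def by (rule subalgebra_info) (auto simp: past_def)
  have sub2: "subalgebra (F j) (F i)" if "i \<le> j" for i j unfolding F_def by (rule info_mono) (use that in \<open>auto simp: past_def\<close>)
  have XF: "X i \<in> borel_measurable (F (Suc i))" for i
  proof -
    have [measurable]: "(\<lambda>\<omega>. trunc (g i \<omega>)) \<in> borel_measurable (F (Suc i))"
      unfolding F_def by (rule tr_info) (auto simp: past_def)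
    have [measurable]: "\<gamma> i \<in> borel_measurable (F (Suc i))"
      unfolding F_def by (rule \<gamma>_info) (simp add: past_def)
    show ?thesis unfolding X_def by measurable
  qed
  have orth: "(\<integral>\<omega>. X j \<omega> * Z \<omega> \<partial>M) = 0" if Z: "Z \<in> borel_measurable (F j)" and bd: "\<And>\<omega>. \<bar>Z \<omega>\<bar> \<le> B" for j Z B
  proof -
    define C where "C = past j \<union> {(0, j), (1, j)}"
    have C: "past j \<subseteq> C" "C \<subseteq> {..<3} \<times> UNIV" "C \<inter> {(2, j)} = {}" by (auto simp: C_def past_def)
    have ZC[measurable]: "Z \<in> borel_measurable (info C)"
      using measurable_from_subalg[OF info_mono[OF C(1)]] Z by (simp add: F_def)
    have [measurable]: "(\<lambda>\<omega>. trunc (g j \<omega>)) \<in> borel_measurable (info C)"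
      by (rule tr_info) (auto simp: C_def past_def)
    have WC: "(\<lambda>\<omega>. trunc (g j \<omega>) * Z \<omega>) \<in> borel_measurable (info C)" by measurable
    have [measurable]: "\<gamma> j \<in> borel_measurable (info {(2, j)})"
      by (rule \<gamma>_info) simp
    have "indep_var borel (\<lambda>\<omega>. sgn (\<gamma> j \<omega>)) borel (\<lambda>\<omega>. trunc (g j \<omega>) * Z \<omega>)"
      by (rule indep_info[OF _ _ _ _ WC, of "{(2, j)}"]) (use C in auto)
    moreover have "integrable M (\<lambda>\<omega>. sgn (\<gamma> j \<omega>))"
      by (rule integrable_const_bound[where B=1]) (auto simp: sgn_if)
    moreover have "integrable M (\<lambda>\<omega>. trunc (g j \<omega>) * Z \<omega>)"
    proof (rule integrable_const_bound[where B="1 * B"])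
      have "\<bar>trunc y\<bar> \<le> 1" for y by (simp add: trunc_def)
      then have "\<bar>trunc (g j \<omega>) * Z \<omega>\<bar> \<le> 1 * B" for \<omega> unfolding abs_mult by (intro mult_mono bd) auto
      then show "AE \<omega> in M. norm (trunc (g j \<omega>) * Z \<omega>) \<le> 1 * B" by simp
      show "(\<lambda>\<omega>. trunc (g j \<omega>) * Z \<omega>) \<in> borel_measurable M"
        by (rule measurable_from_subalg[OF subalgebra_info[OF C(2)] WC])
    qed
    ultimately have "(\<integral>\<omega>. sgn (\<gamma> j \<omega>) * (trunc (g j \<omega>) * Z \<omega>) \<partial>M) = (\<integral>\<omega>. sgn (\<gamma> j \<omega>) \<partial>M) * (\<integral>\<omega>. trunc (g j \<omega>) * Z \<omega> \<partial>M)"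
      by (rule indep_var_lebesgue_integral)
    also have "(\<integral>\<omega>. sgn (\<gamma> j \<omega>) \<partial>M) = 0" using expectation_\<gamma>[of sgn j] by simp
    finally show ?thesis by (simp add: X_def mult.assoc)
  qed
  have sumX: "AE \<omega> in M. summable (\<lambda>i. X i \<omega>)"
    by (rule AE_summable_martingale_differences(1)[where F=F, OF sub1 sub2 XF X1 orth sX])
  have X2: "(\<integral>\<^sup>+\<omega>. ennreal ((\<Sum>i. X i \<omega>)\<^sup>2) \<partial>M) \<le> ennreal (\<Sum>i. \<integral>\<omega>. (X i \<omega>)\<^sup>2 \<partial>M)"
    by (rule AE_summable_martingale_differences(2)[where F=F, OF sub1 sub2 XF X1 orth sX])
  have BC: "AE \<omega> in M. \<forall>\<^sub>F i in sequentially. \<omega> \<in> space M - A i"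
    using sA by (intro borel_cantelli_AE1) (auto simp: emeasure_eq_measure)
  have signs: "AE \<omega> in M. \<forall>i. \<gamma> i \<omega> = 1 \<or> \<gamma> i \<omega> = - 1"
    by (subst AE_all_countable) (simp add: \<gamma>_sign)
  have eqX: "\<gamma> i \<omega> * g i \<omega> = X i \<omega>" if "\<gamma> i \<omega> = 1 \<or> \<gamma> i \<omega> = - 1" "\<omega> \<in> space M - A i" for i \<omega>
    using that by (auto simp: X_def trunc_def A_def)
  show "AE \<omega> in M. summable (\<lambda>i. \<gamma> i \<omega> * G (pt i \<omega>) (V i \<omega>))"
    unfolding g_def[symmetric]
    using sumX BC signs
  proof eventually_elim
    case (elim \<omega>)
    have "\<forall>\<^sub>F i in sequentially. \<gamma> i \<omega> * g i \<omega> = X i \<omega>"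
      using elim(2) by eventually_elim (use eqX elim(3) in auto)
    then show ?case using elim(1) by (simp add: summable_cong)
  qed
  have "(\<integral>\<^sup>+\<omega>. ennreal (min 1 ((\<Sum>i. \<gamma> i \<omega> * g i \<omega>)\<^sup>2)) \<partial>M) \<le> (\<integral>\<^sup>+\<omega>. (\<Sum>i. indicator (A i) \<omega>) + ennreal ((\<Sum>i. X i \<omega>)\<^sup>2) \<partial>M)"
  proof (rule nn_integral_mono_AE)
    show "AE \<omega> in M. ennreal (min 1 ((\<Sum>i. \<gamma> i \<omega> * g i \<omega>)\<^sup>2)) \<le> (\<Sum>i. indicator (A i) \<omega>) + ennreal ((\<Sum>i. X i \<omega>)\<^sup>2)"
      using signs AE_space
    proof eventually_elim
      case (elim \<omega>)
      show ?case
      proof (cases "\<exists>i. \<omega> \<in> A i")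
        case True
        then obtain i where "\<omega> \<in> A i" by auto
        then have "(1::ennreal) = (\<Sum>j\<in>{i}. indicator (A j) \<omega>)" by simp
        also have "\<dots> \<le> (\<Sum>j. indicator (A j) \<omega>)" by (rule sum_le_suminf) auto
        finally have "1 \<le> (\<Sum>j. indicator (A j) \<omega> :: ennreal)" .
        moreover have "ennreal (min 1 ((\<Sum>i. \<gamma> i \<omega> * g i \<omega>)\<^sup>2)) \<le> 1"
          using ennreal_leI[of "min 1 ((\<Sum>i. \<gamma> i \<omega> * g i \<omega>)\<^sup>2)" 1] by simp
        ultimately show ?thesis by (meson add_increasing2 order_trans zero_le)
      next
        case False
        then have "(\<lambda>i. \<gamma> i \<omega> * g i \<omega>) = (\<lambda>i. X i \<omega>)" using eqX elim by auto
        then show ?thesis by (auto intro!: add_increasing ennreal_leI)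
      qed
    qed
  qed
  also have "\<dots> = (\<integral>\<^sup>+\<omega>. (\<Sum>i. indicator (A i) \<omega>) \<partial>M) + (\<integral>\<^sup>+\<omega>. ennreal ((\<Sum>i. X i \<omega>)\<^sup>2) \<partial>M)"
    by (rule nn_integral_add) auto
  also have "(\<integral>\<^sup>+\<omega>. (\<Sum>i. indicator (A i) \<omega>) \<partial>M) = (\<Sum>i. ennreal (prob (A i)))"
    by (subst nn_integral_suminf) (auto simp: emeasure_eq_measure)
  also have "(\<Sum>i. ennreal (prob (A i))) + (\<integral>\<^sup>+\<omega>. ennreal ((\<Sum>i. X i \<omega>)\<^sup>2) \<partial>M) \<le> (\<Sum>i. ennreal (prob (A i))) + (\<Sum>i. ennreal (\<integral>\<omega>. (X i \<omega>)\<^sup>2 \<partial>M))"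
  proof (rule add_left_mono)
    have "(\<Sum>i. ennreal (\<integral>\<omega>. (X i \<omega>)\<^sup>2 \<partial>M)) = ennreal (\<Sum>i. \<integral>\<omega>. (X i \<omega>)\<^sup>2 \<partial>M)"
      by (rule suminf_ennreal2[OF _ sX]) simp
    then show "(\<integral>\<^sup>+\<omega>. ennreal ((\<Sum>i. X i \<omega>)\<^sup>2) \<partial>M) \<le> (\<Sum>i. ennreal (\<integral>\<omega>. (X i \<omega>)\<^sup>2 \<partial>M))"
      using X2 by (simp only:)
  qed
  also have "\<dots> \<le> mass G" by (rule tot)
  finally show "(\<integral>\<^sup>+\<omega>. ennreal (min 1 ((\<Sum>i. \<gamma> i \<omega> * G (pt i \<omega>) (V i \<omega>))\<^sup>2)) \<partial>M) \<le> mass G"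
    by (simp add: g_def)
qed

end

section \<open>The characteristic function of a LePage series\<close>

text \<open>
  The law of the series \<open>\<Sum>\<^sub>i \<gamma>\<^sub>i f(V\<^sub>i) v\<^sub>i\<^bsup>-1/a\<^esup>\<close> is found by a martingale. Given an arrival at time
  \<open>s\<close>, the conditional characteristic function of its term is \<open>1 - q s\<close>, so the part of the series
  after time \<open>s\<close> should have characteristic function \<open>tail s = exp (- \<integral>\<^bsub>(s,\<infinity>)\<^esub> q)\<close>. Then
  \<open>exp (i (partial n)) * tail (arrival n)\<close> has constant expectation: this needs only the integral
  equation \<open>tail_equation\<close>, which is the fundamental theorem of calculus. For \<open>n = 0\<close> the
  expectation is \<open>tail 0\<close>, the claimed value; as \<open>n \<rightarrow> \<infinity>\<close> the factor \<open>tail (arrival n)\<close> tends to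
  \<open>1\<close> and the characteristic function of the series remains.
\<close>

locale lepage_integrand = lepage_variables +
  fixes a :: real and f :: "real \<Rightarrow> real"
  assumes a: "1 < a" "a < 2" and f: "f \<in> L_space a"
begin

lemma f_measurable[measurable]: "f \<in> borel_measurable borel"
  using f by (simp add: L_space_def)

definition f_norm :: real where "f_norm = (\<integral>x. \<bar>f x\<bar> powr a \<partial>lborel)"

lemma nn_integral_f: "(\<integral>\<^sup>+x. ennreal (\<bar>f x\<bar> powr a) \<partial>lborel) = ennreal f_norm"
  unfolding f_norm_def using f by (intro nn_integral_eq_integral) (auto simp: L_space_def)

lemma f_norm_nonneg: "0 \<le> f_norm"
  by (simp add: f_norm_def)

lemma mass_stable: "mass (\<lambda>v x. f x * v powr (- 1 / a)) < \<infinity>"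
proof -
  have "mass (\<lambda>v x. f x * v powr (- 1 / a)) \<le> (\<integral>\<^sup>+x. ennreal (2 / (2 - a)) * ennreal (\<bar>f x\<bar> powr a) \<partial>lborel)"
    unfolding mass_def by (intro nn_integral_mono nn_integral_min_square_powr) (use a in auto)
  also have "\<dots> = ennreal (2 / (2 - a)) * ennreal f_norm"
    by (subst nn_integral_cmult) (auto simp: nn_integral_f)
  also have "\<dots> < \<infinity>" by (simp add: ennreal_mult_less_top)
  finally show ?thesis .
qed

lemma summable_stable: "AE \<omega> in M. summable (\<lambda>i. \<gamma> i \<omega> * (f (V i \<omega>) * pt i \<omega> powr (- 1 / a)))"
  by (rule random_series_summable[OF _ mass_stable]) measurable

text \<open>
  The term of the series contributed by an arrival at time \<open>s\<close> and position \<open>x\<close>, without its sign.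
\<close>

definition phase :: "real \<Rightarrow> real \<Rightarrow> real" where
  "phase s x = f x * (s * m_hat_density x) powr (- 1 / a)"

lemma phase_measurable[measurable]:
  assumes [measurable]: "g \<in> borel_measurable N" "h \<in> borel_measurable N"
  shows "(\<lambda>z. phase (g z) (h z)) \<in> borel_measurable N"
  unfolding phase_def by measurable

lemma phase_\<Gamma>: "phase (\<Gamma> i \<omega>) (V i \<omega>) = f (V i \<omega>) * pt i \<omega> powr (- 1 / a)"
  by (simp add: phase_def pt_def)

lemma abs_one_minus_cos_le: "\<bar>1 - cos x\<bar> \<le> (2 :: real)"
  using cos_ge_minus_one[of x] cos_le_one[of x] by (simp add: abs_le_iff)

definition q :: "real \<Rightarrow> real" where
  "q s = (\<integral>\<omega>. 1 - cos (phase s (V 0 \<omega>)) \<partial>M)"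

lemma q_integrable: "integrable M (\<lambda>\<omega>. 1 - cos (phase s (V 0 \<omega>)))"
  by (rule integrable_const_bound[where B=2]) (simp_all add: abs_one_minus_cos_le)

lemma q_bounds: "0 \<le> q s" "q s \<le> 2"
proof -
  show "0 \<le> q s" unfolding q_def by (rule integral_nonneg_AE) simp
  have "q s \<le> (\<integral>\<omega>. 2 \<partial>M)" unfolding q_def
    by (rule integral_mono[OF q_integrable]) (simp_all add: order_trans[OF abs_ge_self abs_one_minus_cos_le])
  then show "q s \<le> 2" by (simp add: prob_space)
qed

lemma q_measurable[measurable]: "q \<in> borel_measurable borel"
  unfolding q_def[abs_def] by measurable

lemma q_isCont:
  assumes s: "0 < s"
  shows "isCont q s"
  unfolding continuous_at_sequentially
proof (intro allI impI)
  fix X :: "nat \<Rightarrow> real" assume X: "X \<longlonglongrightarrow> s"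
  show "(q \<circ> X) \<longlonglongrightarrow> q s"
    unfolding q_def[abs_def] comp_def
  proof (rule integral_dominated_convergence[where w="\<lambda>_. 2"])
    have "s * m_hat_density x \<noteq> 0" for x using s m_hat_density_pos[of x] by simp
    then show "AE \<omega> in M. (\<lambda>i. 1 - cos (phase (X i) (V 0 \<omega>))) \<longlonglongrightarrow> 1 - cos (phase s (V 0 \<omega>))"
      unfolding phase_def by (intro AE_I2 tendsto_intros X disjI1)
    show "AE \<omega> in M. norm (1 - cos (phase (X i) (V 0 \<omega>))) \<le> 2" for i
      by (simp add: abs_one_minus_cos_le)
  qed simp_all
qed

text \<open>
  Tonelli, then the scaling by \<open>m_hat_density\<close> that yields Lebesgue intensity, and for each \<open>x\<close> the
  scaling of \<open>1 - cos (f x * v\<^bsup>-1/a\<^esup>)\<close>.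
\<close>

lemma nn_integral_q: "(\<integral>\<^sup>+s. ennreal (q s) * indicator {0<..} s \<partial>lborel) = ennreal (kappa a * f_norm)"
proof -
  define \<phi> where "\<phi> = (\<lambda>(v, x). ennreal (1 - cos (f x * v powr (- 1 / a))))"
  have [measurable]: "\<phi> \<in> borel_measurable (borel \<Otimes>\<^sub>M borel)" unfolding \<phi>_def by measurable
  have "(\<integral>\<^sup>+s. ennreal (q s) * indicator {0<..} s \<partial>lborel)
    = (\<integral>\<^sup>+s. (\<integral>\<^sup>+x. \<phi> (s * m_hat_density x, x) * indicator {0<..} s * ennreal (m_hat_density x) \<partial>lborel) \<partial>lborel)"
  proof (rule nn_integral_cong)
    fix s :: real
    have "ennreal (q s) = (\<integral>\<^sup>+\<omega>. \<phi> (s * m_hat_density (V 0 \<omega>), V 0 \<omega>) \<partial>M)"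
      unfolding q_def \<phi>_def prod.case phase_def[symmetric] by (rule nn_integral_eq_integral[OF q_integrable, symmetric]) simp
    also have "\<dots> = (\<integral>\<^sup>+x. ennreal (m_hat_density x) * \<phi> (s * m_hat_density x, x) \<partial>lborel)"
      by (rule nn_integral_V) measurable
    finally have "ennreal (q s) * indicator {0<..} s = (\<integral>\<^sup>+x. ennreal (m_hat_density x) * \<phi> (s * m_hat_density x, x) * indicator {0<..} s \<partial>lborel)"
      by (simp add: nn_integral_multc)
    then show "ennreal (q s) * indicator {0<..} s = (\<integral>\<^sup>+x. \<phi> (s * m_hat_density x, x) * indicator {0<..} s * ennreal (m_hat_density x) \<partial>lborel)"
      by (simp only: mult.commute mult.left_commute)
  qed
  also have "\<dots> = (\<integral>\<^sup>+x. (\<integral>\<^sup>+s. \<phi> (s * m_hat_density x, x) * indicator {0<..} s * ennreal (m_hat_density x) \<partial>lborel) \<partial>lborel)"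
    by (rule lborel_pair.Fubini') measurable
  also have "\<dots> = (\<integral>\<^sup>+x. (\<integral>\<^sup>+s. \<phi> (s * m_hat_density x, x) * indicator {0<..} s \<partial>lborel) * ennreal (m_hat_density x) \<partial>lborel)"
    by (intro nn_integral_cong nn_integral_multc) measurable
  also have "\<dots> = (\<integral>\<^sup>+x. \<integral>\<^sup>+v. \<phi> (v, x) * indicator {0<..} v \<partial>lborel \<partial>lborel)"
    by (intro nn_integral_cong nn_integral_m_hat_scale) measurable
  also have "\<dots> = (\<integral>\<^sup>+x. ennreal (\<bar>f x\<bar> powr a) * ennreal (kappa a) \<partial>lborel)"
  proof (rule nn_integral_cong)
    fix x
    have "(\<integral>\<^sup>+v. \<phi> (v, x) * indicator {0<..} v \<partial>lborel) = ennreal (\<bar>f x\<bar> powr a) * (\<integral>\<^sup>+v. ennreal (1 - cos (v powr (- 1 / a))) * indicator {0<..} v \<partial>lborel)"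
      unfolding \<phi>_def prod.case using a by (intro nn_integral_powr_scale[where h="\<lambda>y. ennreal (1 - cos y)"]) auto
    then show "(\<integral>\<^sup>+v. \<phi> (v, x) * indicator {0<..} v \<partial>lborel) = ennreal (\<bar>f x\<bar> powr a) * ennreal (kappa a)"
      by (simp only: nn_integral_cos_kappa[OF a])
  qed
  also have "\<dots> = ennreal f_norm * ennreal (kappa a)"
    by (subst nn_integral_multc) (auto simp: nn_integral_f)
  also have "\<dots> = ennreal (kappa a * f_norm)"
    using kappa_pos[OF a] f_norm_nonneg by (simp add: ennreal_mult mult.commute)
  finally show ?thesis .
qed

text \<open>
  \<open>q\<close> cut off at \<open>0\<close>, so that integrals over half-lines become integrals over all of \<open>\<real>\<close>.
\<close>

definition q' :: "real \<Rightarrow> real" where "q' s = (if 0 < s then q s else 0)"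

lemma q'_measurable[measurable]: "q' \<in> borel_measurable borel"
  unfolding q'_def[abs_def] by measurable

lemma q'_nonneg: "0 \<le> q' s" using q_bounds by (simp add: q'_def)

lemma q'_integral: "integrable lborel q'" "(\<integral>s. q' s \<partial>lborel) = kappa a * f_norm"
proof -
  have "(\<integral>\<^sup>+s. ennreal (q' s) \<partial>lborel) = (\<integral>\<^sup>+s. ennreal (q s) * indicator {0<..} s \<partial>lborel)"
    by (intro nn_integral_cong) (auto simp: q'_def)
  then have *: "(\<integral>\<^sup>+s. ennreal (q' s) \<partial>lborel) = ennreal (kappa a * f_norm)" by (simp add: nn_integral_q)
  show "integrable lborel q'" by (rule integrableI_nonneg) (auto simp: * q'_nonneg)
  show "(\<integral>s. q' s \<partial>lborel) = kappa a * f_norm"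
    by (rule integral_eq_nn_integral[THEN trans]) (use kappa_pos[OF a] f_norm_nonneg in \<open>auto simp: * q'_nonneg\<close>)
qed

definition J :: "real \<Rightarrow> real" where
  "J s = (\<integral>x. (if x \<le> s then q' x else 0) \<partial>lborel)"

definition tail :: "real \<Rightarrow> real" where
  "tail s = exp (J s - kappa a * f_norm)"

lemma J_measurable[measurable]: "J \<in> borel_measurable borel"
  unfolding J_def[abs_def] by measurable

lemma J_integrable: "integrable lborel (\<lambda>x. if x \<le> s then q' x else 0)"
  by (rule Bochner_Integration.integrable_bound[OF q'_integral(1)]) (auto simp: q'_nonneg)

lemma J_le: "J s \<le> kappa a * f_norm"
  unfolding J_def q'_integral(2)[symmetric] by (rule integral_mono[OF J_integrable q'_integral(1)]) (simp add: q'_nonneg)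

lemma J_0: "J 0 = 0"
proof -
  have "(\<lambda>x. if x \<le> 0 then q' x else 0) = (\<lambda>x. 0)" by (auto simp: q'_def)
  then show ?thesis by (simp add: J_def)
qed

lemma J_at_top: "(J \<longlongrightarrow> kappa a * f_norm) at_top"
proof -
  have "((\<lambda>y. \<integral>x. indicator {..y} x *\<^sub>R q' x \<partial>lborel) \<longlongrightarrow> (\<integral>x. q' x \<partial>lborel)) at_top"
    by (rule tendsto_integral_at_top) (auto intro: q'_integral)
  also have "(\<lambda>y. \<integral>x. indicator {..y} x *\<^sub>R q' x \<partial>lborel) = J"
    unfolding J_def[abs_def] by (intro ext Bochner_Integration.integral_cong) auto
  finally show ?thesis by (simp add: q'_integral)
qed

lemma q'_integrable_on: "q' integrable_on {0..b}"
  by (rule integrable_on_subinterval[OF integrable_on_lborel[OF q'_integral(1)]]) simp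

lemma J_eq_integral: "J s = integral {0..s} q'"
proof -
  have "set_integrable lborel {0..s} q'"
    unfolding set_integrable_def by (rule integrable_mult_indicator) (auto intro: q'_integral)
  then have "integral {0..s} q' = (LINT x:{0..s}|lborel. q' x)" by (rule set_borel_integral_eq_integral(2)[symmetric])
  also have "\<dots> = J s"
    unfolding J_def set_lebesgue_integral_def by (intro Bochner_Integration.integral_cong) (auto simp: q'_def indicator_def)
  finally show ?thesis by simp
qed

lemma q'_isCont: "0 < s \<Longrightarrow> isCont q' s"
proof -
  assume s: "0 < s"
  have "\<forall>\<^sub>F x in nhds s. x \<in> {0<..}" using s by (intro eventually_nhds_in_open) auto
  then have "\<forall>\<^sub>F x in nhds s. q' x = q x" by eventually_elim (simp add: q'_def)
  then show ?thesis using q_isCont[OF s] by (simp add: isCont_cong)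
qed

lemma J_deriv: "0 < s \<Longrightarrow> (J has_real_derivative q' s) (at s)"
proof -
  assume s: "0 < s"
  have "((\<lambda>u. integral {0..u} q') has_vector_derivative q' s) (at s within ({0..s+1} - {}))"
    by (rule integral_has_vector_derivative_continuous_at[OF q'_integrable_on])
      (use s q'_isCont[OF s] in \<open>auto intro: continuous_at_imp_continuous_at_within\<close>)
  then have "(J has_vector_derivative q' s) (at s within {0..s+1})"
    by (simp add: J_eq_integral[abs_def])
  then show ?thesis
    using s by (simp add: at_within_Icc_at has_real_derivative_iff_has_vector_derivative)
qed

lemma J_right: "0 \<le> t \<Longrightarrow> (J \<longlongrightarrow> J t) (at_right t)"
proof -
  assume t: "0 \<le> t"
  have "continuous_on {0..t+1} J"
    using indefinite_integral_continuous_1[OF q'_integrable_on, of "t+1"] by (simp add: J_eq_integral[abs_def])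
  then have "(J \<longlongrightarrow> J t) (at t within {0..t+1})" using t by (simp add: continuous_on_def)
  then have "(J \<longlongrightarrow> J t) (at t within {t..t+1})" by (rule tendsto_within_subset) (use t in auto)
  then show ?thesis by (simp add: at_within_Icc_at_right)
qed

lemma tail_measurable[measurable]: "tail \<in> borel_measurable borel"
  unfolding tail_def[abs_def] by measurable

lemma tail_bounds: "0 < tail s" "tail s \<le> 1"
  using J_le[of s] by (simp_all add: tail_def)

lemma abs_one_minus_q'_le: "\<bar>1 - q' s\<bar> \<le> 1"
  using q_bounds[of s] by (simp add: q'_def abs_le_iff)

text \<open>
  The integrand is the derivative of \<open>- exp (- s) * tail (t + s)\<close>, because \<open>tail' = q' * tail\<close> on the
  positive half-line. At \<open>t = 0\<close> the function \<open>q'\<close> may jump, which is why the fundamental theorem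
  is used on the open half-line.
\<close>

lemma tail_equation:
  assumes t: "0 \<le> t"
  shows "(LINT s:{0<..}|lborel. exp (- s) * ((1 - q' (t + s)) * tail (t + s))) = tail t"
proof -
  let ?f = "\<lambda>s. exp (- s) * ((1 - q' (t + s)) * tail (t + s))"
  let ?F = "\<lambda>s. - exp (- s) * tail (t + s)"
  have e0: "einterval 0 \<infinity> = {0<..}" by (auto simp: einterval_def)
  have bd: "norm (indicator {0<..} s *\<^sub>R ?f s) \<le> norm (exponential_density 1 s)" for s
  proof (cases "0 < s")
    case True
    have "\<bar>(1 - q' (t + s)) * tail (t + s)\<bar> \<le> 1 * 1"
      unfolding abs_mult using tail_bounds[of "t + s"] by (intro mult_mono abs_one_minus_q'_le) auto
    then have "exp (- s) * \<bar>(1 - q' (t + s)) * tail (t + s)\<bar> \<le> exp (- s) * 1" by (intro mult_left_mono) auto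
    then show ?thesis using True by (simp add: abs_mult exponential_density_def)
  qed simp
  have "integrable lborel (exponential_density 1)"
    using nn_integral_erlang_ith_moment[of 1 0 0] by (intro integrableI_nonneg) auto
  then have int: "set_integrable lborel {0<..} ?f"
    unfolding set_integrable_def
  proof (rule Bochner_Integration.integrable_bound)
    show "AE s in lborel. norm (indicator {0<..} s *\<^sub>R ?f s) \<le> norm (exponential_density 1 s)"
      using bd by (intro AE_I2)
  qed measurable
  have "(LBINT s=0..\<infinity>. ?f s) = 0 - (- tail t)"
  proof (rule interval_integral_FTC_integrable)
    fix s :: real assume "0 < ereal s"
    then have s: "0 < s" by simp
    have D: "(J has_real_derivative q' (t + s)) (at (t + s))" using s t by (intro J_deriv) simp
    have D': "((\<lambda>s. J (t + s)) has_real_derivative q' (t + s)) (at s)"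
      using DERIV_shift[of J "q' (t + s)" s t] D by (simp add: add.commute)
    have "(?F has_real_derivative ?f s) (at s)"
      unfolding tail_def by (rule derivative_eq_intros D' refl | simp)+ (simp add: algebra_simps)
    then show "(?F has_vector_derivative ?f s) (at s)" by (simp add: has_real_derivative_iff_has_vector_derivative)
    have "isCont (\<lambda>s. q' (t + s)) s" using s t by (intro isCont_o2[OF _ q'_isCont]) (auto intro!: continuous_intros)
    moreover have "isCont (\<lambda>s. J (t + s)) s" using D' by (rule DERIV_isCont)
    ultimately show "isCont ?f s" unfolding tail_def by (intro continuous_intros)
  next
    show "set_integrable lborel (einterval 0 \<infinity>) ?f" unfolding e0 by (rule int)
    have "((\<lambda>s. J (t + s)) \<longlongrightarrow> J t) (at_right 0)"
      using J_right[OF t] by (subst (asm) filterlim_at_right_to_0) (simp add: add.commute)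
    then have "(?F \<longlongrightarrow> - exp (- 0) * exp (J t - kappa a * f_norm)) (at_right 0)"
      unfolding tail_def by (intro tendsto_intros)
    then show "((?F \<circ> real_of_ereal) \<longlongrightarrow> - tail t) (at_right 0)"
      unfolding zero_ereal_def by (simp add: ereal_tendsto_simps tail_def)
    have "((\<lambda>s. exp (- s)) \<longlongrightarrow> 0) (at_top :: real filter)"
      by (rule filterlim_compose[OF exp_at_bot filterlim_uminus_at_bot_at_top])
    then have "(?F \<longlongrightarrow> 0) at_top"
      by (rule Lim_null_comparison[rotated]) (use tail_bounds in \<open>auto intro!: always_eventually simp: abs_mult less_imp_le mult_left_le\<close>)
    then show "((?F \<circ> real_of_ereal) \<longlongrightarrow> 0) (at_left \<infinity>)" by (simp add: ereal_tendsto_simps)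
  qed simp
  then show ?thesis by (simp add: interval_lebesgue_integral_0_infty)
qed

lemma expectation_V:
  fixes h :: "real \<Rightarrow> real"
  assumes [measurable]: "h \<in> borel_measurable borel"
  shows "(\<integral>\<omega>. h (V i \<omega>) \<partial>M) = (\<integral>\<omega>. h (V 0 \<omega>) \<partial>M)"
proof -
  have "(\<integral>\<omega>. h (V i \<omega>) \<partial>M) = (\<integral>x. h x \<partial>distr M lborel (V i))" for i by (subst integral_distr) auto
  then show ?thesis by (simp add: distributed_distr_eq_density[OF V_distributed])
qed

lemma expectation_sign_average:
  fixes y :: "real \<Rightarrow> real"
  assumes [measurable]: "y \<in> borel_measurable borel"
  shows "(\<integral>\<omega>. iexp (\<gamma> n \<omega> * y (V n \<omega>)) \<partial>M) = complex_of_real (\<integral>\<omega>. cos (y (V 0 \<omega>)) \<partial>M)"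
proof -
  have ind: "indep_var borel (V n) borel (\<gamma> n)"
    by (rule indep_info[of "{(1, n)}" "{(2, n)}"]) (auto intro: V_info \<gamma>_info)
  have "(\<integral>\<omega>. iexp (\<gamma> n \<omega> * y (V n \<omega>)) \<partial>M) = (\<integral>\<omega>. \<integral>\<omega>'. iexp (\<gamma> n \<omega>' * y (V n \<omega>)) \<partial>M \<partial>M)"
  proof -
    define h where "h p = iexp (snd p * y (fst p))" for p
    have [measurable]: "h \<in> borel_measurable (borel \<Otimes>\<^sub>M borel)" unfolding h_def by measurable
    have "(\<integral>\<omega>. h (V n \<omega>, \<gamma> n \<omega>) \<partial>M) = (\<integral>\<omega>. \<integral>\<omega>'. h (V n \<omega>, \<gamma> n \<omega>') \<partial>M \<partial>M)"
      by (rule expectation_indep_pair[OF ind, where B=1]) (simp_all add: h_def)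
    then show ?thesis by (simp only: h_def fst_conv snd_conv)
  qed
  also have "\<dots> = (\<integral>\<omega>. complex_of_real (cos (y (V n \<omega>))) \<partial>M)"
  proof (rule Bochner_Integration.integral_cong[OF refl])
    fix \<omega>
    have "(\<integral>\<omega>'. iexp (\<gamma> n \<omega>' * y (V n \<omega>)) \<partial>M) = (1/2) *\<^sub>R (iexp (1 * y (V n \<omega>)) + iexp (- 1 * y (V n \<omega>)))"
      by (rule expectation_\<gamma>) measurable
    also have "\<dots> = (1/2) *\<^sub>R (cis (y (V n \<omega>)) + cis (- y (V n \<omega>)))" by (simp only: cis_conv_exp mult_1 mult_minus1)
    also have "\<dots> = complex_of_real (cos (y (V n \<omega>)))" by (simp add: complex_eq_iff)
    finally show "(\<integral>\<omega>'. iexp (\<gamma> n \<omega>' * y (V n \<omega>)) \<partial>M) = complex_of_real (cos (y (V n \<omega>)))" .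
  qed
  also have "\<dots> = complex_of_real (\<integral>\<omega>. cos (y (V 0 \<omega>)) \<partial>M)"
    using expectation_V[of "\<lambda>x. cos (y x)" n] by (simp add: integral_complex_of_real)
  finally show ?thesis .
qed

text \<open>
  Average first over the sign, which leaves a cosine, then over the position, which leaves
  \<open>1 - q\<close>, and last over the exponential waiting time, where \<open>tail_equation\<close> applies.
\<close>

lemma tail_step:
  assumes \<tau>: "0 \<le> \<tau>"
  shows "(\<integral>\<omega>. iexp (\<gamma> n \<omega> * phase (\<tau> + gap n \<omega>) (V n \<omega>)) * complex_of_real (tail (\<tau> + gap n \<omega>)) \<partial>M)
    = complex_of_real (tail \<tau>)"
proof -
  define h :: "(real \<times> real) \<times> (real \<times> real) \<Rightarrow> complex" where
    "h p = iexp (snd (snd p) * phase (\<tau> + fst (fst p)) (fst (snd p))) * complex_of_real (tail (\<tau> + fst (fst p)))" for p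
  have [measurable]: "h \<in> borel_measurable ((borel \<Otimes>\<^sub>M borel) \<Otimes>\<^sub>M (borel \<Otimes>\<^sub>M borel))" unfolding h_def by measurable
  have hb: "norm (h p) \<le> 1" for p
    using tail_bounds[of "\<tau> + fst (fst p)"] by (simp add: h_def norm_mult)
  \<comment> \<open>indep_var needs both variables to have the same type, so a zero pads the waiting time to a pair\<close>
  have ind: "indep_var (borel \<Otimes>\<^sub>M borel) (\<lambda>\<omega>. (gap n \<omega>, 0 :: real)) (borel \<Otimes>\<^sub>M borel) (\<lambda>\<omega>. (V n \<omega>, \<gamma> n \<omega>))"
    by (rule indep_info[of "{(0, n)}" "{(1, n), (2, n)}"]) (auto intro!: measurable_Pair gap_info V_info \<gamma>_info)
  have "(\<integral>\<omega>. h ((gap n \<omega>, 0), (V n \<omega>, \<gamma> n \<omega>)) \<partial>M) = (\<integral>\<omega>. \<integral>\<omega>'. h ((gap n \<omega>, 0), (V n \<omega>', \<gamma> n \<omega>')) \<partial>M \<partial>M)"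
    by (rule expectation_indep_pair[OF ind _ hb]) measurable
  also have "\<dots> = (\<integral>\<omega>. complex_of_real ((1 - q (\<tau> + gap n \<omega>)) * tail (\<tau> + gap n \<omega>)) \<partial>M)"
  proof (rule Bochner_Integration.integral_cong[OF refl])
    fix \<omega>
    define s where "s = \<tau> + gap n \<omega>"
    have ic: "integrable M (\<lambda>\<omega>. cos (phase s (V 0 \<omega>)))"
      by (rule integrable_const_bound[where B=1]) auto
    have "(\<integral>\<omega>'. h ((gap n \<omega>, 0), (V n \<omega>', \<gamma> n \<omega>')) \<partial>M)
      = (\<integral>\<omega>'. iexp (\<gamma> n \<omega>' * phase s (V n \<omega>')) \<partial>M) * complex_of_real (tail s)"
      unfolding h_def fst_conv snd_conv s_def[symmetric] by (rule integral_mult_left_zero)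
    also have "(\<integral>\<omega>'. iexp (\<gamma> n \<omega>' * phase s (V n \<omega>')) \<partial>M)
       = complex_of_real (\<integral>\<omega>. cos (phase s (V 0 \<omega>)) \<partial>M)"
      by (rule expectation_sign_average[where y="phase s"]) measurable
    also have "(\<integral>\<omega>. cos (phase s (V 0 \<omega>)) \<partial>M) = 1 - q s"
      unfolding q_def using ic by (simp add: prob_space)
    finally show "(\<integral>\<omega>'. h ((gap n \<omega>, 0), (V n \<omega>', \<gamma> n \<omega>')) \<partial>M) = complex_of_real ((1 - q (\<tau> + gap n \<omega>)) * tail (\<tau> + gap n \<omega>))"
      unfolding s_def[symmetric] by (simp only: of_real_mult)
  qed
  also have "\<dots> = complex_of_real (\<integral>\<omega>. (1 - q (\<tau> + gap n \<omega>)) * tail (\<tau> + gap n \<omega>) \<partial>M)"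
    by (rule integral_complex_of_real)
  also have "(\<integral>\<omega>. (1 - q (\<tau> + gap n \<omega>)) * tail (\<tau> + gap n \<omega>) \<partial>M) = (\<integral>s. exponential_density 1 s * ((1 - q (\<tau> + s)) * tail (\<tau> + s)) \<partial>lborel)"
    by (rule distributed_integral[OF gap_distributed, symmetric]) auto
  also have "\<dots> = (\<integral>s. indicator {0<..} s *\<^sub>R (exp (- s) * ((1 - q' (\<tau> + s)) * tail (\<tau> + s))) \<partial>lborel)"
  proof (rule integral_cong_AE)
    have "AE s in lborel. s \<noteq> (0::real)" by (rule AE_lborel_singleton)
    then show "AE s in lborel. exponential_density 1 s * ((1 - q (\<tau> + s)) * tail (\<tau> + s)) = indicator {0<..} s *\<^sub>R (exp (- s) * ((1 - q' (\<tau> + s)) * tail (\<tau> + s)))"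
      by eventually_elim (use \<tau> in \<open>auto simp: exponential_density_def q'_def indicator_def\<close>)
  qed measurable
  also have "\<dots> = tail \<tau>" using tail_equation[OF \<tau>] by (simp add: set_lebesgue_integral_def)
  finally show ?thesis unfolding h_def fst_conv snd_conv .
qed

definition partial :: "nat \<Rightarrow> 'a \<Rightarrow> real" where
  "partial n \<omega> = (\<Sum>i<n. \<gamma> i \<omega> * phase (\<Gamma> i \<omega>) (V i \<omega>))"

lemma partial_info: "partial n \<in> borel_measurable (info (past n))"
  unfolding partial_def[abs_def]
proof (rule borel_measurable_sum)
  fix i assume "i \<in> {..<n}"
  then have [measurable]: "\<Gamma> i \<in> borel_measurable (info (past n))" "V i \<in> borel_measurable (info (past n))" "\<gamma> i \<in> borel_measurable (info (past n))"
    by (auto intro!: \<Gamma>_info V_info \<gamma>_info simp: past_def)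
  show "(\<lambda>\<omega>. \<gamma> i \<omega> * phase (\<Gamma> i \<omega>) (V i \<omega>)) \<in> borel_measurable (info (past n))" by measurable
qed

lemma partial_measurable[measurable]: "partial n \<in> borel_measurable M"
  unfolding partial_def[abs_def] by measurable

lemma martingale_step:
  "(\<integral>\<omega>. iexp (partial (Suc n) \<omega>) * complex_of_real (tail (arrival (Suc n) \<omega>)) \<partial>M)
   = (\<integral>\<omega>. iexp (partial n \<omega>) * complex_of_real (tail (arrival n \<omega>)) \<partial>M)"
proof -
  define h :: "(real \<times> real \<times> real) \<times> (real \<times> real \<times> real) \<Rightarrow> complex" where
    "h p = iexp (fst (fst p)) *
       (iexp (snd (snd (snd p)) * phase (fst (snd (fst p)) + fst (snd p)) (fst (snd (snd p))))
        * complex_of_real (tail (fst (snd (fst p)) + fst (snd p))))" for p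
  have [measurable]: "h \<in> borel_measurable ((borel \<Otimes>\<^sub>M (borel \<Otimes>\<^sub>M borel)) \<Otimes>\<^sub>M (borel \<Otimes>\<^sub>M (borel \<Otimes>\<^sub>M borel)))" unfolding h_def by measurable
  have hb: "norm (h p) \<le> 1" for p
    using tail_bounds[of "fst (snd (fst p)) + fst (snd p)"] by (simp add: h_def norm_mult)
  \<comment> \<open>again a zero as padding, to a triple\<close>
  have ind: "indep_var (borel \<Otimes>\<^sub>M (borel \<Otimes>\<^sub>M borel)) (\<lambda>\<omega>. (partial n \<omega>, arrival n \<omega>, 0 :: real))
     (borel \<Otimes>\<^sub>M (borel \<Otimes>\<^sub>M borel)) (\<lambda>\<omega>. (gap n \<omega>, V n \<omega>, \<gamma> n \<omega>))"
    by (rule indep_info[of "past n" "{(0, n), (1, n), (2, n)}"])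
      (auto intro!: measurable_Pair partial_info[unfolded past_def] arrival_info gap_info V_info \<gamma>_info simp: past_def)
  have "(\<integral>\<omega>. iexp (partial (Suc n) \<omega>) * complex_of_real (tail (arrival (Suc n) \<omega>)) \<partial>M)
     = (\<integral>\<omega>. h ((partial n \<omega>, arrival n \<omega>, 0), (gap n \<omega>, V n \<omega>, \<gamma> n \<omega>)) \<partial>M)"
  proof (rule Bochner_Integration.integral_cong[OF refl])
    fix \<omega>
    have A: "arrival (Suc n) \<omega> = arrival n \<omega> + gap n \<omega>" by (simp add: arrival_def)
    have "phase (\<Gamma> n \<omega>) (V n \<omega>) = phase (arrival n \<omega> + gap n \<omega>) (V n \<omega>)"
      by (subst \<Gamma>_eq_arrival) (simp only: A)
    then have "partial (Suc n) \<omega> = partial n \<omega> + \<gamma> n \<omega> * phase (arrival n \<omega> + gap n \<omega>) (V n \<omega>)"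
      by (simp add: partial_def)
    then show "iexp (partial (Suc n) \<omega>) * complex_of_real (tail (arrival (Suc n) \<omega>)) = h ((partial n \<omega>, arrival n \<omega>, 0), (gap n \<omega>, V n \<omega>, \<gamma> n \<omega>))"
      by (simp only: h_def fst_conv snd_conv A of_real_add distrib_left exp_add mult.assoc)
  qed
  also have "\<dots> = (\<integral>\<omega>. \<integral>\<omega>'. h ((partial n \<omega>, arrival n \<omega>, 0), (gap n \<omega>', V n \<omega>', \<gamma> n \<omega>')) \<partial>M \<partial>M)"
    by (rule expectation_indep_pair[OF ind _ hb]) measurable
  also have "\<dots> = (\<integral>\<omega>. iexp (partial n \<omega>) * complex_of_real (tail (arrival n \<omega>)) \<partial>M)"
  proof (rule integral_cong_AE)
    show "AE \<omega> in M. (\<integral>\<omega>'. h ((partial n \<omega>, arrival n \<omega>, 0), (gap n \<omega>', V n \<omega>', \<gamma> n \<omega>')) \<partial>M) = iexp (partial n \<omega>) * complex_of_real (tail (arrival n \<omega>))"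
      using arrival_nonneg[of n]
    proof eventually_elim
      case (elim \<omega>)
      show ?case unfolding h_def fst_conv snd_conv by (simp only: integral_mult_right_zero tail_step[OF elim])
    qed
  qed measurable
  finally show ?thesis .
qed

theorem char_random_series:
  "(\<integral>\<omega>. iexp (\<Sum>i. \<gamma> i \<omega> * (f (V i \<omega>) * pt i \<omega> powr (- 1 / a))) \<partial>M) = complex_of_real (exp (- (kappa a * f_norm)))"
proof -
  have E: "(\<integral>\<omega>. iexp (partial n \<omega>) * complex_of_real (tail (arrival n \<omega>)) \<partial>M) = complex_of_real (exp (- (kappa a * f_norm)))" for n
  proof (induction n)
    case 0
    then show ?case by (simp add: partial_def arrival_def tail_def J_0 prob_space)
  next
    case (Suc n)
    then show ?case by (simp only: martingale_step)
  qed
  have "(\<lambda>n. \<integral>\<omega>. iexp (partial n \<omega>) * complex_of_real (tail (arrival n \<omega>)) \<partial>M)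
      \<longlonglongrightarrow> (\<integral>\<omega>. iexp (\<Sum>i. \<gamma> i \<omega> * (f (V i \<omega>) * pt i \<omega> powr (- 1 / a))) * complex_of_real 1 \<partial>M)"
  proof (rule integral_dominated_convergence[where w="\<lambda>_. 1"])
    show "AE \<omega> in M. (\<lambda>n. iexp (partial n \<omega>) * complex_of_real (tail (arrival n \<omega>)))
      \<longlonglongrightarrow> iexp (\<Sum>i. \<gamma> i \<omega> * (f (V i \<omega>) * pt i \<omega> powr (- 1 / a))) * complex_of_real 1"
      using summable_stable arrival_at_top
    proof eventually_elim
      case (elim \<omega>)
      have "(\<lambda>n. partial n \<omega>) \<longlonglongrightarrow> (\<Sum>i. \<gamma> i \<omega> * (f (V i \<omega>) * pt i \<omega> powr (- 1 / a)))"
        unfolding partial_def phase_\<Gamma> by (rule summable_LIMSEQ[OF elim(1)])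
      moreover have "(\<lambda>n. tail (arrival n \<omega>)) \<longlonglongrightarrow> exp (kappa a * f_norm - kappa a * f_norm)"
        unfolding tail_def by (intro tendsto_intros filterlim_compose[OF J_at_top elim(2)])
      then have "(\<lambda>n. tail (arrival n \<omega>)) \<longlonglongrightarrow> 1" by simp
      ultimately show ?case by (intro tendsto_intros)
    qed
    show "AE \<omega> in M. norm (iexp (partial n \<omega>) * complex_of_real (tail (arrival n \<omega>))) \<le> 1" for n
      using tail_bounds by (intro AE_I2) (auto simp: norm_mult less_imp_le)
  qed measurable
  then have "(\<lambda>n::nat. complex_of_real (exp (- (kappa a * f_norm)))) \<longlonglongrightarrow> (\<integral>\<omega>. iexp (\<Sum>i. \<gamma> i \<omega> * (f (V i \<omega>) * pt i \<omega> powr (- 1 / a))) * complex_of_real 1 \<partial>M)"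
    unfolding E .
  then show ?thesis by (simp add: LIMSEQ_const_iff)
qed

end

section \<open>The LePage stable random measure\<close>

lemma L_space_lincomb:
  assumes f: "f \<in> L_space a" and g: "g \<in> L_space a" and a: "0 < a"
  shows "(\<lambda>x. p * f x + q * g x) \<in> L_space a"
proof -
  have m[measurable]: "f \<in> borel_measurable borel" "g \<in> borel_measurable borel"
    and i: "integrable lborel (\<lambda>x. \<bar>f x\<bar> powr a)" "integrable lborel (\<lambda>x. \<bar>g x\<bar> powr a)"
    using f g by (auto simp: L_space_def)
  have bd: "\<bar>y + z\<bar> powr a \<le> 2 powr a * (\<bar>y\<bar> powr a + \<bar>z\<bar> powr a)" for y z :: real
  proof -
    have "\<bar>y + z\<bar> powr a \<le> (2 * max \<bar>y\<bar> \<bar>z\<bar>) powr a" using a by (intro powr_mono2) auto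
    also have "\<dots> = 2 powr a * (max \<bar>y\<bar> \<bar>z\<bar> powr a)" by (simp add: powr_mult)
    also have "\<dots> \<le> 2 powr a * (\<bar>y\<bar> powr a + \<bar>z\<bar> powr a)" by (intro mult_left_mono) (auto simp: max_def)
    finally show ?thesis .
  qed
  have "integrable lborel (\<lambda>x. 2 powr a * (\<bar>p\<bar> powr a * \<bar>f x\<bar> powr a + \<bar>q\<bar> powr a * \<bar>g x\<bar> powr a))"
    using i by simp
  then have "integrable lborel (\<lambda>x. \<bar>p * f x + q * g x\<bar> powr a)"
  proof (rule Bochner_Integration.integrable_bound)
    show "AE x in lborel. norm (\<bar>p * f x + q * g x\<bar> powr a) \<le> norm (2 powr a * (\<bar>p\<bar> powr a * \<bar>f x\<bar> powr a + \<bar>q\<bar> powr a * \<bar>g x\<bar> powr a))"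
      using bd[of "p * f _" "q * g _"] by (intro AE_I2) (simp add: abs_mult powr_mult)
  qed measurable
  then show ?thesis by (simp add: L_space_def)
qed

lemma L_space_sum:
  assumes a: "0 < a" and f: "\<And>j. j \<in> J \<Longrightarrow> f j \<in> L_space a" and J: "finite J"
  shows "(\<lambda>x. \<Sum>j\<in>J. \<theta> j * f j x) \<in> L_space a"
  using J f
proof (induction J)
  case empty
  then show ?case by (simp add: L_space_def)
next
  case (insert j J)
  then have "(\<lambda>x. \<theta> j * f j x + 1 * (\<Sum>j\<in>J. \<theta> j * f j x)) \<in> L_space a"
    by (intro L_space_lincomb a) auto
  then show ?case using insert.hyps by simp
qed

lemma sas_random_measure_sum:
  assumes S: "sas_random_measure N a I" and a: "0 < a" and J: "finite J" and f: "\<And>j. j \<in> J \<Longrightarrow> f j \<in> L_space a"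
  shows "AE \<omega> in N. I (\<lambda>x. \<Sum>j\<in>J. \<theta> j * f j x) \<omega> = (\<Sum>j\<in>J. \<theta> j * I (f j) \<omega>)"
proof -
  have lin: "\<And>f g p q. f \<in> L_space a \<Longrightarrow> g \<in> L_space a \<Longrightarrow> AE \<omega> in N. I (\<lambda>x. p * f x + q * g x) \<omega> = p * I f \<omega> + q * I g \<omega>"
    using S by (simp add: sas_random_measure_def)
  show ?thesis using J f
  proof (induction J)
    case empty
    have "(\<lambda>x. 0) \<in> L_space a" by (simp add: L_space_def)
    from lin[OF this this, of 0 0] show ?case by simp
  next
    case (insert j J)
    have "AE \<omega> in N. I (\<lambda>x. \<theta> j * f j x + 1 * (\<Sum>j\<in>J. \<theta> j * f j x)) \<omega> = \<theta> j * I (f j) \<omega> + 1 * I (\<lambda>x. \<Sum>j\<in>J. \<theta> j * f j x) \<omega>"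
      using insert by (intro lin L_space_sum a) auto
    moreover have "AE \<omega> in N. I (\<lambda>x. \<Sum>j\<in>J. \<theta> j * f j x) \<omega> = (\<Sum>j\<in>J. \<theta> j * I (f j) \<omega>)"
      using insert by auto
    ultimately show ?case by eventually_elim (use insert.hyps in simp)
  qed
qed

text \<open>
  By linearity a linear combination of integrals is one integral, so a stable random measure
  has its joint laws determined by one-dimensional characteristic functions.
\<close>

lemma sas_random_measure_joint_char:
  assumes S: "sas_random_measure N a I" and a: "0 < a" and J: "finite J" and f: "\<And>j. j \<in> J \<Longrightarrow> f j \<in> L_space a"
  shows "(\<integral>\<omega>. iexp (\<Sum>j\<in>J. \<theta> j * I (f j) \<omega>) \<partial>N) = complex_of_real (exp (- (\<integral>x. \<bar>\<Sum>j\<in>J. \<theta> j * f j x\<bar> powr a \<partial>lborel)))"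
proof -
  let ?F = "\<lambda>x. \<Sum>j\<in>J. \<theta> j * f j x"
  have F: "?F \<in> L_space a" by (rule L_space_sum[OF a f J])
  have m: "\<And>f. f \<in> L_space a \<Longrightarrow> I f \<in> borel_measurable N" using S by (simp add: sas_random_measure_def)
  note [measurable] = m[OF F]
  have [measurable]: "(\<lambda>\<omega>. \<Sum>j\<in>J. \<theta> j * I (f j) \<omega>) \<in> borel_measurable N"
    using m[OF f] by (intro borel_measurable_sum borel_measurable_times) auto
  have "(\<integral>\<omega>. iexp (\<Sum>j\<in>J. \<theta> j * I (f j) \<omega>) \<partial>N) = (\<integral>\<omega>. iexp (1 * I ?F \<omega>) \<partial>N)"
  proof (rule integral_cong_AE)
    have "AE \<omega> in N. I ?F \<omega> = (\<Sum>j\<in>J. \<theta> j * I (f j) \<omega>)" by (rule sas_random_measure_sum[OF S a J f])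
    then show "AE \<omega> in N. iexp (\<Sum>j\<in>J. \<theta> j * I (f j) \<omega>) = iexp (1 * I ?F \<omega>)"
      by eventually_elim (simp only: mult_1)
  qed measurable
  also have "\<dots> = char (distr N borel (I ?F)) 1"
    unfolding char_def by (subst integral_distr) auto
  also have "\<dots> = complex_of_real (exp (- (\<bar>1\<bar> powr a * (\<integral>x. \<bar>?F x\<bar> powr a \<partial>lborel))))"
    using S F unfolding sas_random_measure_def by blast
  finally show ?thesis by simp
qed

definition lepage_integral ::
  "real \<Rightarrow> (nat \<Rightarrow> 'w \<Rightarrow> real) \<Rightarrow> (nat \<Rightarrow> 'w \<Rightarrow> real) \<Rightarrow> (nat \<Rightarrow> 'w \<Rightarrow> real) \<Rightarrow> (real \<Rightarrow> real) \<Rightarrow> 'w \<Rightarrow> real"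
where
  "lepage_integral a \<Gamma> V \<gamma> f \<omega> = stable_const a powr (1 / a) *
     (\<Sum>i. \<gamma> i \<omega> * (f (V i \<omega>) * (\<Gamma> i \<omega> * m_hat_density (V i \<omega>)) powr (- 1 / a)))"

lemma lepage_integral_measurable:
  assumes [measurable]: "\<And>i. \<Gamma> i \<in> borel_measurable M" "\<And>i. V i \<in> borel_measurable M" "\<And>i. \<gamma> i \<in> borel_measurable M"
    and f: "f \<in> borel_measurable borel"
  shows "lepage_integral a \<Gamma> V \<gamma> f \<in> borel_measurable M"
proof -
  note [measurable] = f
  show ?thesis unfolding lepage_integral_def[abs_def] by measurable
qed

lemma stable_const_pos: "1 < a \<Longrightarrow> a < 2 \<Longrightarrow> 0 < stable_const a"
  using kappa_pos by (simp add: stable_const_kappa)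

context lepage_variables
begin

lemma summable_lepage:
  assumes a: "1 < a" "a < 2" and f: "f \<in> L_space a"
  shows "AE \<omega> in M. summable (\<lambda>i. \<gamma> i \<omega> * (f (V i \<omega>) * (\<Gamma> i \<omega> * m_hat_density (V i \<omega>)) powr (- 1 / a)))"
proof -
  interpret lepage_integrand M \<Gamma> V \<gamma> a f by unfold_locales (fact a f)+
  show ?thesis using summable_stable by (simp add: pt_def)
qed

lemma char_lepage_integral:
  assumes a: "1 < a" "a < 2" and f: "f \<in> L_space a"
  shows "(\<integral>\<omega>. iexp (\<theta> * lepage_integral a \<Gamma> V \<gamma> f \<omega>) \<partial>M)
    = complex_of_real (exp (- (\<bar>\<theta>\<bar> powr a * (\<integral>x. \<bar>f x\<bar> powr a \<partial>lborel))))"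
proof -
  define k where "k = \<theta> * stable_const a powr (1 / a)"
  define g where "g x = k * f x" for x
  have g: "g \<in> L_space a" using L_space_lincomb[OF f f, of k 0] a by (simp add: g_def[abs_def])
  interpret G: lepage_integrand M \<Gamma> V \<gamma> a g by unfold_locales (fact a g)+
  have fm: "f \<in> borel_measurable borel" using f by (simp add: L_space_def)
  note [measurable] = lepage_integral_measurable[OF \<Gamma>_measurable V_measurable \<gamma>_measurable fm, of a] G.f_measurable
  have "(\<integral>\<omega>. iexp (\<theta> * lepage_integral a \<Gamma> V \<gamma> f \<omega>) \<partial>M)
     = (\<integral>\<omega>. iexp (\<Sum>i. \<gamma> i \<omega> * (g (V i \<omega>) * pt i \<omega> powr (- 1 / a))) \<partial>M)"
  proof (rule integral_cong_AE)
    show "AE \<omega> in M. iexp (\<theta> * lepage_integral a \<Gamma> V \<gamma> f \<omega>) = iexp (\<Sum>i. \<gamma> i \<omega> * (g (V i \<omega>) * pt i \<omega> powr (- 1 / a)))"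
      using summable_lepage[OF a f]
    proof eventually_elim
      case (elim \<omega>)
      have "\<theta> * lepage_integral a \<Gamma> V \<gamma> f \<omega> = k * (\<Sum>i. \<gamma> i \<omega> * (f (V i \<omega>) * (\<Gamma> i \<omega> * m_hat_density (V i \<omega>)) powr (- 1 / a)))"
        by (simp add: lepage_integral_def k_def)
      also have "\<dots> = (\<Sum>i. k * (\<gamma> i \<omega> * (f (V i \<omega>) * (\<Gamma> i \<omega> * m_hat_density (V i \<omega>)) powr (- 1 / a))))"
        by (rule suminf_mult[OF elim, symmetric])
      also have "\<dots> = (\<Sum>i. \<gamma> i \<omega> * (g (V i \<omega>) * pt i \<omega> powr (- 1 / a)))"
        by (rule suminf_cong) (simp add: g_def pt_def mult.left_commute mult.assoc)
      finally show ?case by (simp only:)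
    qed
  qed measurable
  also have "\<dots> = complex_of_real (exp (- (kappa a * G.f_norm)))" by (rule G.char_random_series)
  also have "kappa a * G.f_norm = \<bar>\<theta>\<bar> powr a * (\<integral>x. \<bar>f x\<bar> powr a \<partial>lborel)"
  proof -
    have "\<bar>k\<bar> powr a = \<bar>\<theta>\<bar> powr a * stable_const a"
      using stable_const_pos[OF a] a by (simp add: k_def abs_mult powr_mult powr_powr)
    then have "\<bar>g x\<bar> powr a = \<bar>\<theta>\<bar> powr a * stable_const a * \<bar>f x\<bar> powr a" for x
      by (simp add: g_def abs_mult powr_mult)
    then have "G.f_norm = \<bar>\<theta>\<bar> powr a * stable_const a * (\<integral>x. \<bar>f x\<bar> powr a \<partial>lborel)"
      by (simp add: G.f_norm_def)
    then show ?thesis using kappa_pos[OF a] by (simp add: stable_const_kappa)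
  qed
  finally show ?thesis .
qed

theorem sas_random_measure_lepage:
  assumes a: "1 < a" "a < 2"
  shows "sas_random_measure M a (lepage_integral a \<Gamma> V \<gamma>)"
  unfolding sas_random_measure_def
proof (intro conjI ballI allI)
  show "prob_space M" by (rule prob_space_axioms)
next
  fix f assume f: "f \<in> L_space a"
  then have fm: "f \<in> borel_measurable borel" by (simp add: L_space_def)
  show m: "lepage_integral a \<Gamma> V \<gamma> f \<in> borel_measurable M"
    by (rule lepage_integral_measurable[OF \<Gamma>_measurable V_measurable \<gamma>_measurable fm])
  fix \<theta>
  show "char (distr M borel (lepage_integral a \<Gamma> V \<gamma> f)) \<theta> = complex_of_real (exp (- (\<bar>\<theta>\<bar> powr a * (\<integral>x. \<bar>f x\<bar> powr a \<partial>lborel))))"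
    unfolding char_def using m char_lepage_integral[OF a f, of \<theta>] by (subst integral_distr) auto
next
  fix f g p q assume f: "f \<in> L_space a" and g: "g \<in> L_space a"
  show "AE \<omega> in M. lepage_integral a \<Gamma> V \<gamma> (\<lambda>x. p * f x + q * g x) \<omega> = p * lepage_integral a \<Gamma> V \<gamma> f \<omega> + q * lepage_integral a \<Gamma> V \<gamma> g \<omega>"
    using summable_lepage[OF a f] summable_lepage[OF a g]
  proof eventually_elim
    case (elim \<omega>)
    let ?t = "\<lambda>f i. \<gamma> i \<omega> * (f (V i \<omega>) * (\<Gamma> i \<omega> * m_hat_density (V i \<omega>)) powr (- 1 / a))"
    have "(\<Sum>i. ?t (\<lambda>x. p * f x + q * g x) i) = (\<Sum>i. p * ?t f i + q * ?t g i)"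
      by (rule suminf_cong) (simp add: algebra_simps)
    also have "\<dots> = (\<Sum>i. p * ?t f i) + (\<Sum>i. q * ?t g i)"
      by (rule suminf_add[symmetric]) (intro summable_mult elim)+
    also have "\<dots> = p * (\<Sum>i. ?t f i) + q * (\<Sum>i. ?t g i)"
      by (simp only: suminf_mult[OF elim(1)] suminf_mult[OF elim(2)])
    finally have "(\<Sum>i. ?t (\<lambda>x. p * f x + q * g x) i) = p * (\<Sum>i. ?t f i) + q * (\<Sum>i. ?t g i)" .
    then show ?case by (simp only: lepage_integral_def distrib_left mult.left_commute)
  qed
qed

end

lemma sas_random_measure_distr:
  assumes \<phi>[measurable]: "\<phi> \<in> measurable M P" and a: "0 < a"
    and S: "sas_random_measure M a (\<lambda>f \<omega>. J f (\<phi> \<omega>))"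
    and Jm: "\<And>f. f \<in> L_space a \<Longrightarrow> J f \<in> borel_measurable P"
  shows "sas_random_measure (distr M P \<phi>) a J"
  unfolding sas_random_measure_def
proof (intro conjI ballI allI)
  interpret prob_space M using S by (simp add: sas_random_measure_def)
  show "prob_space (distr M P \<phi>)" by (rule prob_space_distr) measurable
next
  fix f assume f: "f \<in> L_space a"
  note [measurable] = Jm[OF f]
  show "J f \<in> borel_measurable (distr M P \<phi>)" by simp
  fix \<theta>
  have "distr (distr M P \<phi>) borel (J f) = distr M borel (\<lambda>\<omega>. J f (\<phi> \<omega>))"
    by (subst distr_distr) (auto simp: comp_def)
  then show "char (distr (distr M P \<phi>) borel (J f)) \<theta> = complex_of_real (exp (- (\<bar>\<theta>\<bar> powr a * (\<integral>x. \<bar>f x\<bar> powr a \<partial>lborel))))"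
    using S f by (simp add: sas_random_measure_def)
next
  fix f g p q assume f: "f \<in> L_space a" and g: "g \<in> L_space a"
  note [measurable] = Jm[OF f] Jm[OF g] Jm[OF L_space_lincomb[OF f g a]]
  have "AE \<omega> in M. J (\<lambda>x. p * f x + q * g x) (\<phi> \<omega>) = p * J f (\<phi> \<omega>) + q * J g (\<phi> \<omega>)"
    using S f g unfolding sas_random_measure_def by blast
  then show "AE \<omega> in distr M P \<phi>. J (\<lambda>x. p * f x + q * g x) \<omega> = p * J f \<omega> + q * J g \<omega>"
    by (subst AE_distr_iff) auto
qed

text \<open>
  The random measure on \<open>M\<close> is a function of the three sequences. They are stored in the values of one
  path at the natural numbers, interleaved modulo \<open>3\<close>, so the same function lives on the path space.
\<close>

lemma (in lepage_variables) ex_sas_random_measure: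
  assumes a: "1 < a" "a < 2"
  shows "\<exists>(N :: (real \<Rightarrow> real) measure) I. sas_random_measure N a I"
proof -
  let ?P = "PiM UNIV (\<lambda>_. borel) :: (real \<Rightarrow> real) measure"
  define code where "code \<omega> x = (let n = nat \<lfloor>x\<rfloor> in ([\<Gamma>, V, \<gamma>] ! (n mod 3)) (n div 3) \<omega>)" for \<omega> and x :: real
  define dec where "dec k i p = p (real (3 * i + k))" for k i :: nat and p :: "real \<Rightarrow> real"
  have seq_m: "([\<Gamma>, V, \<gamma>] ! (n mod 3)) i \<in> borel_measurable M" for n i :: nat
  proof -
    have "n mod 3 < 3" by simp
    then have "n mod 3 = 0 \<or> n mod 3 = 1 \<or> n mod 3 = 2" by linarith
    then show ?thesis by (auto simp: numeral_2_eq_2)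
  qed
  have code_m: "code \<in> measurable M ?P"
  proof (rule measurable_PiM_single')
    fix x :: real
    show "(\<lambda>\<omega>. code \<omega> x) \<in> borel_measurable M" unfolding code_def Let_def by (rule seq_m)
  qed (auto simp: space_PiM)
  have dec_m: "dec k i \<in> borel_measurable ?P" for k i unfolding dec_def by measurable
  have dec_code: "dec 0 i (code \<omega>) = \<Gamma> i \<omega>" "dec 1 i (code \<omega>) = V i \<omega>" "dec 2 i (code \<omega>) = \<gamma> i \<omega>" for i \<omega>
  proof -
    have "nat \<lfloor>real (3 * i + k)\<rfloor> = 3 * i + k" for k by (simp only: floor_of_nat nat_int)
    then have *: "dec k i (code \<omega>) = ([\<Gamma>, V, \<gamma>] ! ((3 * i + k) mod 3)) ((3 * i + k) div 3) \<omega>" for k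
      by (simp only: dec_def code_def Let_def)
    show "dec 0 i (code \<omega>) = \<Gamma> i \<omega>" "dec 1 i (code \<omega>) = V i \<omega>" "dec 2 i (code \<omega>) = \<gamma> i \<omega>"
    proof -
      have "(3 * i + 0) mod 3 = 0" "(3 * i + 0) div 3 = i" "(3 * i + 1) mod 3 = 1" "(3 * i + 1) div 3 = i"
        "(3 * i + 2) mod 3 = 2" "(3 * i + 2) div 3 = i" by presburger+
      then show "dec 0 i (code \<omega>) = \<Gamma> i \<omega>" "dec 1 i (code \<omega>) = V i \<omega>" "dec 2 i (code \<omega>) = \<gamma> i \<omega>"
        unfolding * by (simp_all only:) (simp_all add: numeral_2_eq_2)
    qed
  qed
  have "sas_random_measure (distr M ?P code) a (lepage_integral a (dec 0) (dec 1) (dec 2))"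
  proof (rule sas_random_measure_distr[OF code_m])
    have "(\<lambda>f \<omega>. lepage_integral a (dec 0) (dec 1) (dec 2) f (code \<omega>)) = lepage_integral a \<Gamma> V \<gamma>"
      by (intro ext) (simp only: lepage_integral_def dec_code)
    then show "sas_random_measure M a (\<lambda>f \<omega>. lepage_integral a (dec 0) (dec 1) (dec 2) f (code \<omega>))"
      using sas_random_measure_lepage[OF a] by (simp only:)
    fix f assume "f \<in> L_space a"
    then have "f \<in> borel_measurable borel" by (simp add: L_space_def)
    then show "lepage_integral a (dec 0) (dec 1) (dec 2) f \<in> borel_measurable ?P"
      by (intro lepage_integral_measurable dec_m)
  qed (use a in simp)
  then show ?thesis by blast
qed

lemma log_kernel_increment:
  fixes r :: real
  assumes r: "0 < r" and y: "y \<noteq> 0" "y \<noteq> s"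
  shows "log_kernel (u + r * s) (u + r * y) - log_kernel u (u + r * y) = log_kernel s y"
proof -
  have "u + r * s - (u + r * y) = r * (s - y)" "u - (u + r * y) = r * (- y)" by (simp_all add: algebra_simps)
  then show ?thesis using r y by (simp add: log_kernel_def abs_mult ln_mult)
qed

text \<open>
  Substitute \<open>x = u + r y\<close>. The factor \<open>r\<close> of the substitution cancels against
  \<open>(r\<^bsup>-1/a\<^esup>)\<^bsup>a\<^esup>\<close>: self-similarity with exponent \<open>1/a\<close> and stationarity of the increments in one step.
\<close>

lemma log_kernel_increment_norm:
  fixes a r u :: real
  assumes r: "0 < r" and a: "0 < a" and J: "finite J"
  shows "(\<integral>x. \<bar>\<Sum>s\<in>J. \<theta> s * r powr (- 1 / a) * (log_kernel (u + r * s) x - log_kernel u x)\<bar> powr a \<partial>lborel)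
    = (\<integral>y. \<bar>\<Sum>s\<in>J. \<theta> s * log_kernel s y\<bar> powr a \<partial>lborel)"
proof -
  let ?f = "\<lambda>x. \<bar>\<Sum>s\<in>J. \<theta> s * r powr (- 1 / a) * (log_kernel (u + r * s) x - log_kernel u x)\<bar> powr a"
  have "(\<integral>x. ?f x \<partial>lborel) = \<bar>r\<bar> *\<^sub>R (\<integral>y. ?f (u + r * y) \<partial>lborel)"
    by (rule lborel_integral_real_affine) (use r in simp)
  also have "(\<integral>y. ?f (u + r * y) \<partial>lborel) = (\<integral>y. (1 / r) * \<bar>\<Sum>s\<in>J. \<theta> s * log_kernel s y\<bar> powr a \<partial>lborel)"
  proof (rule integral_cong_AE)
    have "AE y in lborel. y \<notin> insert 0 J"
      using J by (intro AE_not_in countable_imp_null_set_lborel) (auto intro: countable_finite)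
    then show "AE y in lborel. ?f (u + r * y) = (1 / r) * \<bar>\<Sum>s\<in>J. \<theta> s * log_kernel s y\<bar> powr a"
    proof eventually_elim
      case (elim y)
      have "(\<Sum>s\<in>J. \<theta> s * r powr (- 1 / a) * (log_kernel (u + r * s) (u + r * y) - log_kernel u (u + r * y)))
         = (\<Sum>s\<in>J. r powr (- 1 / a) * (\<theta> s * log_kernel s y))"
      proof (rule sum.cong[OF refl])
        fix s assume "s \<in> J"
        then have "log_kernel (u + r * s) (u + r * y) - log_kernel u (u + r * y) = log_kernel s y"
          using elim by (intro log_kernel_increment r) auto
        then show "\<theta> s * r powr (- 1 / a) * (log_kernel (u + r * s) (u + r * y) - log_kernel u (u + r * y))
          = r powr (- 1 / a) * (\<theta> s * log_kernel s y)" by (simp only: mult.assoc mult.left_commute)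
      qed
      also have "\<dots> = r powr (- 1 / a) * (\<Sum>s\<in>J. \<theta> s * log_kernel s y)" by (rule sum_distrib_left[symmetric])
      finally have "?f (u + r * y) = (r powr (- 1 / a)) powr a * \<bar>\<Sum>s\<in>J. \<theta> s * log_kernel s y\<bar> powr a"
        by (simp only: abs_mult powr_mult abs_of_nonneg powr_ge_zero)
      also have "(r powr (- 1 / a)) powr a = 1 / r" using r a by (simp add: powr_powr powr_neg_one)
      finally show ?case .
    qed
  qed measurable
  also have "\<bar>r\<bar> *\<^sub>R \<dots> = (\<integral>y. \<bar>\<Sum>s\<in>J. \<theta> s * log_kernel s y\<bar> powr a \<partial>lborel)"
    using r by simp
  finally show ?thesis .
qed

section \<open>The cost of freezing the stability index\<close>

text \<open>
  A Lipschitz bound between \<open>u\<close> and nearby points only; unlike differentiability it passes to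
  \<open>kappa\<close> without differentiating under the integral.
\<close>

definition locally_Lipschitz_at :: "(real \<Rightarrow> real) \<Rightarrow> real \<Rightarrow> bool" where
  "locally_Lipschitz_at h u \<longleftrightarrow> (\<exists>L\<ge>0. \<forall>\<^sub>F t in nhds u. \<bar>h t - h u\<bar> \<le> L * \<bar>t - u\<bar>)"

lemma locally_Lipschitz_at_differentiable:
  assumes "(h has_real_derivative D) (at u)"
  shows "locally_Lipschitz_at h u"
proof -
  have "((\<lambda>t. (h t - h u) / (t - u)) \<longlongrightarrow> D) (at u)"
    using assms by (simp add: has_field_derivative_iff)
  then have "\<forall>\<^sub>F t in at u. dist ((h t - h u) / (t - u)) D < 1" by (rule tendstoD) simp
  then have "\<forall>\<^sub>F t in at u. \<bar>h t - h u\<bar> \<le> (\<bar>D\<bar> + 1) * \<bar>t - u\<bar>"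
    using eventually_at_in_open'[OF open_UNIV UNIV_I, of u]  eventually_neq_at_within[of u u UNIV]
  proof eventually_elim
    case (elim t)
    then have "\<bar>(h t - h u) / (t - u)\<bar> \<le> \<bar>D\<bar> + 1" unfolding dist_real_def by linarith
    then show ?case using elim by (simp add: abs_divide divide_le_eq)
  qed
  then have "\<forall>\<^sub>F t in nhds u. \<bar>h t - h u\<bar> \<le> (\<bar>D\<bar> + 1) * \<bar>t - u\<bar>"
    by (simp add: eventually_nhds_conv_at)
  then show ?thesis unfolding locally_Lipschitz_at_def by (intro exI[of _ "\<bar>D\<bar> + 1"]) auto
qed

lemma locally_Lipschitz_at_tendsto:
  assumes "locally_Lipschitz_at h u"
  shows "(h \<longlongrightarrow> h u) (nhds u)"
proof -
  obtain L where L: "\<forall>\<^sub>F t in nhds u. \<bar>h t - h u\<bar> \<le> L * \<bar>t - u\<bar>"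
    using assms by (auto simp: locally_Lipschitz_at_def)
  have "((\<lambda>t. L * \<bar>t - u\<bar>) \<longlongrightarrow> L * \<bar>u - u\<bar>) (nhds u)"
    by (intro tendsto_intros filterlim_ident)
  then have "((\<lambda>t. L * \<bar>t - u\<bar>) \<longlongrightarrow> 0) (nhds u)" by simp
  then have "((\<lambda>t. h t - h u) \<longlongrightarrow> 0) (nhds u)"
    by (rule Lim_null_comparison[rotated]) (use L in simp)
  then show ?thesis by (simp add: LIM_zero_iff)
qed

lemma locally_Lipschitz_at_compose:
  assumes g: "locally_Lipschitz_at g (h u)" and h: "locally_Lipschitz_at h u"
  shows "locally_Lipschitz_at (\<lambda>t. g (h t)) u"
proof -
  obtain L where L: "0 \<le> L" "\<forall>\<^sub>F t in nhds u. \<bar>h t - h u\<bar> \<le> L * \<bar>t - u\<bar>"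
    using h by (auto simp: locally_Lipschitz_at_def)
  obtain K where K: "0 \<le> K" "\<forall>\<^sub>F y in nhds (h u). \<bar>g y - g (h u)\<bar> \<le> K * \<bar>y - h u\<bar>"
    using g by (auto simp: locally_Lipschitz_at_def)
  have "\<forall>\<^sub>F t in nhds u. \<bar>g (h t) - g (h u)\<bar> \<le> K * \<bar>h t - h u\<bar>"
    using K(2) locally_Lipschitz_at_tendsto[OF h] by (rule eventually_compose_filterlim)
  then have "\<forall>\<^sub>F t in nhds u. \<bar>g (h t) - g (h u)\<bar> \<le> (K * L) * \<bar>t - u\<bar>"
    using L(2)
  proof eventually_elim
    case (elim t)
    have "K * \<bar>h t - h u\<bar> \<le> K * (L * \<bar>t - u\<bar>)" using elim K(1) by (intro mult_left_mono) auto
    then show ?case using elim by (simp add: mult.assoc)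
  qed
  then show ?thesis unfolding locally_Lipschitz_at_def using K(1) L(1) by (intro exI[of _ "K * L"]) auto
qed

lemma locally_Lipschitz_at_mult:
  assumes g: "locally_Lipschitz_at g u" and h: "locally_Lipschitz_at h u"
  shows "locally_Lipschitz_at (\<lambda>t. g t * h t) u"
proof -
  obtain L where L: "0 \<le> L" "\<forall>\<^sub>F t in nhds u. \<bar>h t - h u\<bar> \<le> L * \<bar>t - u\<bar>"
    using h by (auto simp: locally_Lipschitz_at_def)
  obtain K where K: "0 \<le> K" "\<forall>\<^sub>F t in nhds u. \<bar>g t - g u\<bar> \<le> K * \<bar>t - u\<bar>"
    using g by (auto simp: locally_Lipschitz_at_def)
  have "\<forall>\<^sub>F t in nhds u. dist (h t) (h u) < 1"
    by (rule tendstoD[OF locally_Lipschitz_at_tendsto[OF h]]) simp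
  then have "\<forall>\<^sub>F t in nhds u. \<bar>g t * h t - g u * h u\<bar> \<le> (K * (\<bar>h u\<bar> + 1) + \<bar>g u\<bar> * L) * \<bar>t - u\<bar>"
    using L(2) K(2)
  proof eventually_elim
    case (elim t)
    have "g t * h t - g u * h u = (g t - g u) * h t + g u * (h t - h u)" by (simp add: algebra_simps)
    also have "\<bar>\<dots>\<bar> \<le> \<bar>g t - g u\<bar> * \<bar>h t\<bar> + \<bar>g u\<bar> * \<bar>h t - h u\<bar>"
      by (rule order_trans[OF abs_triangle_ineq]) (simp add: abs_mult)
    also have "\<dots> \<le> (K * \<bar>t - u\<bar>) * (\<bar>h u\<bar> + 1) + \<bar>g u\<bar> * (L * \<bar>t - u\<bar>)"
      using elim K(1) by (intro add_mono mult_mono mult_left_mono) (auto simp: dist_real_def)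
    finally show ?case by (simp add: algebra_simps)
  qed
  then show ?thesis unfolding locally_Lipschitz_at_def using K(1) L(1) by (intro exI[of _ "K * (\<bar>h u\<bar> + 1) + \<bar>g u\<bar> * L"]) auto
qed

lemma locally_Lipschitz_at_kappa:
  assumes "1 < a" "a < 2"
  shows "locally_Lipschitz_at kappa a"
proof -
  define c d where "c = (1 + a) / 2" and "d = (a + 2) / 2"
  have cd: "1 < c" "c < a" "a < d" "d < 2" using assms by (auto simp: c_def d_def)
  obtain L where L: "0 \<le> L" "\<And>a a'. a \<in> {c..d} \<Longrightarrow> a' \<in> {c..d} \<Longrightarrow> \<bar>kappa a - kappa a'\<bar> \<le> L * \<bar>a - a'\<bar>"
    using kappa_Lipschitz[OF cd(1,4)] by blast
  have "\<forall>\<^sub>F t in nhds a. t \<in> {c<..<d}" using cd by (intro eventually_nhds_in_open) auto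
  then have "\<forall>\<^sub>F t in nhds a. \<bar>kappa t - kappa a\<bar> \<le> L * \<bar>t - a\<bar>"
    by eventually_elim (use L(2) cd in auto)
  then show ?thesis unfolding locally_Lipschitz_at_def using L(1) by blast
qed

lemma locally_Lipschitz_at_scale:
  assumes \<alpha>: "\<And>t. 1 < \<alpha> t" "\<And>t. \<alpha> t < 2"
    and \<alpha>L: "locally_Lipschitz_at \<alpha> u" and bL: "locally_Lipschitz_at b u"
  shows "locally_Lipschitz_at (\<lambda>t. b t * stable_const (\<alpha> t) powr (1 / \<alpha> t)) u"
    and "locally_Lipschitz_at (\<lambda>t. 1 / \<alpha> t) u"
proof -
  have "((\<lambda>x. 1 / x) has_real_derivative - (1 / (\<alpha> u)\<^sup>2)) (at (\<alpha> u))"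
    using \<alpha>(1)[of u] by (auto intro!: derivative_eq_intros simp: power2_eq_square divide_simps)
  from locally_Lipschitz_at_compose[OF locally_Lipschitz_at_differentiable[OF this] \<alpha>L]
  show inv: "locally_Lipschitz_at (\<lambda>t. 1 / \<alpha> t) u" .
  have kap: "locally_Lipschitz_at (\<lambda>t. kappa (\<alpha> t)) u"
    by (rule locally_Lipschitz_at_compose[OF locally_Lipschitz_at_kappa[OF \<alpha>] \<alpha>L])
  have "((\<lambda>x. - ln x) has_real_derivative - (1 / kappa (\<alpha> u))) (at (kappa (\<alpha> u)))"
    using kappa_pos[OF \<alpha>] by (auto intro!: derivative_eq_intros)
  from locally_Lipschitz_at_compose[OF locally_Lipschitz_at_differentiable[OF this] kap]
  have "locally_Lipschitz_at (\<lambda>t. - ln (kappa (\<alpha> t))) u" .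
  from locally_Lipschitz_at_mult[OF inv this]
  have "locally_Lipschitz_at (\<lambda>t. 1 / \<alpha> t * - ln (kappa (\<alpha> t))) u" .
  from locally_Lipschitz_at_compose[OF locally_Lipschitz_at_differentiable[OF DERIV_exp] this]
  have "locally_Lipschitz_at (\<lambda>t. exp (1 / \<alpha> t * - ln (kappa (\<alpha> t)))) u" .
  moreover have "exp (1 / \<alpha> t * - ln (kappa (\<alpha> t))) = stable_const (\<alpha> t) powr (1 / \<alpha> t)" for t
  proof -
    have "kappa (\<alpha> t) \<noteq> 0" using kappa_pos[OF \<alpha>, of t] by simp
    then show ?thesis by (simp add: stable_const_kappa powr_def ln_inverse)
  qed
  ultimately have "locally_Lipschitz_at (\<lambda>t. stable_const (\<alpha> t) powr (1 / \<alpha> t)) u" by simp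
  from locally_Lipschitz_at_mult[OF bL this]
  show "locally_Lipschitz_at (\<lambda>t. b t * stable_const (\<alpha> t) powr (1 / \<alpha> t)) u" .
qed

text \<open>
  For a single power \<open>v\<^bsup>-p\<^esup>\<close> the mass is at most a multiple of the integral of the \<open>1/p\<close>-th power
  of its coefficient, and the square of a sum of two terms is at most twice the sum of the squares.
\<close>

lemma mass_two_powers:
  assumes p: "1 / 2 < p0" "p1 < 1" "p0 \<le> p1" and k: "0 \<le> k"
    and G: "\<And>v x. 0 < v \<Longrightarrow> \<bar>G v x\<bar> \<le> k * \<bar>log_kernel t x\<bar> * (v powr (- p0) + v powr (- p1))"
  shows "mass G \<le> ennreal (4 / (2 - 1 / p0) * (k powr (1 / p0) * (\<bar>t\<bar> * log_kernel_norm (1 / p0)))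
     + 4 / (2 - 1 / p1) * (k powr (1 / p1) * (\<bar>t\<bar> * log_kernel_norm (1 / p1))))"
proof -
  define F where "F p x = (\<integral>\<^sup>+v. ennreal (min 1 ((k * log_kernel t x * v powr (- p))\<^sup>2)) * indicator {0<..} v \<partial>lborel)" for p x
  have F_bd: "(\<integral>\<^sup>+x. F p x \<partial>lborel) \<le> ennreal (2 / (2 - 1 / p) * (k powr (1 / p) * (\<bar>t\<bar> * log_kernel_norm (1 / p))))"
    if p: "1 / 2 < p" "p < 1" for p
  proof -
    have a: "1 < 1 / p" "1 / p < 2" using p by (auto simp: field_simps)
    have "F p x \<le> ennreal (2 / (2 - 1 / p)) * (ennreal (k powr (1 / p)) * ennreal (\<bar>log_kernel t x\<bar> powr (1 / p)))" for x
      using nn_integral_min_square_powr[of "1 / p" "k * log_kernel t x"] a k p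
      by (simp add: F_def abs_mult powr_mult ennreal_mult)
    then have "(\<integral>\<^sup>+x. F p x \<partial>lborel) \<le> (\<integral>\<^sup>+x. ennreal (2 / (2 - 1 / p)) * (ennreal (k powr (1 / p)) * ennreal (\<bar>log_kernel t x\<bar> powr (1 / p))) \<partial>lborel)"
      by (rule nn_integral_mono)
    also have "\<dots> = ennreal (2 / (2 - 1 / p)) * (ennreal (k powr (1 / p)) * ennreal (\<bar>t\<bar> * log_kernel_norm (1 / p)))"
      using nn_integral_log_kernel[of "1 / p" t] a by (simp add: nn_integral_cmult)
    also have "\<dots> = ennreal (2 / (2 - 1 / p) * (k powr (1 / p) * (\<bar>t\<bar> * log_kernel_norm (1 / p))))"
    proof -
      have "0 \<le> 2 / (2 - 1 / p)" "0 \<le> k powr (1 / p)" using a by (auto intro!: divide_nonneg_nonneg)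
      then show ?thesis by (simp only: ennreal_mult')
    qed
    finally show ?thesis .
  qed
  have [measurable]: "F p \<in> borel_measurable borel" for p unfolding F_def[abs_def] by measurable
  have "mass G \<le> (\<integral>\<^sup>+x. 2 * F p0 x + 2 * F p1 x \<partial>lborel)"
    unfolding mass_def
  proof (rule nn_integral_mono)
    fix x
    have "(\<integral>\<^sup>+v. ennreal (min 1 ((G v x)\<^sup>2)) * indicator {0<..} v \<partial>lborel)
      \<le> (\<integral>\<^sup>+v. 2 * (ennreal (min 1 ((k * log_kernel t x * v powr (- p0))\<^sup>2)) * indicator {0<..} v)
             + 2 * (ennreal (min 1 ((k * log_kernel t x * v powr (- p1))\<^sup>2)) * indicator {0<..} v) \<partial>lborel)"
    proof (rule nn_integral_mono)
      fix v :: real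
      show "ennreal (min 1 ((G v x)\<^sup>2)) * indicator {0<..} v
        \<le> 2 * (ennreal (min 1 ((k * log_kernel t x * v powr (- p0))\<^sup>2)) * indicator {0<..} v)
             + 2 * (ennreal (min 1 ((k * log_kernel t x * v powr (- p1))\<^sup>2)) * indicator {0<..} v)"
      proof (cases "0 < v")
        case True
        define y z where "y = k * \<bar>log_kernel t x\<bar> * v powr (- p0)" and "z = k * \<bar>log_kernel t x\<bar> * v powr (- p1)"
        have "\<bar>G v x\<bar> \<le> y + z" using G[OF True, of x] by (simp add: y_def z_def distrib_left)
        then have "(G v x)\<^sup>2 \<le> (y + z)\<^sup>2" by (metis abs_ge_zero power2_abs power_mono)
        also have "\<dots> \<le> 2 * y\<^sup>2 + 2 * z\<^sup>2" using sum_squares_bound[of y z] by (simp add: power2_sum)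
        finally have "min 1 ((G v x)\<^sup>2) \<le> 2 * min 1 (y\<^sup>2) + 2 * min 1 (z\<^sup>2)"
          using zero_le_power2[of y] zero_le_power2[of z] unfolding min_def by (smt (verit))
        then have "ennreal (min 1 ((G v x)\<^sup>2)) \<le> ennreal (2 * min 1 (y\<^sup>2) + 2 * min 1 (z\<^sup>2))" by (rule ennreal_leI)
        also have "\<dots> = 2 * ennreal (min 1 (y\<^sup>2)) + 2 * ennreal (min 1 (z\<^sup>2))"
          by (simp add: ennreal_mult')
        finally show ?thesis using True by (simp add: y_def z_def power_mult_distrib)
      qed simp
    qed
    also have "\<dots> = 2 * F p0 x + 2 * F p1 x"
      unfolding F_def by (subst nn_integral_add) (auto simp: nn_integral_cmult)
    finally show "(\<integral>\<^sup>+v. ennreal (min 1 ((G v x)\<^sup>2)) * indicator {0<..} v \<partial>lborel) \<le> 2 * F p0 x + 2 * F p1 x" .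
  qed
  also have "\<dots> = 2 * (\<integral>\<^sup>+x. F p0 x \<partial>lborel) + 2 * (\<integral>\<^sup>+x. F p1 x \<partial>lborel)"
    by (subst nn_integral_add) (auto simp: nn_integral_cmult)
  also have "\<dots> \<le> 2 * ennreal (2 / (2 - 1 / p0) * (k powr (1 / p0) * (\<bar>t\<bar> * log_kernel_norm (1 / p0))))
     + 2 * ennreal (2 / (2 - 1 / p1) * (k powr (1 / p1) * (\<bar>t\<bar> * log_kernel_norm (1 / p1))))"
    using p by (intro add_mono mult_left_mono F_bd) auto
  also have "\<dots> = ennreal (2 * (2 / (2 - 1 / p0) * (k powr (1 / p0) * (\<bar>t\<bar> * log_kernel_norm (1 / p0))))
     + 2 * (2 / (2 - 1 / p1) * (k powr (1 / p1) * (\<bar>t\<bar> * log_kernel_norm (1 / p1)))))"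
  proof -
    have nn: "0 \<le> 2 / (2 - 1 / p) * (k powr (1 / p) * (\<bar>t\<bar> * log_kernel_norm (1 / p)))" if "1 / 2 < p" for p
      using that log_kernel_norm_nonneg[of "1 / p"]
      by (intro mult_nonneg_nonneg divide_nonneg_nonneg) (auto simp: field_simps)
    have "2 * ennreal z = ennreal (2 * z)" for z by (simp add: ennreal_mult')
    then show ?thesis using nn[of p0] nn[of p1] p by (simp add: ennreal_plus)
  qed
  also have "2 * (2 / (2 - 1 / p0) * (k powr (1 / p0) * (\<bar>t\<bar> * log_kernel_norm (1 / p0))))
     + 2 * (2 / (2 - 1 / p1) * (k powr (1 / p1) * (\<bar>t\<bar> * log_kernel_norm (1 / p1))))
    = 4 / (2 - 1 / p0) * (k powr (1 / p0) * (\<bar>t\<bar> * log_kernel_norm (1 / p0)))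
     + 4 / (2 - 1 / p1) * (k powr (1 / p1) * (\<bar>t\<bar> * log_kernel_norm (1 / p1)))" by simp
  finally show ?thesis .
qed

context lepage_variables
begin

text \<open>
  The inner sum keeps the one shell that contains \<open>V i\<close>, and its weight is a power of
  \<open>1 / m_hat_density\<close>. Positive arrival times allow the powers to be multiplied.
\<close>

lemma log_frac_multistable_motion_eq:
  assumes \<alpha>: "0 < \<alpha> t" and pos: "\<And>i. 0 < \<Gamma> i \<omega>"
  shows "log_frac_multistable_motion \<alpha> b \<Gamma> V \<gamma> t \<omega> = b t * lepage_integral (\<alpha> t) \<Gamma> V \<gamma> (log_kernel t) \<omega>"
proof -
  have summand: "(\<Sum>j. \<gamma> i \<omega> * \<Gamma> i \<omega> powr (- 1 / \<alpha> t) * log_kernel t (V i \<omega>) *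
        (pi powr (2 / \<alpha> t) / 3 powr (1 / \<alpha> t)) * real (Suc j) powr (2 / \<alpha> t) *
        indicator (shell j) (V i \<omega>))
     = \<gamma> i \<omega> * (log_kernel t (V i \<omega>) * (\<Gamma> i \<omega> * m_hat_density (V i \<omega>)) powr (- 1 / \<alpha> t))" for i
  proof -
    define N where "N = real (Suc (shell_index (V i \<omega>)))"
    have N: "0 < N" by (simp add: N_def)
    have "m_hat_density (V i \<omega>) powr (- 1 / \<alpha> t) = (3 / (pi powr 2 * N powr 2)) powr (- 1 / \<alpha> t)"
      using N by (simp add: m_hat_density_eq N_def)
    also have "\<dots> = 3 powr (- 1 / \<alpha> t) / (pi powr (2 * (- 1 / \<alpha> t)) * N powr (2 * (- 1 / \<alpha> t)))"
      using N by (simp only: powr_divide powr_mult powr_powr)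
    also have "\<dots> = pi powr (2 / \<alpha> t) / 3 powr (1 / \<alpha> t) * N powr (2 / \<alpha> t)"
      by (simp add: powr_minus field_simps)
    finally have m: "m_hat_density (V i \<omega>) powr (- 1 / \<alpha> t) = pi powr (2 / \<alpha> t) / 3 powr (1 / \<alpha> t) * N powr (2 / \<alpha> t)" .
    have "(\<Gamma> i \<omega> * m_hat_density (V i \<omega>)) powr (- 1 / \<alpha> t) = \<Gamma> i \<omega> powr (- 1 / \<alpha> t) * m_hat_density (V i \<omega>) powr (- 1 / \<alpha> t)"
      using pos[of i] m_hat_density_pos[of "V i \<omega>"] by (simp add: powr_mult)
    then show ?thesis unfolding suminf_shell N_def[symmetric] m by (simp only: mult.assoc mult.left_commute)
  qed
  show ?thesis
    unfolding log_frac_multistable_motion_def summand lepage_integral_def by (simp only: mult.assoc)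
qed

lemma log_frac_multistable_motion_AE:
  assumes "\<And>t. 0 < \<alpha> t"
  shows "AE \<omega> in M. \<forall>t. log_frac_multistable_motion \<alpha> b \<Gamma> V \<gamma> t \<omega> = b t * lepage_integral (\<alpha> t) \<Gamma> V \<gamma> (log_kernel t) \<omega>"
proof -
  have "AE \<omega> in M. \<forall>i. 0 < \<Gamma> i \<omega>" by (subst AE_all_countable) (simp add: \<Gamma>_pos)
  then show ?thesis by eventually_elim (use log_frac_multistable_motion_eq assms in blast)
qed

lemma log_frac_multistable_motion_measurable:
  "log_frac_multistable_motion \<alpha> b \<Gamma> V \<gamma> t \<in> borel_measurable M"
proof -
  have [measurable]: "shell j \<in> sets borel" for j unfolding shell_def by auto
  show ?thesis unfolding log_frac_multistable_motion_def[abs_def] by measurable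
qed

text \<open>
  The difference is a single series over the Poisson points, with coefficient
  \<open>B' v\<^bsup>-1/a'\<^esup> - B v\<^bsup>-1/a\<^esup>\<close> times the kernel. Multiplied by \<open>\<rho>\<close>, it is at most
  \<open>k \<bar>log_kernel t x\<bar> (v\<^bsup>-p0\<^esup> + v\<^bsup>-p1\<^esup>)\<close>; one part comes from the change of the amplitude, the other from the
  change of the exponent. This bounds the mass, and Markov's inequality is applied to \<open>min 1 (D\<^sup>2)\<close>.
\<close>

lemma prob_lepage_difference:
  fixes A B :: real
  assumes p: "1 / 2 < p0" "p1 < 1" "0 < e" and \<alpha>: "1 / a \<in> {p0 + e..p1 - e}" "1 / a' \<in> {p0 + e..p1 - e}"
    and \<rho>: "0 \<le> \<rho>" and d: "0 < d"
    and k: "k = \<rho> * (\<bar>b' * stable_const a' powr (1 / a') - b * stable_const a powr (1 / a)\<bar> + \<bar>b * stable_const a powr (1 / a)\<bar> * (\<bar>1 / a' - 1 / a\<bar> / e))"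
  shows "prob {\<omega>\<in>space M. d \<le> \<bar>\<rho> * (b' * lepage_integral a' \<Gamma> V \<gamma> (log_kernel t) \<omega> - b * lepage_integral a \<Gamma> V \<gamma> (log_kernel t) \<omega>)\<bar>}
    \<le> (4 / (2 - 1 / p0) * (k powr (1 / p0) * (\<bar>t\<bar> * log_kernel_norm (1 / p0)))
     + 4 / (2 - 1 / p1) * (k powr (1 / p1) * (\<bar>t\<bar> * log_kernel_norm (1 / p1)))) / min 1 (d\<^sup>2)"
proof -
  define B' B where "B' = b' * stable_const a' powr (1 / a')" and "B = b * stable_const a powr (1 / a)"
  have a12: "1 < a \<and> a < 2" if "1 / a \<in> {p0 + e..p1 - e}" for a
  proof -
    have "1 / 2 < 1 / a" "1 / a < 1" using that p by auto
    moreover from this have "0 < a" by (metis less_trans zero_less_divide_1_iff zero_less_numeral)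
    ultimately show ?thesis by (auto simp: field_simps)
  qed
  have a: "1 < a" "a < 2" "1 < a'" "a' < 2" using a12 \<alpha> by auto
  have p01: "p0 \<le> p1" using \<alpha>(1) p(3) by auto
  define G where "G v x = \<rho> * (log_kernel t x * (B' * v powr (- 1 / a') - B * v powr (- 1 / a)))" for v x
  have Gm: "case_prod G \<in> borel_measurable (borel \<Otimes>\<^sub>M borel)" unfolding G_def by measurable
  have k0: "0 \<le> k" unfolding k using \<rho> p(3) by auto
  have G_le: "\<bar>G v x\<bar> \<le> k * \<bar>log_kernel t x\<bar> * (v powr (- p0) + v powr (- p1))" if v: "0 < v" for v x
  proof -
    let ?w = "v powr (- p0) + v powr (- p1)"
    have w: "v powr (- (1 / a')) \<le> ?w"
    proof (cases "1 \<le> v")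
      case True
      then have "v powr (- (1 / a')) \<le> v powr (- p0)" using \<alpha>(2) p(3) by (intro powr_mono) auto
      then show ?thesis by (simp add: add_increasing2)
    next
      case False
      then have "v powr (- (1 / a')) \<le> v powr (- p1)" using \<alpha>(2) p(3) v by (intro powr_mono') auto
      then show ?thesis by (simp add: add_increasing)
    qed
    have dw: "\<bar>v powr (- (1 / a')) - v powr (- (1 / a))\<bar> \<le> \<bar>1 / a' - 1 / a\<bar> / e * ?w"
      using \<alpha> by (intro abs_powr_diff_le v p(3)) auto
    have "B' * v powr (- (1 / a')) - B * v powr (- (1 / a)) = (B' - B) * v powr (- (1 / a')) + B * (v powr (- (1 / a')) - v powr (- (1 / a)))"
      by (simp add: algebra_simps)
    also have "\<bar>\<dots>\<bar> \<le> \<bar>B' - B\<bar> * v powr (- (1 / a')) + \<bar>B\<bar> * \<bar>v powr (- (1 / a')) - v powr (- (1 / a))\<bar>"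
      by (rule order_trans[OF abs_triangle_ineq]) (simp add: abs_mult)
    also have "\<dots> \<le> \<bar>B' - B\<bar> * ?w + \<bar>B\<bar> * (\<bar>1 / a' - 1 / a\<bar> / e * ?w)"
      by (intro add_mono mult_left_mono w dw) auto
    also have "\<dots> = (\<bar>B' - B\<bar> + \<bar>B\<bar> * (\<bar>1 / a' - 1 / a\<bar> / e)) * ?w" by (simp add: distrib_right)
    finally have "\<rho> * (\<bar>log_kernel t x\<bar> * \<bar>B' * v powr (- (1 / a')) - B * v powr (- (1 / a))\<bar>) \<le> \<rho> * (\<bar>log_kernel t x\<bar> * ((\<bar>B' - B\<bar> + \<bar>B\<bar> * (\<bar>1 / a' - 1 / a\<bar> / e)) * ?w))"
      by (intro mult_left_mono \<rho>) auto
    also have "\<dots> = k * \<bar>log_kernel t x\<bar> * ?w" unfolding k B_def[symmetric] B'_def[symmetric] by (simp only: mult.assoc mult.left_commute)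
    finally show ?thesis using \<rho> by (simp add: G_def abs_mult)
  qed
  define R where "R = 4 / (2 - 1 / p0) * (k powr (1 / p0) * (\<bar>t\<bar> * log_kernel_norm (1 / p0)))
     + 4 / (2 - 1 / p1) * (k powr (1 / p1) * (\<bar>t\<bar> * log_kernel_norm (1 / p1)))"
  have mR: "mass G \<le> ennreal R" unfolding R_def by (rule mass_two_powers[OF p(1,2) p01 k0 G_le])
  have R0: "0 \<le> R"
  proof -
    have "0 \<le> 4 / (2 - 1 / p) * (k powr (1 / p) * (\<bar>t\<bar> * log_kernel_norm (1 / p)))" if "1 / 2 < p" for p
      using that log_kernel_norm_nonneg[of "1 / p"] by (intro mult_nonneg_nonneg divide_nonneg_nonneg) (auto simp: field_simps)
    then show ?thesis unfolding R_def using p(1) p01 by (intro add_nonneg_nonneg) auto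
  qed
  define D where "D \<omega> = \<rho> * (b' * lepage_integral a' \<Gamma> V \<gamma> (log_kernel t) \<omega> - b * lepage_integral a \<Gamma> V \<gamma> (log_kernel t) \<omega>)" for \<omega>
  have [measurable]: "D \<in> borel_measurable M"
    using lepage_integral_measurable[OF \<Gamma>_measurable V_measurable \<gamma>_measurable log_kernel_measurable] unfolding D_def[abs_def]
    by (intro borel_measurable_times borel_measurable_diff borel_measurable_const) auto
  have D_eq: "AE \<omega> in M. D \<omega> = (\<Sum>i. \<gamma> i \<omega> * G (pt i \<omega>) (V i \<omega>))"
    using summable_lepage[OF a(1,2) log_kernel_in_L_space[OF a(1) less_imp_le[OF a(2)], of t]]
      summable_lepage[OF a(3,4) log_kernel_in_L_space[OF a(3) less_imp_le[OF a(4)], of t]]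
  proof eventually_elim
    case (elim \<omega>)
    let ?t = "\<lambda>a i. \<gamma> i \<omega> * (log_kernel t (V i \<omega>) * (\<Gamma> i \<omega> * m_hat_density (V i \<omega>)) powr (- 1 / a))"
    have s: "summable (?t a)" "summable (?t a')" by (rule elim)+
    have "D \<omega> = (\<rho> * B') * (\<Sum>i. ?t a' i) - (\<rho> * B) * (\<Sum>i. ?t a i)"
      by (simp add: D_def B_def B'_def lepage_integral_def algebra_simps)
    also have "\<dots> = (\<Sum>i. (\<rho> * B') * ?t a' i) - (\<Sum>i. (\<rho> * B) * ?t a i)"
      by (simp only: suminf_mult[OF s(1)] suminf_mult[OF s(2)])
    also have "\<dots> = (\<Sum>i. (\<rho> * B') * ?t a' i - (\<rho> * B) * ?t a i)"
      by (rule suminf_diff) (intro summable_mult s)+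
    also have "\<dots> = (\<Sum>i. \<gamma> i \<omega> * G (pt i \<omega>) (V i \<omega>))"
      by (rule suminf_cong) (simp add: G_def pt_def algebra_simps)
    finally show ?case .
  qed
  have "(\<integral>\<^sup>+\<omega>. ennreal (min 1 ((D \<omega>)\<^sup>2)) \<partial>M) = (\<integral>\<^sup>+\<omega>. ennreal (min 1 ((\<Sum>i. \<gamma> i \<omega> * G (pt i \<omega>) (V i \<omega>))\<^sup>2)) \<partial>M)"
    by (rule nn_integral_cong_AE) (use D_eq in \<open>auto elim!: eventually_mono\<close>)
  also have "\<dots> \<le> mass G"
    by (rule random_series_bound[OF Gm]) (rule le_less_trans[OF mR], simp)
  finally have ED: "(\<integral>\<^sup>+\<omega>. ennreal (min 1 ((D \<omega>)\<^sup>2)) \<partial>M) \<le> ennreal R" using mR by (rule order_trans)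
  define \<eta> where "\<eta> = min 1 (d\<^sup>2)"
  have \<eta>: "0 < \<eta>" using d by (simp add: \<eta>_def)
  define E where "E = {\<omega>\<in>space M. d \<le> \<bar>D \<omega>\<bar>}"
  have [measurable]: "E \<in> events" unfolding E_def by measurable
  have "ennreal (\<eta> * prob E) = (\<integral>\<^sup>+\<omega>. ennreal \<eta> * indicator E \<omega> \<partial>M)"
    using \<eta> by (simp add: nn_integral_cmult_indicator emeasure_eq_measure ennreal_mult')
  also have "\<dots> \<le> (\<integral>\<^sup>+\<omega>. ennreal (min 1 ((D \<omega>)\<^sup>2)) \<partial>M)"
  proof (rule nn_integral_mono)
    fix \<omega>
    show "ennreal \<eta> * indicator E \<omega> \<le> ennreal (min 1 ((D \<omega>)\<^sup>2))"
    proof (cases "\<omega> \<in> E")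
      case True
      then have "d\<^sup>2 \<le> \<bar>D \<omega>\<bar>\<^sup>2" using d by (intro power_mono) (auto simp: E_def)
      then have "\<eta> \<le> min 1 ((D \<omega>)\<^sup>2)" by (auto simp: \<eta>_def min_def)
      then show ?thesis using True by (simp add: ennreal_leI)
    qed simp
  qed
  also have "\<dots> \<le> ennreal R" by (rule ED)
  finally have "\<eta> * prob E \<le> R" using R0 by (simp add: ennreal_le_iff)
  then have "prob E \<le> R / \<eta>" using \<eta> by (simp add: field_simps)
  then show ?thesis by (simp add: E_def D_def R_def \<eta>_def)
qed

end

section \<open>The local form\<close>

context lepage_variables
begin

text \<open>
  Both sides have joint characteristic functions given by \<open>L\<^sup>a\<close> norms of kernels, and these agree by
  the substitution in \<open>log_kernel_increment_norm\<close>.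
\<close>

lemma increment_law:
  fixes N :: "'v measure"
  assumes a: "1 < a" "a < 2" and S: "sas_random_measure N a I" and J: "finite J" and r: "0 < r"
  defines "L \<equiv> lepage_integral a \<Gamma> V \<gamma>"
  shows "distr M (PiM J (\<lambda>_. borel)) (\<lambda>\<omega>. \<lambda>s\<in>J. r powr (- 1 / a) * (\<beta> * (L (log_kernel (u + r * s)) \<omega> - L (log_kernel u) \<omega>)))
    = distr N (PiM J (\<lambda>_. borel)) (\<lambda>\<omega>. \<lambda>s\<in>J. \<beta> * I (log_kernel s) \<omega>)"
proof -
  have K: "log_kernel s \<in> L_space a" for s by (rule log_kernel_in_L_space) (use a in auto)
  have a0: "0 < a" using a by simp
  have LS: "sas_random_measure M a L" unfolding L_def by (rule sas_random_measure_lepage[OF a])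
  have Lm: "\<And>f. f \<in> L_space a \<Longrightarrow> L f \<in> borel_measurable M" using LS by (simp add: sas_random_measure_def)
  have Im: "\<And>f. f \<in> L_space a \<Longrightarrow> I f \<in> borel_measurable N" using S by (simp add: sas_random_measure_def)
  have N: "prob_space N" using S by (simp add: sas_random_measure_def)
  note [measurable] = Lm[OF K] Im[OF K]
  define f where "f s x = 1 * log_kernel (u + r * s) x + (- 1) * log_kernel u x" for s x
  have f: "f s \<in> L_space a" for s unfolding f_def[abs_def] by (rule L_space_lincomb[OF K K a0])
  note [measurable] = Lm[OF f]
  have Lf: "AE \<omega> in M. L (f s) \<omega> = L (log_kernel (u + r * s)) \<omega> - L (log_kernel u) \<omega>" for s
  proof -
    have "AE \<omega> in M. L (\<lambda>x. 1 * log_kernel (u + r * s) x + (- 1) * log_kernel u x) \<omega> = 1 * L (log_kernel (u + r * s)) \<omega> + (- 1) * L (log_kernel u) \<omega>"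
      using LS K unfolding sas_random_measure_def by blast
    then show ?thesis unfolding f_def[abs_def] by eventually_elim (simp only: mult_1 mult_minus1 diff_conv_add_uminus)
  qed
  show ?thesis
  proof (rule distr_PiM_eqI_char[OF prob_space_axioms N J])
    fix \<theta> :: "real \<Rightarrow> real"
    have "(\<integral>\<omega>. iexp (\<Sum>s\<in>J. \<theta> s * (r powr (- 1 / a) * (\<beta> * (L (log_kernel (u + r * s)) \<omega> - L (log_kernel u) \<omega>)))) \<partial>M)
       = (\<integral>\<omega>. iexp (\<Sum>s\<in>J. (\<theta> s * \<beta> * r powr (- 1 / a)) * L (f s) \<omega>) \<partial>M)"
    proof (rule integral_cong_AE)
      have "AE \<omega> in M. \<forall>s\<in>J. L (f s) \<omega> = L (log_kernel (u + r * s)) \<omega> - L (log_kernel u) \<omega>"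
        by (rule AE_finite_allI[OF J]) (rule Lf)
      then show "AE \<omega> in M. iexp (\<Sum>s\<in>J. \<theta> s * (r powr (- 1 / a) * (\<beta> * (L (log_kernel (u + r * s)) \<omega> - L (log_kernel u) \<omega>))))
         = iexp (\<Sum>s\<in>J. (\<theta> s * \<beta> * r powr (- 1 / a)) * L (f s) \<omega>)"
      proof eventually_elim
        case (elim \<omega>)
        have "(\<Sum>s\<in>J. \<theta> s * (r powr (- 1 / a) * (\<beta> * (L (log_kernel (u + r * s)) \<omega> - L (log_kernel u) \<omega>))))
          = (\<Sum>s\<in>J. (\<theta> s * \<beta> * r powr (- 1 / a)) * L (f s) \<omega>)"
          by (rule sum.cong[OF refl]) (use elim in \<open>simp only: mult.assoc mult.left_commute\<close>)
        then show ?case by (simp only:)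
      qed
    qed measurable
    also have "\<dots> = complex_of_real (exp (- (\<integral>x. \<bar>\<Sum>s\<in>J. (\<theta> s * \<beta> * r powr (- 1 / a)) * f s x\<bar> powr a \<partial>lborel)))"
      by (rule sas_random_measure_joint_char[OF LS a0 J f])
    also have "(\<integral>x. \<bar>\<Sum>s\<in>J. (\<theta> s * \<beta> * r powr (- 1 / a)) * f s x\<bar> powr a \<partial>lborel)
       = (\<integral>y. \<bar>\<Sum>s\<in>J. (\<theta> s * \<beta>) * log_kernel s y\<bar> powr a \<partial>lborel)"
      using log_kernel_increment_norm[OF r a0 J, of "\<lambda>s. \<theta> s * \<beta>" u] by (simp add: f_def)
    also have "complex_of_real (exp (- (\<integral>y. \<bar>\<Sum>s\<in>J. (\<theta> s * \<beta>) * log_kernel s y\<bar> powr a \<partial>lborel)))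
       = (\<integral>\<omega>. iexp (\<Sum>s\<in>J. (\<theta> s * \<beta>) * I (log_kernel s) \<omega>) \<partial>N)"
      by (rule sas_random_measure_joint_char[OF S a0 J K, symmetric])
    finally show "(\<integral>\<omega>. iexp (\<Sum>s\<in>J. \<theta> s * (r powr (- 1 / a) * (\<beta> * (L (log_kernel (u + r * s)) \<omega> - L (log_kernel u) \<omega>)))) \<partial>M)
       = (\<integral>\<omega>. iexp (\<Sum>s\<in>J. \<theta> s * (\<beta> * I (log_kernel s) \<omega>)) \<partial>N)"
      by (simp only: mult.assoc)
  qed measurable
qed

text \<open>
  The constant \<open>k r\<close> of \<open>prob_lepage_difference\<close> is at most \<open>C r\<^bsup>1 - 1/a\<^esup>\<close>, by the Lipschitz bounds for
  the amplitude and for \<open>1 / \<alpha>\<close> at \<open>u\<close>, and \<open>1 - 1/a > 0\<close>.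
\<close>

lemma freezing_error_tendsto_0:
  assumes cd: "1 < c" "d < 2" "\<And>t. \<alpha> t \<in> {c..d}"
    and \<alpha>L: "locally_Lipschitz_at \<alpha> u" and bL: "locally_Lipschitz_at b u" and \<delta>: "0 < \<delta>"
  shows "((\<lambda>r. prob {\<omega>\<in>space M. \<delta> \<le> \<bar>r powr (- 1 / \<alpha> u) *
      (b (u + r * s) * lepage_integral (\<alpha> (u + r * s)) \<Gamma> V \<gamma> (log_kernel (u + r * s)) \<omega>
       - b u * lepage_integral (\<alpha> u) \<Gamma> V \<gamma> (log_kernel (u + r * s)) \<omega>)\<bar>}) \<longlongrightarrow> 0) (at_right 0)"
proof -
  have \<alpha>12: "1 < \<alpha> t" "\<alpha> t < 2" for t using cd(1,2) cd(3)[of t] by auto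
  have "c \<le> d" using cd(3)[of u] by auto
  then have c: "1 < c" "0 < d" "c < 2" "1 < d" using cd by auto
  define a where "a = \<alpha> u"
  have a: "1 < a" "a < 2" using \<alpha>12 by (auto simp: a_def)
  \<comment> \<open>room on both sides of the range of the exponents 1 / \<alpha>, still inside (1/2, 1)\<close>
  define e where "e = min (1 / d - 1 / 2) (1 - 1 / c) / 2"
  define p0 where "p0 = 1 / d - e"
  define p1 where "p1 = 1 / c + e"
  have "1 / 2 < 1 / d" "1 / c < 1" using c cd(2) by (auto simp: field_simps)
  then have e: "0 < e" "1 / 2 < p0" "p1 < 1" by (auto simp: e_def p0_def p1_def min_def field_simps)
  have inv: "1 / \<alpha> t \<in> {p0 + e..p1 - e}" for t
    using cd(3)[of t] c by (auto simp: p0_def p1_def intro!: divide_left_mono mult_pos_pos)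
  have p1h: "1 / 2 < p1" "0 < p0" "0 < p1" using inv[of u] e by auto
  define B where "B t = b t * stable_const (\<alpha> t) powr (1 / \<alpha> t)" for t
  define k where "k r = r powr (- 1 / a) * (\<bar>B (u + r * s) - B u\<bar> + \<bar>B u\<bar> * (\<bar>1 / \<alpha> (u + r * s) - 1 / a\<bar> / e))" for r
  define R where "R r = (4 / (2 - 1 / p0) * (k r powr (1 / p0) * (\<bar>u + r * s\<bar> * log_kernel_norm (1 / p0)))
     + 4 / (2 - 1 / p1) * (k r powr (1 / p1) * (\<bar>u + r * s\<bar> * log_kernel_norm (1 / p1)))) / min 1 (\<delta>\<^sup>2)" for r
  obtain L1 where L1: "0 \<le> L1" "\<forall>\<^sub>F t in nhds u. \<bar>B t - B u\<bar> \<le> L1 * \<bar>t - u\<bar>"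
    using locally_Lipschitz_at_scale(1)[OF \<alpha>12 \<alpha>L bL] unfolding B_def locally_Lipschitz_at_def by blast
  obtain L2 where L2: "0 \<le> L2" "\<forall>\<^sub>F t in nhds u. \<bar>1 / \<alpha> t - 1 / \<alpha> u\<bar> \<le> L2 * \<bar>t - u\<bar>"
    using locally_Lipschitz_at_scale(2)[OF \<alpha>12 \<alpha>L bL] unfolding locally_Lipschitz_at_def by blast
  define C where "C = L1 * \<bar>s\<bar> + \<bar>B u\<bar> * (L2 * \<bar>s\<bar> / e)"
  have id0: "((\<lambda>r. r) \<longlongrightarrow> (0::real)) (at_right 0)" by (rule tendsto_ident_at)
  have "((\<lambda>r. u + r * s) \<longlongrightarrow> u + 0 * s) (at_right 0)" by (intro tendsto_intros)
  then have lim_u: "filterlim (\<lambda>r. u + r * s) (nhds u) (at_right 0)" by simp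
  have r_pos: "\<forall>\<^sub>F r in at_right (0::real). 0 < r" by (simp add: eventually_at_right_less)
  have k0: "0 \<le> k r" for r using e(1) by (simp add: k_def)
  have k_le: "\<forall>\<^sub>F r in at_right 0. k r \<le> C * r powr (1 - 1 / a)"
    using eventually_compose_filterlim[OF L1(2) lim_u] eventually_compose_filterlim[OF L2(2) lim_u] r_pos
  proof eventually_elim
    case (elim r)
    have *: "\<bar>u + r * s - u\<bar> = r * \<bar>s\<bar>" using elim(3) by (simp add: abs_mult)
    have "k r \<le> r powr (- 1 / a) * (L1 * (r * \<bar>s\<bar>) + \<bar>B u\<bar> * (L2 * (r * \<bar>s\<bar>) / e))"
      unfolding k_def a_def using elim(1,2) e(1) unfolding *
      by (intro mult_left_mono add_mono divide_right_mono) auto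
    also have "\<dots> = C * (r powr (- 1 / a) * r powr 1)" using elim(3) e(1) by (simp add: C_def field_simps)
    also have "r powr (- 1 / a) * r powr 1 = r powr (1 - 1 / a)" unfolding powr_add[symmetric] by simp
    finally show ?case .
  qed
  have "((\<lambda>r. r powr (1 - 1 / a)) \<longlongrightarrow> 0) (at_right 0)"
    by (rule tendsto_zero_powrI[OF id0 tendsto_const]) (use r_pos a in \<open>auto elim!: eventually_mono\<close>)
  then have "((\<lambda>r. C * r powr (1 - 1 / a)) \<longlongrightarrow> 0) (at_right 0)" by (rule tendsto_mult_right_zero)
  from tendsto_sandwich[OF _ k_le tendsto_const this] have k_lim: "(k \<longlongrightarrow> 0) (at_right 0)"
    using k0 by simp
  have kp: "((\<lambda>r. k r powr (1 / p)) \<longlongrightarrow> 0) (at_right 0)" if "0 < p" for p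
    by (rule tendsto_zero_powrI[OF k_lim tendsto_const]) (use k0 that in auto)
  have "(R \<longlongrightarrow> (4 / (2 - 1 / p0) * (0 * (\<bar>u + 0 * s\<bar> * log_kernel_norm (1 / p0)))
     + 4 / (2 - 1 / p1) * (0 * (\<bar>u + 0 * s\<bar> * log_kernel_norm (1 / p1)))) / min 1 (\<delta>\<^sup>2)) (at_right 0)"
    unfolding R_def by (intro tendsto_intros kp id0 p1h) (use \<delta> in \<open>auto simp: min_def\<close>)
  then have R_lim: "(R \<longlongrightarrow> 0) (at_right 0)" by simp
  show ?thesis
  proof (rule tendsto_sandwich[OF _ _ tendsto_const R_lim])
    show "\<forall>\<^sub>F r in at_right 0. prob {\<omega>\<in>space M. \<delta> \<le> \<bar>r powr (- 1 / \<alpha> u) *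
      (b (u + r * s) * lepage_integral (\<alpha> (u + r * s)) \<Gamma> V \<gamma> (log_kernel (u + r * s)) \<omega>
       - b u * lepage_integral (\<alpha> u) \<Gamma> V \<gamma> (log_kernel (u + r * s)) \<omega>)\<bar>} \<le> R r"
    proof (intro always_eventually allI)
      fix r
      show "prob {\<omega>\<in>space M. \<delta> \<le> \<bar>r powr (- 1 / \<alpha> u) *
        (b (u + r * s) * lepage_integral (\<alpha> (u + r * s)) \<Gamma> V \<gamma> (log_kernel (u + r * s)) \<omega>
         - b u * lepage_integral (\<alpha> u) \<Gamma> V \<gamma> (log_kernel (u + r * s)) \<omega>)\<bar>} \<le> R r"
        unfolding R_def
        by (rule prob_lepage_difference[OF e(2,3,1) inv inv _ \<delta>]) (simp_all add: k_def B_def a_def)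
    qed
  qed simp
qed

text \<open>
  The increment of \<open>Y\<close> is compared with that of \<open>b u\<close> times the LePage measure of index \<open>\<alpha> u\<close>. At
  time \<open>u\<close> itself the two agree, so only the error at \<open>u + r t\<close> enters. The limit is not trivial since
  the kernel at time \<open>1\<close> has a positive norm.
\<close>

theorem has_local_form_log_frac_multistable_motion:
  fixes N :: "'v measure"
  assumes cd: "1 < c" "d < 2" "\<And>t. \<alpha> t \<in> {c..d}"
    and \<alpha>L: "locally_Lipschitz_at \<alpha> u" and bL: "locally_Lipschitz_at b u" and b: "b u \<noteq> 0"
    and S: "sas_random_measure N (\<alpha> u) I"
  shows "has_local_form M (log_frac_multistable_motion \<alpha> b \<Gamma> V \<gamma>) (1 / \<alpha> u) u N (\<lambda>t \<omega>. b u * log_frac_stable_motion I t \<omega>)"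
proof -
  let ?Y = "log_frac_multistable_motion \<alpha> b \<Gamma> V \<gamma>"
  define a where "a = \<alpha> u"
  have \<alpha>12: "1 < \<alpha> t" "\<alpha> t < 2" for t using cd(1,2) cd(3)[of t] by auto
  have \<alpha>0: "0 < \<alpha> t" for t using \<alpha>12(1)[of t] by simp
  have a: "1 < a" "a < 2" using \<alpha>12 by (auto simp: a_def)
  have S: "sas_random_measure N a I" using S by (simp add: a_def)
  interpret N: prob_space N using S by (simp add: sas_random_measure_def)
  have K: "log_kernel s \<in> L_space a" for s by (rule log_kernel_in_L_space) (use a in auto)
  have Im[measurable]: "I (log_kernel s) \<in> borel_measurable N" for s
    using S K by (simp add: sas_random_measure_def)
  have Lm[measurable]: "lepage_integral a' \<Gamma> V \<gamma> (log_kernel t) \<in> borel_measurable M" for a' t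
    by (rule lepage_integral_measurable[OF \<Gamma>_measurable V_measurable \<gamma>_measurable log_kernel_measurable])
  note [measurable] = log_frac_multistable_motion_measurable
  have "\<not> (AE \<omega> in N. b u * I (log_kernel 1) \<omega> = 0)"
  proof
    assume "AE \<omega> in N. b u * I (log_kernel 1) \<omega> = 0"
    then have "AE \<omega> in N. I (log_kernel 1) \<omega> = 0" using b by simp
    then have "(\<integral>\<omega>. iexp (\<Sum>s\<in>{1}. 1 * I (log_kernel s) \<omega>) \<partial>N) = (\<integral>\<omega>. 1 \<partial>N)"
      by (intro integral_cong_AE) (auto elim!: eventually_mono)
    moreover have "(\<integral>\<omega>. iexp (\<Sum>s\<in>{1}. 1 * I (log_kernel s) \<omega>) \<partial>N) = complex_of_real (exp (- (\<integral>x. \<bar>\<Sum>s\<in>{1::real}. 1 * log_kernel s x\<bar> powr a \<partial>lborel)))"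
      by (rule sas_random_measure_joint_char[OF S]) (use a K in auto)
    ultimately have "complex_of_real (exp (- log_kernel_norm a)) = 1"
      by (simp add: log_kernel_norm_def N.prob_space)
    then have "exp (- log_kernel_norm a) = 1" by (simp only: of_real_eq_1_iff)
    then show False using log_kernel_norm_pos[of a] a by simp
  qed
  then have nontrivial: "\<exists>t. \<not> (AE \<omega> in N. b u * log_frac_stable_motion I t \<omega> = 0)"
    by (auto simp: log_frac_stable_motion_def)
  have "fdd_convergent M (\<lambda>r t \<omega>. r powr (- (1 / a)) * (?Y (u + r * t) \<omega> - ?Y u \<omega>)) N
     (\<lambda>t \<omega>. b u * log_frac_stable_motion I t \<omega>) (at_right 0)"
    unfolding fdd_convergent_def
  proof (intro allI impI)
    fix J :: "real set" and g :: "(real \<Rightarrow> real) \<Rightarrow> real"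
    assume J: "finite J" and g: "continuous_map (product_topology (\<lambda>_. euclideanreal) J) euclideanreal g"
      and bd: "bounded (g ` (J \<rightarrow>\<^sub>E UNIV))"
    define U where "U r t \<omega> = r powr (- 1 / a) * (b u * (lepage_integral a \<Gamma> V \<gamma> (log_kernel (u + r * t)) \<omega> - lepage_integral a \<Gamma> V \<gamma> (log_kernel u) \<omega>))" for r t \<omega>
    have Um: "U r t \<in> borel_measurable M" for r t unfolding U_def by measurable
    have Xm: "(\<lambda>\<omega>. r powr (- (1 / a)) * (?Y (u + r * t) \<omega> - ?Y u \<omega>)) \<in> borel_measurable M" for r t by measurable
    show "((\<lambda>r. \<integral>\<omega>. g (\<lambda>t\<in>J. r powr (- (1 / a)) * (?Y (u + r * t) \<omega> - ?Y u \<omega>)) \<partial>M) \<longlongrightarrow>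
       (\<integral>\<omega>. g (\<lambda>t\<in>J. b u * log_frac_stable_motion I t \<omega>) \<partial>N)) (at_right 0)"
    proof (rule Slutsky_tendsto[OF prob_space_axioms N.prob_space_axioms J g bd Um Xm])
      show "(\<lambda>\<omega>. b u * log_frac_stable_motion I t \<omega>) \<in> borel_measurable N" for t
        unfolding log_frac_stable_motion_def by measurable
      have "\<forall>\<^sub>F r in at_right (0::real). 0 < r" by (simp add: eventually_at_right_less)
      then show "\<forall>\<^sub>F r in at_right 0. distr M (PiM J (\<lambda>_. borel)) (\<lambda>\<omega>. \<lambda>t\<in>J. U r t \<omega>)
          = distr N (PiM J (\<lambda>_. borel)) (\<lambda>\<omega>. \<lambda>t\<in>J. b u * log_frac_stable_motion I t \<omega>)"
        by eventually_elim (simp only: U_def log_frac_stable_motion_def increment_law[OF a S J])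
    next
      fix t \<delta> :: real assume \<delta>: "0 < \<delta>"
      have "prob {\<omega>\<in>space M. \<delta> \<le> \<bar>r powr (- (1 / a)) * (?Y (u + r * t) \<omega> - ?Y u \<omega>) - U r t \<omega>\<bar>}
         = prob {\<omega>\<in>space M. \<delta> \<le> \<bar>r powr (- 1 / \<alpha> u) *
            (b (u + r * t) * lepage_integral (\<alpha> (u + r * t)) \<Gamma> V \<gamma> (log_kernel (u + r * t)) \<omega>
            - b u * lepage_integral (\<alpha> u) \<Gamma> V \<gamma> (log_kernel (u + r * t)) \<omega>)\<bar>}" for r
      proof (rule finite_measure_eq_AE)
        show "AE \<omega> in M. (\<omega> \<in> {\<omega>\<in>space M. \<delta> \<le> \<bar>r powr (- (1 / a)) * (?Y (u + r * t) \<omega> - ?Y u \<omega>) - U r t \<omega>\<bar>}) =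
          (\<omega> \<in> {\<omega>\<in>space M. \<delta> \<le> \<bar>r powr (- 1 / \<alpha> u) *
            (b (u + r * t) * lepage_integral (\<alpha> (u + r * t)) \<Gamma> V \<gamma> (log_kernel (u + r * t)) \<omega>
            - b u * lepage_integral (\<alpha> u) \<Gamma> V \<gamma> (log_kernel (u + r * t)) \<omega>)\<bar>})"
          using log_frac_multistable_motion_AE[of \<alpha> b, OF \<alpha>0]
        proof eventually_elim
          case (elim \<omega>)
          have "r powr (- (1 / a)) * (?Y (u + r * t) \<omega> - ?Y u \<omega>) - U r t \<omega> = r powr (- 1 / \<alpha> u) *
            (b (u + r * t) * lepage_integral (\<alpha> (u + r * t)) \<Gamma> V \<gamma> (log_kernel (u + r * t)) \<omega>
            - b u * lepage_integral (\<alpha> u) \<Gamma> V \<gamma> (log_kernel (u + r * t)) \<omega>)"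
            unfolding U_def elim[rule_format] a_def by (simp add: algebra_simps)
          then show ?case by (simp only: mem_Collect_eq)
        qed
      qed (use Um in measurable)
      then show "((\<lambda>r. prob {\<omega>\<in>space M. \<delta> \<le> \<bar>r powr (- (1 / a)) * (?Y (u + r * t) \<omega> - ?Y u \<omega>) - U r t \<omega>\<bar>}) \<longlongrightarrow> 0) (at_right 0)"
        using freezing_error_tendsto_0[OF cd \<alpha>L bL \<delta>, where s=t] by (simp only:)
    qed
  qed
  then show ?thesis
    unfolding has_local_form_def stochastic_process_def using nontrivial prob_space_axioms N.prob_space_axioms
    by (auto simp: a_def log_frac_stable_motion_def)
qed

end

theorem theorem8:
  fixes M :: "'w measure"
    and \<Gamma> V \<gamma> :: "nat \<Rightarrow> 'w \<Rightarrow> real"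
    and \<alpha> b :: "real \<Rightarrow> real"
    and c d :: real
  assumes "prob_space M"
    and "1 < c" and "d < 2" and "\<And>t. \<alpha> t \<in> {c..d}"
    and "\<alpha> C1_differentiable_on UNIV"
    and "\<And>t. b t > 0"
    and "b C1_differentiable_on UNIV"
    and "poisson_arrival_times M 1 \<Gamma>"
    and "prob_space.indep_vars M (\<lambda>_. borel) V UNIV"
    and "\<And>i. distributed M lborel (V i) m_hat_density"
    and "prob_space.indep_vars M (\<lambda>_. borel) \<gamma> UNIV"
    and "\<And>i. measure M {\<omega> \<in> space M. \<gamma> i \<omega> = 1} = 1 / 2"
    and "\<And>i. measure M {\<omega> \<in> space M. \<gamma> i \<omega> = - 1} = 1 / 2"
    and "prob_space.indep_vars M (\<lambda>_. PiM UNIV (\<lambda>_. borel))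
           (\<lambda>k \<omega> i. ([\<Gamma>, V, \<gamma>] ! k) i \<omega>) {..<3::nat}"
  defines "Y \<equiv> log_frac_multistable_motion \<alpha> b \<Gamma> V \<gamma>"
  shows "\<forall>u. localisable_at M Y (1 / \<alpha> u) u \<and>
           (\<exists>(N :: (real \<Rightarrow> real) measure) I. sas_random_measure N (\<alpha> u) I) \<and>
           (\<forall>(N :: 'v measure) I. sas_random_measure N (\<alpha> u) I \<longrightarrow>
              has_local_form M Y (1 / \<alpha> u) u N
                (\<lambda>t \<omega>. b u * log_frac_stable_motion I t \<omega>))"
proof
  fix u
  interpret lepage_variables M \<Gamma> V \<gamma>
    by (rule lepage_variables.intro[OF assms(1)], rule lepage_variables_axioms.intro) (fact assms)+
  have Lipschitz: "locally_Lipschitz_at h u" if h: "h C1_differentiable_on UNIV" for h :: "real \<Rightarrow> real"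
  proof -
    have "h differentiable (at u)" using h by (simp add: C1_differentiable_on_eq)
    then show ?thesis
      using locally_Lipschitz_at_differentiable by (auto simp: real_differentiable_def)
  qed
  note local_form = has_local_form_log_frac_multistable_motion[OF assms(2-4) Lipschitz[OF assms(5)]
      Lipschitz[OF assms(7)] less_imp_neq[OF assms(6), symmetric], folded Y_def]
  have "1 < \<alpha> u" "\<alpha> u < 2" using assms(2,3) assms(4)[of u] by auto
  then have ex: "\<exists>(N :: (real \<Rightarrow> real) measure) I. sas_random_measure N (\<alpha> u) I"
    by (rule ex_sas_random_measure)
  then obtain N0 :: "(real \<Rightarrow> real) measure" and I0 where "sas_random_measure N0 (\<alpha> u) I0"
    by blast
  from local_form[OF this] have "localisable_at M Y (1 / \<alpha> u) u"
    unfolding localisable_at_def by blast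
  then show "localisable_at M Y (1 / \<alpha> u) u \<and>
           (\<exists>(N :: (real \<Rightarrow> real) measure) I. sas_random_measure N (\<alpha> u) I) \<and>
           (\<forall>(N :: 'v measure) I. sas_random_measure N (\<alpha> u) I \<longrightarrow>
              has_local_form M Y (1 / \<alpha> u) u N
                (\<lambda>t \<omega>. b u * log_frac_stable_motion I t \<omega>))"
    using ex local_form by blast
qed

end
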